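(* $(C(\Pi_\infty),\ell^2(E),D)$ is an even spectral triple with $\mathbb Z/2$-grading $\chi$, and its representation is faithful. If $\hat{\mathcal H}$ is sufficiently large, i.e. for all $\varepsilon,\varepsilon'\in\mathcal E$ with $s(\varepsilon)=s(\varepsilon')$ there is a path in $\hat{\mathcal H}$ linking $\varepsilon$ to $\varepsilon'$, then its spectral distance $d_s$ is compatible with the topology of $\Pi_\infty$, and one has $$d_s(x,y)=c_{xy}\rho^{n_{xy}}+\sum_{n>n_{xy}}\big(b_n(x)+b_n(y)\big)\rho^n\qquad\text{for }x\neq y,$$ where $n_{xy}$ is the largest integer such that $x_i=y_i$ for $i<n_{xy}$, and $b_n(z)=1$ if $\hat\tau(z_n)\neq z_{n+1}$ and $b_n(z)=0$ otherwise, for any $z\in\Pi_\infty$. The coefficient $c_{xy}$ is the number of edges in a shortest path in $\hat{\mathcal H}$ linking $x_{n_{xy}}$ to $y_{n_{xy}}$. If $\hat{\mathcal H}$ is maximal, that is $\hat{\mathcal H}=\{(\varepsilon,\varepsilon')\in\mathcal E\times\mathcal E:\varepsilon\neq\varepsilon',\ s(\varepsilon)=s(\varepsilon')\}$, then $c_{xy}=1$ for all $x,y\in\Pi_\infty$.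
   Context: Data. $\mathcal G=(\mathcal V,\mathcal E)$ is a finite oriented graph with source and range maps $s,r:\mathcal E\to\mathcal V$; its graph matrix $A$ has entries $A_{vw}=$ number of edges with source $v$ and range $w$, and is assumed primitive (some power of $A$ has only positive entries). $l^*\in\mathcal E$ is a distinguished one-edge loop. $\hat\tau:\mathcal E\to\mathcal E$ satisfies: if $r(\varepsilon)$ is the vertex of $l^*$ then $\hat\tau(\varepsilon)=l^*$; otherwise $\hat\tau(\varepsilon)$ starts at $r(\varepsilon)$ and its range is closer to the vertex of $l^*$ (combinatorial graph metric, non-loop edges having length 1 and loop edges length 0). $\hat{\mathcal H}$ is a symmetric subset of $\{(\varepsilon,\varepsilon')\in\mathcal E\times\mathcal E:\varepsilon\ne\varepsilon',\ s(\varepsilon)=s(\varepsilon')\}$, viewed as a graph with vertex set $\mathcal E$; an orientation is fixed, i.e. $\hat{\mathcal H}=\hat{\mathcal H}^+\sqcup\hat{\mathcal H}^-$, the two parts being exchanged by $(\varepsilon,\varepsilon')\mapsto(\varepsilon',\varepsilon)$. Finally $\rho\in(0,1)$. Spectral triple. $\Pi_n$ is the set of paths $\varepsilon_1\cdots\varepsilon_n$ of length $n$ ($r(\varepsilon_i)=s(\varepsilon_{i+1})$; $\Pi_0=\mathcal V$), and $\Pi_\infty$ the compact space of one-sided infinite paths $x=x_1x_2\cdots$. For $n\ge1$, $\tau:\Pi_n\to\Pi_\infty$ is $\tau(\varepsilon_1\cdots\varepsilon_n)=\varepsilon_1\cdots\varepsilon_n\hat\tau(\varepsilon_n)\hat\tau^2(\varepsilon_n)\cdots$.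 For $n\ge 1$, $E_n$ is the set of pairs $e=(\tau(\eta\varepsilon),\tau(\eta\varepsilon'))$ with $\eta\in\Pi_{n-1}$ ending at $s(\varepsilon)$ and $(\varepsilon,\varepsilon')\in\hat{\mathcal H}$; $s(e)$ and $r(e)$ are the first and second components, $e^{op}$ is the reversed pair; $E=\bigcup_{n\ge1}E_n=E^+\sqcup E^-$ with the orientation inherited from $\hat{\mathcal H}$. $\pi(f)\varphi(e)=f(s(e))\varphi(e)$ and $D\varphi(e)=\rho^{-n}\varphi(e^{op})$ for $e\in E_n$. $\chi$ is the grading given by the orientation, i.e. by the decomposition $\ell^2(E)=\ell^2(E^+)\oplus\ell^2(E^-)$: it is $+1$ on $\ell^2(E^+)$ and $-1$ on $\ell^2(E^-)$. A spectral triple for a unital $C^*$-algebra consists of a faithful representation and a self-adjoint $D$ with compact resolvent such that the elements having bounded commutator with $D$ form a dense subalgebra; it is even if there is a $\mathbb Z/2$-grading operator commuting with the representation and anticommuting with $D$. The spectral distance is $d_s(x,y)=\sup\{|f(x)-f(y)|:f\in C(\Pi_\infty),\ \|[D,\pi(f)]\|\le1\}$.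
   Formalization: As printed the claim fails; here b_n(z) is the Ĥ-distance from τ̂(z_{n-1}) to z_n (for maximal Ĥ: 1 if τ̂(z_{n-1})≠z_n, else 0), the spectral-triple and faithfulness claim assumes Ĥ nonempty, and c_xy=1 is claimed for x≠y with s(x_1)=s(y_1). *)

theory Defs
  imports "HOL-Analysis.Analysis" "Graph_Theory.Digraph" "Graph_Theory.Shortest_Path"
begin

section \<open>The Hilbert space of square-summable functions on a set\<close>

text \<open>Elements are functions on the whole index type that vanish outside the index set.\<close>

definition ell2 :: "'i set \<Rightarrow> ('i \<Rightarrow> complex) set" where
  "ell2 I = {\<phi>. (\<forall>i. i \<notin> I \<longrightarrow> \<phi> i = 0) \<and> (\<lambda>i. (cmod (\<phi> i))\<^sup>2) summable_on I}"

definition ell2_inner :: "'i set \<Rightarrow> ('i \<Rightarrow> complex) \<Rightarrow> ('i \<Rightarrow> complex) \<Rightarrow> complex" where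
  "ell2_inner I \<phi> \<psi> = (\<Sum>\<^sub>\<infinity>i\<in>I. cnj (\<phi> i) * \<psi> i)"

definition ell2_norm :: "'i set \<Rightarrow> ('i \<Rightarrow> complex) \<Rightarrow> real" where
  "ell2_norm I \<phi> = sqrt (\<Sum>\<^sub>\<infinity>i\<in>I. (cmod (\<phi> i))\<^sup>2)"

type_synonym 'i operator = "('i \<Rightarrow> complex) \<Rightarrow> ('i \<Rightarrow> complex)"

text \<open>A possibly unbounded operator is given by its domain \<open>\<D>\<close> and its action \<open>T\<close> on \<open>\<D>\<close>.\<close>

definition lin_operator :: "'i set \<Rightarrow> ('i \<Rightarrow> complex) set \<Rightarrow> 'i operator \<Rightarrow> bool" where
  "lin_operator I \<D> T \<longleftrightarrow>
     \<D> \<subseteq> ell2 I \<and> (\<lambda>i. 0) \<in> \<D> \<and>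
     (\<forall>\<phi>\<in>\<D>. \<forall>\<psi>\<in>\<D>. (\<lambda>i. \<phi> i + \<psi> i) \<in> \<D> \<and>
        T (\<lambda>i. \<phi> i + \<psi> i) = (\<lambda>i. T \<phi> i + T \<psi> i)) \<and>
     (\<forall>c. \<forall>\<phi>\<in>\<D>. (\<lambda>i. c * \<phi> i) \<in> \<D> \<and> T (\<lambda>i. c * \<phi> i) = (\<lambda>i. c * T \<phi> i)) \<and>
     (\<forall>\<phi>\<in>\<D>. T \<phi> \<in> ell2 I)"

definition operator_norm :: "'i set \<Rightarrow> ('i \<Rightarrow> complex) set \<Rightarrow> 'i operator \<Rightarrow> ereal" where
  "operator_norm I \<D> T = (SUP \<phi>\<in>{\<phi>\<in>\<D>. ell2_norm I \<phi> \<le> 1}. ereal (ell2_norm I (T \<phi>)))"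

definition bounded_operator :: "'i set \<Rightarrow> 'i operator \<Rightarrow> bool" where
  "bounded_operator I T \<longleftrightarrow> lin_operator I (ell2 I) T \<and> operator_norm I (ell2 I) T < \<infinity>"

text \<open>Densely defined, and the graph of \<open>T\<close> equals the graph of its adjoint.\<close>

definition self_adjoint_operator :: "'i set \<Rightarrow> ('i \<Rightarrow> complex) set \<Rightarrow> 'i operator \<Rightarrow> bool" where
  "self_adjoint_operator I \<D> T \<longleftrightarrow>
     lin_operator I \<D> T \<and>
     (\<forall>\<phi>\<in>ell2 I. \<forall>\<delta>>0. \<exists>\<psi>\<in>\<D>. ell2_norm I (\<lambda>i. \<phi> i - \<psi> i) < \<delta>) \<and>
     (\<forall>\<psi>\<in>ell2 I. \<forall>\<xi>\<in>ell2 I.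
        (\<psi> \<in> \<D> \<and> T \<psi> = \<xi>) \<longleftrightarrow> (\<forall>\<phi>\<in>\<D>. ell2_inner I (T \<phi>) \<psi> = ell2_inner I \<phi> \<xi>))"

definition compact_operator :: "'i set \<Rightarrow> 'i operator \<Rightarrow> bool" where
  "compact_operator I K \<longleftrightarrow>
     lin_operator I (ell2 I) K \<and>
     (\<forall>u :: nat \<Rightarrow> 'i \<Rightarrow> complex.
        (\<forall>k. u k \<in> ell2 I \<and> ell2_norm I (u k) \<le> 1) \<longrightarrow>
        (\<exists>\<psi>\<in>ell2 I. \<exists>j :: nat \<Rightarrow> nat. strict_mono j \<and>
           (\<lambda>k. ell2_norm I (\<lambda>i. K (u (j k)) i - \<psi> i)) \<longlonglongrightarrow> 0))"

text \<open>For self-adjoint \<open>T\<close>: all resolvents at non-real points exist and are compact.\<close>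

definition compact_resolvent :: "'i set \<Rightarrow> ('i \<Rightarrow> complex) set \<Rightarrow> 'i operator \<Rightarrow> bool" where
  "compact_resolvent I \<D> T \<longleftrightarrow>
     (\<forall>z. z \<notin> \<real> \<longrightarrow>
        bij_betw (\<lambda>\<phi> i. T \<phi> i - z * \<phi> i) \<D> (ell2 I) \<and>
        compact_operator I (inv_into \<D> (\<lambda>\<phi> i. T \<phi> i - z * \<phi> i)))"


section \<open>Spectral triples for the algebra of continuous functions on a compact space\<close>

text \<open>Continuous functions are normalised to vanish outside the space, so that equality of
  functions is equality in the algebra; all operations are pointwise.\<close>

definition cont_alg :: "'x topology \<Rightarrow> ('x \<Rightarrow> complex) set" where
  "cont_alg X = {f. continuous_map X euclidean f \<and> (\<forall>x. x \<notin> topspace X \<longrightarrow> f x = 0)}"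

definition star_representation ::
    "'x topology \<Rightarrow> 'i set \<Rightarrow> (('x \<Rightarrow> complex) \<Rightarrow> 'i operator) \<Rightarrow> bool" where
  "star_representation X I \<pi> \<longleftrightarrow>
     (\<forall>f\<in>cont_alg X. bounded_operator I (\<pi> f)) \<and>
     (\<forall>f\<in>cont_alg X. \<forall>g\<in>cont_alg X. \<forall>\<phi>\<in>ell2 I.
        \<pi> (\<lambda>x. f x + g x) \<phi> = (\<lambda>i. \<pi> f \<phi> i + \<pi> g \<phi> i) \<and>
        \<pi> (\<lambda>x. f x * g x) \<phi> = \<pi> f (\<pi> g \<phi>)) \<and>
     (\<forall>c. \<forall>f\<in>cont_alg X. \<forall>\<phi>\<in>ell2 I. \<pi> (\<lambda>x. c * f x) \<phi> = (\<lambda>i. c * \<pi> f \<phi> i)) \<and>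
     (\<forall>\<phi>\<in>ell2 I. \<pi> (\<lambda>x. if x \<in> topspace X then 1 else 0) \<phi> = \<phi>) \<and>
     (\<forall>f\<in>cont_alg X. \<forall>\<phi>\<in>ell2 I. \<forall>\<psi>\<in>ell2 I.
        ell2_inner I (\<pi> (\<lambda>x. cnj (f x)) \<phi>) \<psi> = ell2_inner I \<phi> (\<pi> f \<psi>))"

definition faithful_representation ::
    "'x topology \<Rightarrow> 'i set \<Rightarrow> (('x \<Rightarrow> complex) \<Rightarrow> 'i operator) \<Rightarrow> bool" where
  "faithful_representation X I \<pi> \<longleftrightarrow>
     star_representation X I \<pi> \<and>
     (\<forall>f\<in>cont_alg X. \<forall>g\<in>cont_alg X. (\<forall>\<phi>\<in>ell2 I. \<pi> f \<phi> = \<pi> g \<phi>) \<longrightarrow> f = g)"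

definition commutator :: "'i operator \<Rightarrow> 'i operator \<Rightarrow> 'i operator" where
  "commutator S T \<phi> = (\<lambda>i. S (T \<phi>) i - T (S \<phi>) i)"

text \<open>The functions \<open>f\<close> for which \<open>[D, \<pi> f]\<close> is defined on the domain of \<open>D\<close> and bounded.\<close>

definition bounded_commutator_alg ::
    "'x topology \<Rightarrow> 'i set \<Rightarrow> (('x \<Rightarrow> complex) \<Rightarrow> 'i operator) \<Rightarrow>
     ('i \<Rightarrow> complex) set \<Rightarrow> 'i operator \<Rightarrow> ('x \<Rightarrow> complex) set" where
  "bounded_commutator_alg X I \<pi> \<D> D =
     {f\<in>cont_alg X. \<pi> f ` \<D> \<subseteq> \<D> \<and> operator_norm I \<D> (commutator D (\<pi> f)) < \<infinity>}"

definition dense_subalgebra :: "'x topology \<Rightarrow> ('x \<Rightarrow> complex) set \<Rightarrow> bool" where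
  "dense_subalgebra X A \<longleftrightarrow>
     A \<subseteq> cont_alg X \<and> (\<lambda>x. 0) \<in> A \<and>
     (\<forall>f\<in>A. \<forall>g\<in>A. (\<lambda>x. f x + g x) \<in> A \<and> (\<lambda>x. f x * g x) \<in> A) \<and>
     (\<forall>c. \<forall>f\<in>A. (\<lambda>x. c * f x) \<in> A) \<and>
     (\<forall>f\<in>cont_alg X. \<forall>\<delta>>0. \<exists>g\<in>A. \<forall>x\<in>topspace X. cmod (f x - g x) < \<delta>)"

definition spectral_triple ::
    "'x topology \<Rightarrow> 'i set \<Rightarrow> (('x \<Rightarrow> complex) \<Rightarrow> 'i operator) \<Rightarrow>
     ('i \<Rightarrow> complex) set \<Rightarrow> 'i operator \<Rightarrow> bool" where
  "spectral_triple X I \<pi> \<D> D \<longleftrightarrow>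
     compact_space X \<and> Hausdorff_space X \<and>
     faithful_representation X I \<pi> \<and>
     self_adjoint_operator I \<D> D \<and>
     compact_resolvent I \<D> D \<and>
     dense_subalgebra X (bounded_commutator_alg X I \<pi> \<D> D)"

definition even_spectral_triple ::
    "'x topology \<Rightarrow> 'i set \<Rightarrow> (('x \<Rightarrow> complex) \<Rightarrow> 'i operator) \<Rightarrow>
     ('i \<Rightarrow> complex) set \<Rightarrow> 'i operator \<Rightarrow> 'i operator \<Rightarrow> bool" where
  "even_spectral_triple X I \<pi> \<D> D \<gamma> \<longleftrightarrow>
     spectral_triple X I \<pi> \<D> D \<and>
     bounded_operator I \<gamma> \<and>
     (\<forall>\<phi>\<in>ell2 I. \<gamma> (\<gamma> \<phi>) = \<phi>) \<and>
     (\<forall>\<phi>\<in>ell2 I. \<forall>\<psi>\<in>ell2 I. ell2_inner I (\<gamma> \<phi>) \<psi> = ell2_inner I \<phi> (\<gamma> \<psi>)) \<and>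
     (\<forall>f\<in>cont_alg X. \<forall>\<phi>\<in>ell2 I. \<gamma> (\<pi> f \<phi>) = \<pi> f (\<gamma> \<phi>)) \<and>
     (\<forall>\<phi>\<in>\<D>. \<gamma> \<phi> \<in> \<D> \<and> D (\<gamma> \<phi>) = (\<lambda>i. - \<gamma> (D \<phi>) i))"

definition spectral_distance ::
    "'x topology \<Rightarrow> 'i set \<Rightarrow> (('x \<Rightarrow> complex) \<Rightarrow> 'i operator) \<Rightarrow>
     ('i \<Rightarrow> complex) set \<Rightarrow> 'i operator \<Rightarrow> 'x \<Rightarrow> 'x \<Rightarrow> ereal" where
  "spectral_distance X I \<pi> \<D> D x y =
     (SUP f\<in>{f\<in>bounded_commutator_alg X I \<pi> \<D> D.
              operator_norm I \<D> (commutator D (\<pi> f)) \<le> 1}.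
        ereal (cmod (f x - f y)))"

text \<open>The spectral distance may take the value \<open>\<infinity>\<close>, so compatibility is that of an extended metric.\<close>

definition compatible_extended_metric :: "'x topology \<Rightarrow> ('x \<Rightarrow> 'x \<Rightarrow> ereal) \<Rightarrow> bool" where
  "compatible_extended_metric X d \<longleftrightarrow>
     (\<forall>x\<in>topspace X. \<forall>y\<in>topspace X. 0 \<le> d x y \<and> (d x y = 0 \<longleftrightarrow> x = y) \<and> d x y = d y x) \<and>
     (\<forall>x\<in>topspace X. \<forall>y\<in>topspace X. \<forall>z\<in>topspace X. d x z \<le> d x y + d y z) \<and>
     (\<forall>U. openin X U \<longleftrightarrow>
        U \<subseteq> topspace X \<and>
        (\<forall>x\<in>U. \<exists>\<delta>>0. \<forall>y\<in>topspace X. d x y < ereal \<delta> \<longrightarrow> y \<in> U))"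


section \<open>The graph data\<close>

text \<open>Entries of the graph matrix and of its powers.\<close>

definition graph_matrix :: "('v, 'e) pre_digraph \<Rightarrow> 'v \<Rightarrow> 'v \<Rightarrow> nat" where
  "graph_matrix G v w = card {\<epsilon>\<in>arcs G. tail G \<epsilon> = v \<and> head G \<epsilon> = w}"

fun graph_matrix_pow :: "('v, 'e) pre_digraph \<Rightarrow> nat \<Rightarrow> 'v \<Rightarrow> 'v \<Rightarrow> nat" where
  "graph_matrix_pow G 0 v w = (if v = w then 1 else 0)"
| "graph_matrix_pow G (Suc k) v w = (\<Sum>u\<in>verts G. graph_matrix G v u * graph_matrix_pow G k u w)"

definition primitive_graph :: "('v, 'e) pre_digraph \<Rightarrow> bool" where
  "primitive_graph G \<longleftrightarrow> (\<exists>k\<ge>1. \<forall>v\<in>verts G. \<forall>w\<in>verts G. graph_matrix_pow G k v w > 0)"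

text \<open>Length of a shortest oriented path, loops having length \<open>0\<close> and other edges length \<open>1\<close>.\<close>

definition graph_dist :: "('v, 'e) pre_digraph \<Rightarrow> 'v \<Rightarrow> 'v \<Rightarrow> ereal" where
  "graph_dist G = wf_digraph.\<mu> G (\<lambda>\<epsilon>. if tail G \<epsilon> = head G \<epsilon> then 0 else 1)"

definition maximal_horizontal :: "('v, 'e) pre_digraph \<Rightarrow> ('e \<times> 'e) set" where
  "maximal_horizontal G =
     {(\<epsilon>, \<epsilon>'). \<epsilon> \<in> arcs G \<and> \<epsilon>' \<in> arcs G \<and> \<epsilon> \<noteq> \<epsilon>' \<and> tail G \<epsilon> = tail G \<epsilon>'}"

locale horizontal_data = fin_digraph G
  for G :: "('v, 'e) pre_digraph" +
  fixes lstar :: 'e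
    and \<tau>h :: "'e \<Rightarrow> 'e"
    and H Hp Hm :: "('e \<times> 'e) set"
    and \<rho> :: real
  assumes primitive: "primitive_graph G"
    and lstar: "lstar \<in> arcs G" "tail G lstar = head G lstar"
    and \<tau>h_lstar: "\<And>\<epsilon>. \<epsilon> \<in> arcs G \<Longrightarrow> head G \<epsilon> = tail G lstar \<Longrightarrow> \<tau>h \<epsilon> = lstar"
    and \<tau>h_closer: "\<And>\<epsilon>. \<epsilon> \<in> arcs G \<Longrightarrow> head G \<epsilon> \<noteq> tail G lstar \<Longrightarrow>
          \<tau>h \<epsilon> \<in> arcs G \<and> tail G (\<tau>h \<epsilon>) = head G \<epsilon> \<and>
          graph_dist G (head G (\<tau>h \<epsilon>)) (tail G lstar) < graph_dist G (head G \<epsilon>) (tail G lstar)"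
    and H_subset: "H \<subseteq> maximal_horizontal G"
    and H_sym: "sym H"
    and orientation: "H = Hp \<union> Hm" "Hp \<inter> Hm = {}" "Hm = Hp\<inverse>"
    and \<rho>: "0 < \<rho>" "\<rho> < 1"

text \<open>\<open>H\<close> viewed as a graph whose vertices are the edges of \<open>G\<close>.\<close>

definition horizontal_graph :: "('v, 'e) pre_digraph \<Rightarrow> ('e \<times> 'e) set \<Rightarrow> ('e, 'e \<times> 'e) pre_digraph"
  where "horizontal_graph G H = \<lparr>verts = arcs G, arcs = H, tail = fst, head = snd\<rparr>"

definition sufficiently_large :: "('v, 'e) pre_digraph \<Rightarrow> ('e \<times> 'e) set \<Rightarrow> bool" where
  "sufficiently_large G H \<longleftrightarrow>
     (\<forall>\<epsilon>\<in>arcs G. \<forall>\<epsilon>'\<in>arcs G. tail G \<epsilon> = tail G \<epsilon>' \<longrightarrow> \<epsilon> \<rightarrow>\<^sup>*\<^bsub>horizontal_graph G H\<^esub> \<epsilon>')"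

text \<open>Number of edges in a shortest path in \<open>H\<close>; it is \<open>\<infinity>\<close> if there is no path.\<close>

definition horizontal_dist :: "('v, 'e) pre_digraph \<Rightarrow> ('e \<times> 'e) set \<Rightarrow> 'e \<Rightarrow> 'e \<Rightarrow> ereal" where
  "horizontal_dist G H = wf_digraph.\<mu> (horizontal_graph G H) (\<lambda>_. 1)"


section \<open>Path space and spectral triple\<close>

text \<open>A path \<open>x\<^sub>1 x\<^sub>2 \<dots>\<close> is a function on \<open>nat\<close> starting at index \<open>0\<close>; \<open>letter x i\<close> is \<open>x\<^sub>i\<close>.\<close>

definition letter :: "(nat \<Rightarrow> 'e) \<Rightarrow> nat \<Rightarrow> 'e" where
  "letter x i = x (i - 1)"

definition inf_paths :: "('v, 'e) pre_digraph \<Rightarrow> (nat \<Rightarrow> 'e) set" where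
  "inf_paths G = {x. \<forall>i. x i \<in> arcs G \<and> head G (x i) = tail G (x (Suc i))}"

definition path_space :: "('v, 'e) pre_digraph \<Rightarrow> (nat \<Rightarrow> 'e) topology" where
  "path_space G =
     subtopology (product_topology (\<lambda>_. discrete_topology (arcs G)) UNIV) (inf_paths G)"

definition extend_path :: "('e \<Rightarrow> 'e) \<Rightarrow> 'e list \<Rightarrow> (nat \<Rightarrow> 'e)" where
  "extend_path \<tau>h es =
     (\<lambda>i. if i < length es then es ! i else (\<tau>h ^^ (Suc i - length es)) (last es))"

definition hor_edges_level ::
    "('v, 'e) pre_digraph \<Rightarrow> ('e \<Rightarrow> 'e) \<Rightarrow> ('e \<times> 'e) set \<Rightarrow> nat \<Rightarrow> ((nat \<Rightarrow> 'e) \<times> (nat \<Rightarrow> 'e)) set"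
  where "hor_edges_level G \<tau>h H n =
     {(extend_path \<tau>h (\<eta> @ [\<epsilon>]), extend_path \<tau>h (\<eta> @ [\<epsilon>'])) | \<eta> \<epsilon> \<epsilon>'.
        length \<eta> = n - 1 \<and> (\<epsilon>, \<epsilon>') \<in> H \<and> (\<exists>u. pre_digraph.awalk G u \<eta> (tail G \<epsilon>))}"

definition hor_edges ::
    "('v, 'e) pre_digraph \<Rightarrow> ('e \<Rightarrow> 'e) \<Rightarrow> ('e \<times> 'e) set \<Rightarrow> ((nat \<Rightarrow> 'e) \<times> (nat \<Rightarrow> 'e)) set"
  where "hor_edges G \<tau>h H = (\<Union>n\<in>{1..}. hor_edges_level G \<tau>h H n)"

definition level ::
    "('v, 'e) pre_digraph \<Rightarrow> ('e \<Rightarrow> 'e) \<Rightarrow> ('e \<times> 'e) set \<Rightarrow> (nat \<Rightarrow> 'e) \<times> (nat \<Rightarrow> 'e) \<Rightarrow> nat"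
  where "level G \<tau>h H e = (THE n. 1 \<le> n \<and> e \<in> hor_edges_level G \<tau>h H n)"

definition path_rep ::
    "((nat \<Rightarrow> 'e) \<Rightarrow> complex) \<Rightarrow> ((nat \<Rightarrow> 'e) \<times> (nat \<Rightarrow> 'e)) operator" where
  "path_rep f \<phi> = (\<lambda>e. f (fst e) * \<phi> e)"

definition dirac ::
    "('v, 'e) pre_digraph \<Rightarrow> ('e \<Rightarrow> 'e) \<Rightarrow> ('e \<times> 'e) set \<Rightarrow> real \<Rightarrow>
     ((nat \<Rightarrow> 'e) \<times> (nat \<Rightarrow> 'e)) operator" where
  "dirac G \<tau>h H \<rho> \<phi> =
     (\<lambda>e. complex_of_real (\<rho> powi (- int (level G \<tau>h H e))) * \<phi> (prod.swap e))"

definition dirac_dom ::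
    "('v, 'e) pre_digraph \<Rightarrow> ('e \<Rightarrow> 'e) \<Rightarrow> ('e \<times> 'e) set \<Rightarrow> real \<Rightarrow>
     ((nat \<Rightarrow> 'e) \<times> (nat \<Rightarrow> 'e) \<Rightarrow> complex) set" where
  "dirac_dom G \<tau>h H \<rho> =
     {\<phi>\<in>ell2 (hor_edges G \<tau>h H). dirac G \<tau>h H \<rho> \<phi> \<in> ell2 (hor_edges G \<tau>h H)}"

text \<open>On \<open>ell2 (hor_edges G \<tau>h H)\<close> the second case concerns only the edges over \<open>Hm\<close>.\<close>

definition grading ::
    "('v, 'e) pre_digraph \<Rightarrow> ('e \<Rightarrow> 'e) \<Rightarrow> ('e \<times> 'e) set \<Rightarrow>
     ((nat \<Rightarrow> 'e) \<times> (nat \<Rightarrow> 'e)) operator" where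
  "grading G \<tau>h Hp \<phi> = (\<lambda>e. if e \<in> hor_edges G \<tau>h Hp then \<phi> e else - \<phi> e)"

definition path_dist ::
    "('v, 'e) pre_digraph \<Rightarrow> ('e \<Rightarrow> 'e) \<Rightarrow> ('e \<times> 'e) set \<Rightarrow> real \<Rightarrow>
     (nat \<Rightarrow> 'e) \<Rightarrow> (nat \<Rightarrow> 'e) \<Rightarrow> ereal" where
  "path_dist G \<tau>h H \<rho> =
     spectral_distance (path_space G) (hor_edges G \<tau>h H) path_rep
       (dirac_dom G \<tau>h H \<rho>) (dirac G \<tau>h H \<rho>)"

definition split_index :: "(nat \<Rightarrow> 'e) \<Rightarrow> (nat \<Rightarrow> 'e) \<Rightarrow> nat" where
  "split_index x y = (GREATEST n. \<forall>i. 1 \<le> i \<and> i < n \<longrightarrow> letter x i = letter y i)"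

definition split_coeff ::
    "('v, 'e) pre_digraph \<Rightarrow> ('e \<times> 'e) set \<Rightarrow> (nat \<Rightarrow> 'e) \<Rightarrow> (nat \<Rightarrow> 'e) \<Rightarrow> ereal" where
  "split_coeff G H x y =
     horizontal_dist G H (letter x (split_index x y)) (letter y (split_index x y))"

text \<open>The coefficient of \<open>\<rho> ^ n\<close> for \<open>n \<ge> 2\<close>: moving from the extension of \<open>z\<^sub>1 \<dots> z\<^bsub>n-1\<^esub>\<close> to that
  of \<open>z\<^sub>1 \<dots> z\<^sub>n\<close> replaces the \<open>n\<close>-th letter \<open>\<tau>h z\<^bsub>n-1\<^esub>\<close> by \<open>z\<^sub>n\<close>, through edges of level \<open>n\<close>.
  It vanishes iff \<open>\<tau>h z\<^bsub>n-1\<^esub> = z\<^sub>n\<close>. If \<open>H\<close> is not maximal it may exceed \<open>1\<close>.\<close>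

definition branch_coeff ::
    "('v, 'e) pre_digraph \<Rightarrow> ('e \<Rightarrow> 'e) \<Rightarrow> ('e \<times> 'e) set \<Rightarrow> (nat \<Rightarrow> 'e) \<Rightarrow> nat \<Rightarrow> ereal" where
  "branch_coeff G \<tau>h H z n = horizontal_dist G H (\<tau>h (letter z (n - 1))) (letter z n)"

end

theory Submission
  imports Defs
begin

text \<open>The pairs \<open>{e, e\<^sup>o\<^sup>p}\<close> split \<open>D\<close> into finite-dimensional blocks with eigenvalues
  \<open>\<plusminus> \<rho>\<close> to the power \<open>-n\<close>, and only finitely many blocks occur at each level \<open>n\<close>; this gives
  self-adjointness and compact resolvent. The commutator with \<open>f\<close> is bounded by \<open>C\<close> iff
  \<open>f\<close> varies by at most \<open>C * \<rho> ^ n\<close> along the edges of level \<open>n\<close>, which locally constant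
  functions satisfy.

  Hence the spectral distance is dual to a length metric. Going from \<open>x\<close> to \<open>y\<close> through the
  extensions of their finite prefixes bounds it from above by the claimed formula. Conversely, the
  formula is a sum over the levels of terms each satisfying the triangle inequality, so the
  distance to \<open>x\<close> that it defines is itself an admissible function, and it attains the bound.\<close>

section \<open>Square-summable functions\<close>

text \<open>All analysis of \<open>D\<close> uses only an index set with an involution and a
  positive invariant weight whose sublevel sets are finite; the graph enters through the finiteness
  of each level and \<open>\<rho> < 1\<close>. Faithfulness is where primitivity acts: a
  multiplication operator sees \<open>f\<close> only at the sources of edges, and these are dense as
  soon as \<open>H\<close> contains a pair; for empty \<open>H\<close> the Hilbert space is zero.
  The obstacle in the lower bound is the triangle inequality, because the shape of the claimed
  formula depends on where two paths split. Writing it as one series with a coefficient for every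
  index turns this into a case distinction on which prefixes agree. Paths with a common prefix share
  the letter prescribed by \<open>\<tau>h\<close>, and this letter serves as a base point among the
  possible next letters. No edge changes the start vertex of a path. Hence paths from different
  vertices have infinite distance, and the metric is an extended one. Paths are indexed from 0 and
  levels from 1, so the letter at index \<open>i\<close> carries the weight
  \<open>\<rho> ^ Suc i\<close>.\<close>

lemma ell2_zero: "\<phi> \<in> ell2 I \<Longrightarrow> i \<notin> I \<Longrightarrow> \<phi> i = 0"
  by (simp add: ell2_def)

lemma ell2_norm_nonneg [simp]: "0 \<le> ell2_norm I \<phi>"
  by (simp add: ell2_norm_def infsum_nonneg)

lemma ell2_norm_power2: "(ell2_norm I \<phi>)\<^sup>2 = (\<Sum>\<^sub>\<infinity>i\<in>I. (cmod (\<phi> i))\<^sup>2)"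
  by (simp add: ell2_norm_def infsum_nonneg)

text \<open>Uniformly bounded finite partial sums give summability and the norm bound at once, so
  that later estimates reduce to finite sums.\<close>

lemma ell2_boundedI:
  assumes "\<And>i. i \<notin> I \<Longrightarrow> \<phi> i = 0"
    and "\<And>F. finite F \<Longrightarrow> F \<subseteq> I \<Longrightarrow> (\<Sum>i\<in>F. (cmod (\<phi> i))\<^sup>2) \<le> B"
  shows "\<phi> \<in> ell2 I" and "(ell2_norm I \<phi>)\<^sup>2 \<le> B"
proof -
  have *: "(\<lambda>i. (cmod (\<phi> i))\<^sup>2) summable_on I"
    by (rule nonneg_bdd_above_summable_on) (use assms(2) in \<open>auto intro!: bdd_aboveI[of _ B]\<close>)
  then show "\<phi> \<in> ell2 I"
    using assms(1) by (simp add: ell2_def)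
  show "(ell2_norm I \<phi>)\<^sup>2 \<le> B"
    unfolding ell2_norm_power2 using * assms(2) by (rule infsum_le_finite_sums)
qed

lemma ell2_sum_le:
  assumes "\<phi> \<in> ell2 I" "finite F" "F \<subseteq> I"
  shows "(\<Sum>i\<in>F. (cmod (\<phi> i))\<^sup>2) \<le> (ell2_norm I \<phi>)\<^sup>2"
  unfolding ell2_norm_power2 using assms by (intro finite_sum_le_infsum) (auto simp: ell2_def)

lemma ell2_coord_le:
  assumes "\<phi> \<in> ell2 I"
  shows "cmod (\<phi> i) \<le> ell2_norm I \<phi>"
proof (cases "i \<in> I")
  case True
  then show ?thesis
    using ell2_sum_le[OF assms, of "{i}"] by (auto intro: power2_le_imp_le)
qed (simp add: ell2_zero[OF assms])

text \<open>The injection \<open>\<sigma>\<close> turns finite partial sums of \<open>\<psi>\<close>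
  into finite partial sums of \<open>\<phi>\<close>. The identity covers multiplication operators,
  an involution covers operators that swap coordinates.\<close>

lemma ell2_dominated:
  assumes \<phi>: "\<phi> \<in> ell2 I" and \<sigma>: "inj_on \<sigma> I" "\<sigma> ` I \<subseteq> I" and "0 \<le> C"
    and "\<And>i. i \<notin> I \<Longrightarrow> \<psi> i = 0"
    and le: "\<And>i. i \<in> I \<Longrightarrow> cmod (\<psi> i) \<le> C * cmod (\<phi> (\<sigma> i))"
  shows "\<psi> \<in> ell2 I" and "ell2_norm I \<psi> \<le> C * ell2_norm I \<phi>"
proof -
  have *: "(\<Sum>i\<in>F. (cmod (\<psi> i))\<^sup>2) \<le> (C * ell2_norm I \<phi>)\<^sup>2" if F: "finite F" "F \<subseteq> I" for F
  proof -
    have "(\<Sum>i\<in>F. (cmod (\<psi> i))\<^sup>2) \<le> (\<Sum>i\<in>F. C\<^sup>2 * (cmod (\<phi> (\<sigma> i)))\<^sup>2)"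
      using F(2) le by (intro sum_mono) (metis norm_ge_zero power_mono power_mult_distrib subsetD)
    also have "\<dots> = C\<^sup>2 * (\<Sum>i\<in>\<sigma> ` F. (cmod (\<phi> i))\<^sup>2)"
      using inj_on_subset[OF \<sigma>(1) F(2)] by (simp add: sum.reindex sum_distrib_left)
    also have "\<dots> \<le> C\<^sup>2 * (ell2_norm I \<phi>)\<^sup>2"
      using F \<sigma>(2) by (intro mult_left_mono ell2_sum_le \<phi>) auto
    finally show ?thesis by (simp add: power_mult_distrib)
  qed
  show "\<psi> \<in> ell2 I"
    using assms(5) * by (rule ell2_boundedI(1))
  have "(ell2_norm I \<psi>)\<^sup>2 \<le> (C * ell2_norm I \<phi>)\<^sup>2"
    using assms(5) * by (rule ell2_boundedI(2))
  then show "ell2_norm I \<psi> \<le> C * ell2_norm I \<phi>"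
    by (rule power2_le_imp_le) (simp add: \<open>0 \<le> C\<close>)
qed

text \<open>The second bound uses (a + b)^2 \<le> 2 (a^2 + b^2) termwise instead of Minkowski's
  inequality; the factor 2 is harmless, since only boundedness of differences is derived from
  it.\<close>

lemma ell2_add:
  assumes "\<phi> \<in> ell2 I" "\<psi> \<in> ell2 I"
  shows "(\<lambda>i. \<phi> i + \<psi> i) \<in> ell2 I"
    and "(ell2_norm I (\<lambda>i. \<phi> i + \<psi> i))\<^sup>2 \<le> 2 * ((ell2_norm I \<phi>)\<^sup>2 + (ell2_norm I \<psi>)\<^sup>2)"
proof -
  have *: "(\<Sum>i\<in>F. (cmod (\<phi> i + \<psi> i))\<^sup>2) \<le> 2 * ((ell2_norm I \<phi>)\<^sup>2 + (ell2_norm I \<psi>)\<^sup>2)"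
    if F: "finite F" "F \<subseteq> I" for F
  proof -
    have "(cmod (\<phi> i + \<psi> i))\<^sup>2 \<le> 2 * ((cmod (\<phi> i))\<^sup>2 + (cmod (\<psi> i))\<^sup>2)" for i
    proof -
      have "(cmod (\<phi> i + \<psi> i))\<^sup>2 \<le> (cmod (\<phi> i) + cmod (\<psi> i))\<^sup>2"
        by (simp add: norm_triangle_ineq power_mono)
      also have "\<dots> \<le> 2 * ((cmod (\<phi> i))\<^sup>2 + (cmod (\<psi> i))\<^sup>2)"
        using sum_squares_bound[of "cmod (\<phi> i)" "cmod (\<psi> i)"] by (simp add: power2_sum)
      finally show ?thesis .
    qed
    then have "(\<Sum>i\<in>F. (cmod (\<phi> i + \<psi> i))\<^sup>2) \<le> (\<Sum>i\<in>F. 2 * ((cmod (\<phi> i))\<^sup>2 + (cmod (\<psi> i))\<^sup>2))"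
      by (intro sum_mono)
    also have "\<dots> = 2 * ((\<Sum>i\<in>F. (cmod (\<phi> i))\<^sup>2) + (\<Sum>i\<in>F. (cmod (\<psi> i))\<^sup>2))"
      by (simp add: sum.distrib sum_distrib_left)
    also have "\<dots> \<le> 2 * ((ell2_norm I \<phi>)\<^sup>2 + (ell2_norm I \<psi>)\<^sup>2)"
      using ell2_sum_le[OF assms(1) F] ell2_sum_le[OF assms(2) F] by simp
    finally show ?thesis .
  qed
  have z: "\<And>i. i \<notin> I \<Longrightarrow> \<phi> i + \<psi> i = 0"
    using assms by (simp add: ell2_zero)
  show "(\<lambda>i. \<phi> i + \<psi> i) \<in> ell2 I"
    using z * by (rule ell2_boundedI(1))
  show "(ell2_norm I (\<lambda>i. \<phi> i + \<psi> i))\<^sup>2 \<le> 2 * ((ell2_norm I \<phi>)\<^sup>2 + (ell2_norm I \<psi>)\<^sup>2)"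
    using z * by (rule ell2_boundedI(2))
qed

lemma ell2_mult:
  assumes "\<phi> \<in> ell2 I" "0 \<le> C" "\<And>i. i \<in> I \<Longrightarrow> cmod (m i) \<le> C"
  shows "(\<lambda>i. m i * \<phi> i) \<in> ell2 I" and "ell2_norm I (\<lambda>i. m i * \<phi> i) \<le> C * ell2_norm I \<phi>"
  using assms
  by (auto intro!: ell2_dominated[where \<sigma> = "\<lambda>i. i" and \<phi> = \<phi>] mult_right_mono
      simp: ell2_zero norm_mult)

lemma ell2_scale:
  assumes "\<phi> \<in> ell2 I"
  shows "(\<lambda>i. c * \<phi> i) \<in> ell2 I"
  using ell2_mult(1)[OF assms, of "cmod c" "\<lambda>_. c"] by simp

lemma ell2_diff:
  assumes "\<phi> \<in> ell2 I" "\<psi> \<in> ell2 I"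
  shows "(\<lambda>i. \<phi> i - \<psi> i) \<in> ell2 I"
  using ell2_add(1)[OF assms(1) ell2_scale[OF assms(2), of "-1"]] by simp

lemma ell2_finite_support:
  assumes "finite F" "F \<subseteq> I" "\<And>i. i \<notin> F \<Longrightarrow> \<phi> i = 0"
  shows "\<phi> \<in> ell2 I"
proof (rule ell2_boundedI(1))
  fix F' assume F': "finite F'" "F' \<subseteq> I"
  have "(\<Sum>i\<in>F'. (cmod (\<phi> i))\<^sup>2) = (\<Sum>i\<in>F' \<inter> F. (cmod (\<phi> i))\<^sup>2)"
    using F' assms(3) by (intro sum.mono_neutral_right) auto
  also have "\<dots> \<le> (\<Sum>i\<in>F. (cmod (\<phi> i))\<^sup>2)"
    using assms(1) by (intro sum_mono2) auto
  finally show "(\<Sum>i\<in>F'. (cmod (\<phi> i))\<^sup>2) \<le> (\<Sum>i\<in>F. (cmod (\<phi> i))\<^sup>2)" .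
qed (use assms in auto)

section \<open>Unit vectors and multiplication operators\<close>

definition unit_vec :: "'i \<Rightarrow> 'i \<Rightarrow> complex" where
  "unit_vec j = (\<lambda>i. if i = j then 1 else 0)"

lemma unit_vec_ell2: "j \<in> I \<Longrightarrow> unit_vec j \<in> ell2 I"
  by (rule ell2_finite_support[of "{j}"]) (auto simp: unit_vec_def)

lemma ell2_norm_unit_vec: "ell2_norm I (unit_vec j) \<le> 1"
proof (cases "j \<in> I")
  case True
  have "(ell2_norm I (unit_vec j))\<^sup>2 \<le> 1"
  proof (rule ell2_boundedI(2))
    fix F assume "finite F" "F \<subseteq> I"
    have "(\<Sum>i\<in>F. (cmod (unit_vec j i))\<^sup>2) = (\<Sum>i\<in>F. if i = j then 1 else 0)"
      by (intro sum.cong) (auto simp: unit_vec_def)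
    also have "\<dots> \<le> 1"
      using \<open>finite F\<close> by simp
    finally show "(\<Sum>i\<in>F. (cmod (unit_vec j i))\<^sup>2) \<le> 1" .
  qed (use True in \<open>auto simp: unit_vec_def\<close>)
  then show ?thesis by (simp add: power2_le_imp_le)
next
  case False
  then have "ell2_norm I (unit_vec j) = 0"
    unfolding ell2_norm_def by (subst infsum_0) (auto simp: unit_vec_def)
  then show ?thesis by simp
qed

lemma infsum_single_support:
  fixes f :: "'i \<Rightarrow> complex"
  assumes "j \<in> I" "\<And>i. i \<in> I \<Longrightarrow> i \<noteq> j \<Longrightarrow> f i = 0"
  shows "infsum f I = f j"
proof -
  have "infsum f I = infsum f {j}"
    using assms by (intro infsum_cong_neutral) auto
  then show ?thesis by simp
qed

lemma bounded_operator_multiplier: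
  assumes "\<And>i. i \<in> I \<Longrightarrow> cmod (m i) \<le> C"
  shows "bounded_operator I (\<lambda>\<phi> i. m i * \<phi> i)"
proof -
  \<comment> \<open>\<open>C\<close> may be negative when \<open>I\<close> is empty.\<close>
  have C: "0 \<le> max C 0" "\<And>i. i \<in> I \<Longrightarrow> cmod (m i) \<le> max C 0"
    using assms by (auto simp: le_max_iff_disj)
  have "(\<lambda>i. 0) \<in> ell2 I" by (simp add: ell2_def)
  then have "lin_operator I (ell2 I) (\<lambda>\<phi> i. m i * \<phi> i)"
    using ell2_mult(1)[where m = m, OF _ C]
    by (auto simp: lin_operator_def ell2_add ell2_scale algebra_simps)
  moreover have "operator_norm I (ell2 I) (\<lambda>\<phi> i. m i * \<phi> i) \<le> ereal (max C 0)"
    unfolding operator_norm_def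
  proof (rule SUP_least)
    fix \<phi> assume "\<phi> \<in> {\<phi> \<in> ell2 I. ell2_norm I \<phi> \<le> 1}"
    then have "ell2_norm I (\<lambda>i. m i * \<phi> i) \<le> max C 0 * 1"
      by (intro order.trans[OF ell2_mult(2)[where m = m, OF _ C]] mult_left_mono) auto
    then show "ereal (ell2_norm I (\<lambda>i. m i * \<phi> i)) \<le> ereal (max C 0)"
      by (simp only: ereal_less_eq mult_1_right)
  qed
  ultimately show ?thesis
    unfolding bounded_operator_def by (metis ereal_infty_less(1) order.strict_trans1 PInfty_neq_ereal(1))
qed

lemma
  assumes "lin_operator I \<D> T" "\<phi> \<in> \<D>"
  shows lin_operator_range: "T \<phi> \<in> ell2 I"
    and lin_operator_scale: "T (\<lambda>i. c * \<phi> i) = (\<lambda>i. c * T \<phi> i)"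
    and lin_operator_add: "\<psi> \<in> \<D> \<Longrightarrow> T (\<lambda>i. \<phi> i + \<psi> i) = (\<lambda>i. T \<phi> i + T \<psi> i)"
  using assms by (simp_all add: lin_operator_def)

text \<open>Countability of \<open>I\<close> places the sequence in a countable product of closed
  discs, which is compact by Tychonoff and therefore sequentially compact; this replaces a diagonal
  argument.\<close>

lemma bounded_pointwise_subsequence:
  fixes u :: "nat \<Rightarrow> 'i \<Rightarrow> complex"
  assumes "countable I" and bound: "\<And>k i. i \<in> I \<Longrightarrow> cmod (u k i) \<le> B"
  obtains j :: "nat \<Rightarrow> nat" and v
  where "strict_mono j" "\<And>i. i \<in> I \<Longrightarrow> (\<lambda>k. u (j k) i) \<longlonglongrightarrow> v i"
proof (cases "I = {}")
  case True
  then show ?thesis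
    using that[of "\<lambda>k. k"] by (simp add: strict_mono_def)
next
  case False
  define g where "g k = (\<lambda>n. u k (from_nat_into I n))" for k
  define S :: "(nat \<Rightarrow> complex) set" where "S = (\<Pi>\<^sub>E n\<in>UNIV. cball 0 B)"
  have "compactin (product_topology (\<lambda>_. euclidean) UNIV) S"
    unfolding S_def by (subst compactin_PiE) auto
  then have "seq_compact S"
    by (simp add: euclidean_product_topology compact_imp_seq_compact)
  moreover have "\<forall>k. g k \<in> S"
    using bound from_nat_into[OF False] by (auto simp: g_def S_def)
  ultimately obtain l j where j: "strict_mono j" and l: "(g \<circ> j) \<longlonglongrightarrow> l"
    unfolding seq_compact_def by metis
  have lim: "(\<lambda>k. g (j k) n) \<longlonglongrightarrow> l n" for n
  proof -
    have "isCont (\<lambda>h::nat \<Rightarrow> complex. h n) l"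
      using continuous_on_eq_continuous_at continuous_on_product_coordinates open_UNIV UNIV_I by metis
    from isCont_tendsto_compose[OF this l] show ?thesis by (simp add: o_def)
  qed
  show ?thesis
  proof (rule that[OF j])
    fix i assume "i \<in> I"
    then show "(\<lambda>k. u (j k) i) \<longlonglongrightarrow> l (to_nat_on I i)"
      using lim[of "to_nat_on I i"] \<open>countable I\<close> by (simp add: g_def)
  qed
qed

text \<open>The coefficients \<open>a\<close> tend to \<open>0\<close> along \<open>I\<close>, so pointwise convergence of a bounded
  sequence becomes norm convergence after applying \<open>K\<close>.\<close>

lemma compact_operatorI:
  assumes lin: "lin_operator I (ell2 I) K" and "countable I"
    and \<sigma>: "inj_on \<sigma> I" "\<sigma> ` I \<subseteq> I"
    and bound: "\<And>\<psi> i. \<psi> \<in> ell2 I \<Longrightarrow> i \<in> I \<Longrightarrow>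
      (cmod (K \<psi> i))\<^sup>2 \<le> a i * ((cmod (\<psi> i))\<^sup>2 + (cmod (\<psi> (\<sigma> i)))\<^sup>2)"
    and fin: "\<And>\<delta>. 0 < \<delta> \<Longrightarrow> finite {i\<in>I. \<delta> < a i}"
  shows "compact_operator I K"
  unfolding compact_operator_def
proof (intro conjI lin allI impI)
  fix u :: "nat \<Rightarrow> 'a \<Rightarrow> complex"
  assume u: "\<forall>k. u k \<in> ell2 I \<and> ell2_norm I (u k) \<le> 1"
  have coord: "cmod (u k i) \<le> 1" for k i
    using u ell2_coord_le[of "u k" I i] by (meson order_trans)
  obtain j v where j: "strict_mono j" and v: "\<And>i. i \<in> I \<Longrightarrow> (\<lambda>k. u (j k) i) \<longlonglongrightarrow> v i"
    using bounded_pointwise_subsequence[OF \<open>countable I\<close>, of u 1] coord by blast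
  define v0 where "v0 i = (if i \<in> I then v i else 0)" for i
  have v0_lim: "(\<lambda>k. u (j k) i) \<longlonglongrightarrow> v0 i" for i
  proof (cases "i \<in> I")
    case False
    then have "u (j k) i = 0" for k using u by (auto intro: ell2_zero)
    then show ?thesis using False by (simp add: v0_def)
  qed (simp add: v v0_def)
  \<comment> \<open>Finite partial sums pass to the pointwise limit, so the limit stays in the unit
    ball.\<close>
  have v0_sum: "(\<Sum>i\<in>F. (cmod (v0 i))\<^sup>2) \<le> 1" if F: "finite F" "F \<subseteq> I" for F
  proof (rule LIMSEQ_le_const2)
    show "(\<lambda>k. \<Sum>i\<in>F. (cmod (u (j k) i))\<^sup>2) \<longlonglongrightarrow> (\<Sum>i\<in>F. (cmod (v0 i))\<^sup>2)"
      by (intro tendsto_intros v0_lim)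
    have "(\<Sum>i\<in>F. (cmod (u k i))\<^sup>2) \<le> 1" for k
      using ell2_sum_le[of "u k" I F] u F power_le_one[of "ell2_norm I (u k)" 2]
      by (auto intro: order_trans)
    then show "\<exists>N. \<forall>n\<ge>N. (\<Sum>i\<in>F. (cmod (u (j n) i))\<^sup>2) \<le> 1" by blast
  qed
  have v0_ell2: "v0 \<in> ell2 I" and v0_norm: "(ell2_norm I v0)\<^sup>2 \<le> 1"
    using ell2_boundedI[of I v0 1] v0_sum by (auto simp: v0_def)
  define d where "d k = (\<lambda>i. u (j k) i - v0 i)" for k
  have d_ell2: "d k \<in> ell2 I" for k
    unfolding d_def using u v0_ell2 by (intro ell2_diff) auto
  \<comment> \<open>4 = 2 * (1 + 1), from the squared norms of \<open>u (j k)\<close> and of the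
    limit.\<close>
  have d_norm: "(ell2_norm I (d k))\<^sup>2 \<le> 4" for k
  proof -
    have neg: "(\<lambda>i. -1 * v0 i) \<in> ell2 I" "(ell2_norm I (\<lambda>i. -1 * v0 i))\<^sup>2 \<le> 1"
      using ell2_scale[OF v0_ell2, of "-1"] v0_norm by (simp_all add: ell2_norm_def)
    have "(ell2_norm I (u (j k)))\<^sup>2 \<le> 1"
      using u by (simp add: power_le_one)
    then show ?thesis
      using ell2_add(2)[of "u (j k)" I "\<lambda>i. -1 * v0 i"] u neg by (simp add: d_def)
  qed
  have K_diff: "(\<lambda>i. K (u (j k)) i - K v0 i) = K (d k)" for k
  proof -
    have u': "u (j k) \<in> ell2 I" using u by blast
    have "K (\<lambda>i. u (j k) i + (-1 * v0 i)) = (\<lambda>i. K (u (j k)) i + K (\<lambda>i. -1 * v0 i) i)"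
      by (rule lin_operator_add[OF lin u' ell2_scale[OF v0_ell2]])
    then show ?thesis by (simp only: lin_operator_scale[OF lin v0_ell2]) (simp add: d_def)
  qed
  have sq0: "(\<lambda>k. (ell2_norm I (K (d k)))\<^sup>2) \<longlonglongrightarrow> 0"
  proof (rule LIMSEQ_I)
    fix \<epsilon> :: real assume "0 < \<epsilon>"
    \<comment> \<open>Outside the finite set \<open>F\<close> the contribution is at most
      \<open>\<delta> * (4 + 4)\<close>, which is \<open>\<epsilon> / 2\<close>; inside
      \<open>F\<close> it is eventually less than \<open>\<epsilon> / 4\<close>.\<close>
    define \<delta> where "\<delta> = \<epsilon> / 16"
    have "0 < \<delta>" using \<open>0 < \<epsilon>\<close> by (simp add: \<delta>_def)
    define F where "F = {i\<in>I. \<delta> < a i}"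
    have F: "finite F" "F \<subseteq> I" using fin[OF \<open>0 < \<delta>\<close>] by (auto simp: F_def)
    define h where "h k = (\<Sum>i\<in>F. a i * ((cmod (d k i))\<^sup>2 + (cmod (d k (\<sigma> i)))\<^sup>2))" for k
    have d0: "(\<lambda>k. d k i) \<longlonglongrightarrow> 0" for i
      using tendsto_diff[OF v0_lim[of i] tendsto_const[of "v0 i"]] by (simp add: d_def)
    have "h \<longlonglongrightarrow> (\<Sum>i\<in>F. a i * ((cmod 0)\<^sup>2 + (cmod 0)\<^sup>2))"
      unfolding h_def
      by (intro tendsto_sum tendsto_mult tendsto_add tendsto_power tendsto_norm tendsto_const d0)
    then have "eventually (\<lambda>k. h k < \<epsilon> / 4) sequentially"
      using \<open>0 < \<epsilon>\<close> by (intro order_tendstoD(2)) auto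
    then obtain N where N: "\<And>k. k \<ge> N \<Longrightarrow> h k < \<epsilon> / 4"
      by (auto simp: eventually_sequentially)
    have "(ell2_norm I (K (d k)))\<^sup>2 \<le> h k + \<delta> * 8" for k
    proof (rule ell2_boundedI(2))
      show "K (d k) i = 0" if "i \<notin> I" for i
        using lin_operator_range[OF lin d_ell2] that by (rule ell2_zero)
      fix F' assume F': "finite F'" "F' \<subseteq> I"
      have "(\<Sum>i\<in>F'. (cmod (K (d k) i))\<^sup>2)
          = (\<Sum>i\<in>F' \<inter> F. (cmod (K (d k) i))\<^sup>2) + (\<Sum>i\<in>F' - F. (cmod (K (d k) i))\<^sup>2)"
        by (metis F'(1) sum.Int_Diff)
      moreover have "(\<Sum>i\<in>F' \<inter> F. (cmod (K (d k) i))\<^sup>2) \<le> h k"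
      proof -
        have "(\<Sum>i\<in>F' \<inter> F. (cmod (K (d k) i))\<^sup>2) \<le> (\<Sum>i\<in>F. (cmod (K (d k) i))\<^sup>2)"
          using F by (intro sum_mono2) auto
        also have "\<dots> \<le> h k"
          unfolding h_def using F by (intro sum_mono bound d_ell2) auto
        finally show ?thesis .
      qed
      moreover have "(\<Sum>i\<in>F' - F. (cmod (K (d k) i))\<^sup>2) \<le> \<delta> * 8"
      proof -
        have "(\<Sum>i\<in>F' - F. (cmod (K (d k) i))\<^sup>2)
            \<le> (\<Sum>i\<in>F' - F. \<delta> * ((cmod (d k i))\<^sup>2 + (cmod (d k (\<sigma> i)))\<^sup>2))"
        proof (rule sum_mono)
          fix i assume i: "i \<in> F' - F"
          then have "a i \<le> \<delta>" "i \<in> I" using F' by (auto simp: F_def)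
          then show "(cmod (K (d k) i))\<^sup>2 \<le> \<delta> * ((cmod (d k i))\<^sup>2 + (cmod (d k (\<sigma> i)))\<^sup>2)"
            by (intro order_trans[OF bound[OF d_ell2 \<open>i \<in> I\<close>] mult_right_mono]) auto
        qed
        also have "\<dots> = \<delta> * ((\<Sum>i\<in>F' - F. (cmod (d k i))\<^sup>2) + (\<Sum>i\<in>F' - F. (cmod (d k (\<sigma> i)))\<^sup>2))"
          by (simp only: sum_distrib_left[symmetric] sum.distrib)
        also have "(\<Sum>i\<in>F' - F. (cmod (d k (\<sigma> i)))\<^sup>2) = (\<Sum>i\<in>\<sigma> ` (F' - F). (cmod (d k i))\<^sup>2)"
        proof -
          have "inj_on \<sigma> (F' - F)" using \<sigma>(1) F'(2) by (auto intro: inj_on_subset)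
          then show ?thesis by (simp add: sum.reindex)
        qed
        also have "\<delta> * ((\<Sum>i\<in>F' - F. (cmod (d k i))\<^sup>2) + (\<Sum>i\<in>\<sigma> ` (F' - F). (cmod (d k i))\<^sup>2)) \<le> \<delta> * (4 + 4)"
        proof (intro mult_left_mono add_mono)
          show "(\<Sum>i\<in>F' - F. (cmod (d k i))\<^sup>2) \<le> 4"
            using F' by (intro order_trans[OF ell2_sum_le[OF d_ell2] d_norm]) auto
          show "(\<Sum>i\<in>\<sigma> ` (F' - F). (cmod (d k i))\<^sup>2) \<le> 4"
            using F' \<sigma>(2) by (intro order_trans[OF ell2_sum_le[OF d_ell2] d_norm]) auto
        qed (use \<open>0 < \<delta>\<close> in simp)
        finally show ?thesis by simp
      qed
      ultimately show "(\<Sum>i\<in>F'. (cmod (K (d k) i))\<^sup>2) \<le> h k + \<delta> * 8" by linarith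
    qed
    moreover have "h k + \<delta> * 8 < \<epsilon>" if "k \<ge> N" for k
      using N[OF that] \<open>0 < \<epsilon>\<close> by (simp add: \<delta>_def)
    ultimately have "norm ((ell2_norm I (K (d k)))\<^sup>2 - 0) < \<epsilon>" if "k \<ge> N" for k
      using that by (metis diff_zero order.strict_trans1 abs_of_nonneg real_norm_def zero_le_power2)
    then show "\<exists>N. \<forall>k\<ge>N. norm ((ell2_norm I (K (d k)))\<^sup>2 - 0) < \<epsilon>" by blast
  qed
  have "(\<lambda>k. ell2_norm I (K (d k))) \<longlonglongrightarrow> 0"
    using tendsto_real_sqrt[OF sq0] by simp
  then have "(\<lambda>k. ell2_norm I (\<lambda>i. K (u (j k)) i - K v0 i)) \<longlonglongrightarrow> 0"
    by (simp only: K_diff)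
  moreover have "K v0 \<in> ell2 I"
    by (rule lin_operator_range[OF lin v0_ell2])
  ultimately show "\<exists>\<psi>\<in>ell2 I. \<exists>j :: nat \<Rightarrow> nat. strict_mono j \<and>
      (\<lambda>k. ell2_norm I (\<lambda>i. K (u (j k)) i - \<psi> i)) \<longlonglongrightarrow> 0"
    using j by blast
qed

section \<open>Weighted involutions\<close>

text \<open>Isolates what the analysis of \<open>D\<close> uses. For the Dirac operator,
  \<open>\<sigma>\<close> reverses an edge and \<open>w\<close> is \<rho> to the power minus the
  level; properness of \<open>w\<close> yields countability of the index set and compactness of the
  resolvent.\<close>

locale weighted_involution =
  fixes I :: "'i set" and \<sigma> :: "'i \<Rightarrow> 'i" and w :: "'i \<Rightarrow> real"
  assumes invol [simp]: "\<sigma> (\<sigma> i) = i"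
    and closed: "i \<in> I \<Longrightarrow> \<sigma> i \<in> I"
    and w_pos: "i \<in> I \<Longrightarrow> 0 < w i"
    and w_invol: "i \<in> I \<Longrightarrow> w (\<sigma> i) = w i"
    and w_proper: "finite {i\<in>I. w i \<le> c}"
begin

definition wswap :: "'i operator" where
  "wswap \<phi> = (\<lambda>i. complex_of_real (w i) * \<phi> (\<sigma> i))"

definition wdom :: "('i \<Rightarrow> complex) set" where
  "wdom = {\<phi>\<in>ell2 I. wswap \<phi> \<in> ell2 I}"

lemma closed_iff [simp]: "\<sigma> i \<in> I \<longleftrightarrow> i \<in> I"
  using closed[of i] closed[of "\<sigma> i"] by auto

lemma inj_invol: "inj_on \<sigma> A"
  by (metis inj_onI invol)

lemma image_invol: "\<sigma> ` I \<subseteq> I"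
  using closed by blast

lemma bij_invol: "bij_betw \<sigma> I I"
  by (rule bij_betw_byWitness[of _ \<sigma>]) auto

lemma countable_index: "countable I"
proof -
  have "I = (\<Union>n::nat. {i\<in>I. w i \<le> real n})"
    using real_arch_simple by auto
  moreover have "countable (\<Union>n::nat. {i\<in>I. w i \<le> real n})"
    using w_proper by (intro countable_UN) (auto intro: countable_finite)
  ultimately show ?thesis by simp
qed

lemma ell2_invol:
  assumes "\<phi> \<in> ell2 I"
  shows "(\<lambda>i. \<phi> (\<sigma> i)) \<in> ell2 I"
  by (rule ell2_dominated(1)[OF assms inj_invol image_invol, of 1])
     (auto intro: ell2_zero[OF assms])

lemma finite_support_wdom:
  assumes "finite F" "F \<subseteq> I" "\<And>i. i \<notin> F \<Longrightarrow> \<phi> i = 0"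
  shows "\<phi> \<in> wdom"
proof -
  have "wswap \<phi> \<in> ell2 I"
  proof (rule ell2_finite_support)
    show "finite (\<sigma> ` F)" "\<sigma> ` F \<subseteq> I" using assms(1,2) by auto
    fix i assume "i \<notin> \<sigma> ` F"
    then have "\<sigma> i \<notin> F" by (metis image_eqI invol)
    then show "wswap \<phi> i = 0" by (simp add: wswap_def assms(3))
  qed
  then show ?thesis
    using ell2_finite_support[of F I \<phi>] assms unfolding wdom_def by blast
qed

lemma unit_vec_wdom: "j \<in> I \<Longrightarrow> unit_vec j \<in> wdom"
  by (rule finite_support_wdom[of "{j}"]) (auto simp: unit_vec_def)

lemma wswap_add: "wswap (\<lambda>i. \<phi> i + \<psi> i) = (\<lambda>i. wswap \<phi> i + wswap \<psi> i)"
  by (simp add: wswap_def distrib_left)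

lemma wswap_scale: "wswap (\<lambda>i. c * \<phi> i) = (\<lambda>i. c * wswap \<phi> i)"
  by (simp add: wswap_def mult.left_commute)

lemma lin_operator_wswap: "lin_operator I wdom wswap"
proof -
  have "wswap (\<lambda>i. 0) = (\<lambda>i. 0)" by (simp add: wswap_def)
  moreover have "(\<lambda>i. 0) \<in> ell2 I" by (simp add: ell2_def)
  ultimately show ?thesis
    by (auto simp: lin_operator_def wdom_def wswap_add wswap_scale ell2_add ell2_scale)
qed

lemma wdom_dense:
  assumes \<phi>: "\<phi> \<in> ell2 I" and "0 < \<delta>"
  shows "\<exists>\<psi>\<in>wdom. ell2_norm I (\<lambda>i. \<phi> i - \<psi> i) < \<delta>"
proof -
  define S where "S = (\<Sum>\<^sub>\<infinity>i\<in>I. (cmod (\<phi> i))\<^sup>2)"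
  have sum: "(\<lambda>i. (cmod (\<phi> i))\<^sup>2) summable_on I" using \<phi> by (simp add: ell2_def)
  have "0 < (\<delta> / 2)\<^sup>2" using \<open>0 < \<delta>\<close> by simp
  from infsum_finite_approximation[OF sum this] obtain F
    where F: "finite F" "F \<subseteq> I" "dist (\<Sum>i\<in>F. (cmod (\<phi> i))\<^sup>2) S \<le> (\<delta> / 2)\<^sup>2"
    unfolding S_def by blast
  define \<psi> where "\<psi> i = (if i \<in> F then \<phi> i else 0)" for i
  have "(ell2_norm I (\<lambda>i. \<phi> i - \<psi> i))\<^sup>2 \<le> (\<delta> / 2)\<^sup>2"
  proof (rule ell2_boundedI(2))
    show "\<phi> i - \<psi> i = 0" if "i \<notin> I" for i
      using ell2_zero[OF \<phi> that] by (simp add: \<psi>_def)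
    fix F' assume F': "finite F'" "F' \<subseteq> I"
    have "(\<Sum>i\<in>F'. (cmod (\<phi> i - \<psi> i))\<^sup>2) = (\<Sum>i\<in>F' - F. (cmod (\<phi> i))\<^sup>2)"
      using F' by (intro sum.mono_neutral_cong_right) (auto simp: \<psi>_def)
    also have "\<dots> + (\<Sum>i\<in>F. (cmod (\<phi> i))\<^sup>2) = (\<Sum>i\<in>F' \<union> F. (cmod (\<phi> i))\<^sup>2)"
      using F F' by (subst sum.union_disjoint[symmetric]) (auto intro: sum.cong)
    also have "\<dots> \<le> S"
      unfolding S_def using F F' sum by (intro finite_sum_le_infsum) auto
    finally show "(\<Sum>i\<in>F'. (cmod (\<phi> i - \<psi> i))\<^sup>2) \<le> (\<delta> / 2)\<^sup>2"
      using F(3) by (simp add: dist_real_def)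
  qed
  then have "ell2_norm I (\<lambda>i. \<phi> i - \<psi> i) \<le> \<delta> / 2"
    by (rule power2_le_imp_le) (use \<open>0 < \<delta>\<close> in simp)
  moreover have "\<psi> \<in> wdom"
    using F(1,2) by (rule finite_support_wdom) (simp add: \<psi>_def)
  ultimately show ?thesis using \<open>0 < \<delta>\<close> by force
qed

text \<open>Both sides are the same infinite sum reindexed by \<open>\<sigma>\<close>, so the
  identity can also be applied to a vector not yet known to lie in \<open>wdom\<close>.\<close>

lemma wswap_inner: "ell2_inner I (wswap \<phi>) \<psi> = ell2_inner I \<phi> (wswap \<psi>)"
proof -
  have "ell2_inner I (wswap \<phi>) \<psi> = (\<Sum>\<^sub>\<infinity>i\<in>I. cnj (wswap \<phi> (\<sigma> i)) * \<psi> (\<sigma> i))"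
    unfolding ell2_inner_def by (rule infsum_reindex_bij_betw[OF bij_invol, symmetric])
  also have "\<dots> = ell2_inner I \<phi> (wswap \<psi>)"
    unfolding ell2_inner_def by (rule infsum_cong) (simp add: wswap_def w_invol)
  finally show ?thesis .
qed

lemma self_adjoint_wswap: "self_adjoint_operator I wdom wswap"
  unfolding self_adjoint_operator_def
proof (intro conjI lin_operator_wswap ballI allI impI iffI)
  fix \<phi> and \<delta> :: real assume "\<phi> \<in> ell2 I" "0 < \<delta>"
  then show "\<exists>\<psi>\<in>wdom. ell2_norm I (\<lambda>i. \<phi> i - \<psi> i) < \<delta>" by (rule wdom_dense)
next
  fix \<psi> \<xi> \<phi> assume "\<psi> \<in> wdom \<and> wswap \<psi> = \<xi>"
  then show "ell2_inner I (wswap \<phi>) \<psi> = ell2_inner I \<phi> \<xi>" using wswap_inner by blast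
next
  fix \<psi> \<xi> assume \<psi>: "\<psi> \<in> ell2 I" and \<xi>: "\<xi> \<in> ell2 I"
    and adj: "\<forall>\<phi>\<in>wdom. ell2_inner I (wswap \<phi>) \<psi> = ell2_inner I \<phi> \<xi>"
  \<comment> \<open>Unit vectors lie in \<open>wdom\<close> and read off coordinates; testing the
    adjoint relation on them forces \<open>wswap \<psi> = \<xi>\<close>, which puts
    \<open>\<psi>\<close> into the domain.\<close>
  have inner: "ell2_inner I (unit_vec j) \<theta> = \<theta> j" if "j \<in> I" for j \<theta>
    unfolding ell2_inner_def
    by (subst infsum_single_support[OF that]) (auto simp: unit_vec_def)
  have "wswap \<psi> j = \<xi> j" for j
  proof (cases "j \<in> I")
    case True
    then show ?thesis
      using adj unit_vec_wdom[OF True] wswap_inner[of "unit_vec j" \<psi>] inner[OF True] by metis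
  next
    case False
    then have "\<psi> (\<sigma> j) = 0" using ell2_zero[OF \<psi>] by simp
    then show ?thesis using ell2_zero[OF \<xi> False] by (simp add: wswap_def)
  qed
  then show "wswap \<psi> = \<xi>" by blast
  with \<psi> \<xi> show "\<psi> \<in> wdom" by (simp add: wdom_def)
qed

text \<open>On the span of the coordinates \<open>i\<close> and \<open>\<sigma> i\<close> the operator has the eigenvalues
  \<open>\<plusminus> w i\<close>, so the resolvent there is a \<open>2 \<times> 2\<close> matrix which is at most of the
  order of \<open>1 / w i\<close>.\<close>

lemma compact_resolvent_wswap: "compact_resolvent I wdom wswap"
  unfolding compact_resolvent_def
proof (intro allI impI)
  fix z :: complex assume "z \<notin> \<real>"
  define \<beta> where "\<beta> = \<bar>Im z\<bar>"
  have \<beta>: "0 < \<beta>" using \<open>z \<notin> \<real>\<close> by (simp add: \<beta>_def complex_is_Real_iff)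
  \<comment> \<open>A common lower bound for the moduli of \<open>z - w i\<close> and
    \<open>z + w i\<close>: the imaginary part bounds both below by \<open>\<beta>\<close>, the
    triangle inequality by \<open>w i - cmod z\<close>.\<close>
  define q where "q i = max \<beta> (w i - cmod z)" for i
  have q: "0 < q i" "\<beta> \<le> q i" for i using \<beta> by (auto simp: q_def less_max_iff_disj)
  \<comment> \<open>The block with zero diagonal and off-diagonal entries \<open>w i\<close> has the
    resolvent eigenvalues 1 / (\<plusminus> w i - z). Half their sum is the diagonal entry
    \<open>c1 i\<close> of the resolvent, half their difference the off-diagonal entry
    \<open>c2 i\<close>.\<close>
  define c1 where "c1 i = - (1 / (z - w i) + 1 / (z + w i)) / 2" for i
  define c2 where "c2 i = - (1 / (z - w i) - 1 / (z + w i)) / 2" for i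
  have ne: "z - complex_of_real t \<noteq> 0" "z + complex_of_real t \<noteq> 0" for t
    using \<beta> by (auto simp: \<beta>_def complex_eq_iff)
  have eq1: "w i * c2 i - z * c1 i = 1" and eq2: "w i * c1 i - z * c2 i = 0" for i
  proof -
    have c1: "c1 i = - z / ((z - w i) * (z + w i))" and c2: "c2 i = - w i / ((z - w i) * (z + w i))"
      unfolding c1_def c2_def using ne[of "w i"] by (auto simp: divide_simps algebra_simps)
    have nz: "(z - w i) * (z + w i) \<noteq> 0" using ne by simp
    have "w i * c2 i - z * c1 i = ((z - w i) * (z + w i)) / ((z - w i) * (z + w i))"
      unfolding c1 c2 by (simp add: algebra_simps flip: add_divide_distrib diff_divide_distrib)
    then show "w i * c2 i - z * c1 i = 1" using nz by simp
    show "w i * c1 i - z * c2 i = 0" unfolding c1 c2 by (simp add: mult.commute)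
  qed
  have c_le: "cmod (c1 i) \<le> 1 / q i" "cmod (c2 i) \<le> 1 / q i" for i
  proof -
    have lower: "q i \<le> cmod (z - w i)" "q i \<le> cmod (z + w i)"
    proof -
      have "\<beta> \<le> cmod (z - w i)" "\<beta> \<le> cmod (z + w i)"
        using abs_Im_le_cmod[of "z - w i"] abs_Im_le_cmod[of "z + w i"] by (auto simp: \<beta>_def)
      moreover have "w i - cmod z \<le> cmod (z - w i)" "w i - cmod z \<le> cmod (z + w i)"
        using norm_triangle_ineq2[of "complex_of_real (w i)" z]
          norm_triangle_ineq2[of "complex_of_real (w i)" "- z"]
        by (auto simp: norm_minus_commute add.commute)
      ultimately show "q i \<le> cmod (z - w i)" "q i \<le> cmod (z + w i)" by (auto simp: q_def)
    qed
    then have "cmod (1 / (z - w i)) \<le> 1 / q i" "cmod (1 / (z + w i)) \<le> 1 / q i"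
      using q(1)[of i] by (auto simp: norm_divide intro!: divide_left_mono mult_pos_pos)
    then have "cmod (1 / (z - w i) + 1 / (z + w i)) \<le> 2 / q i"
      and "cmod (1 / (z - w i) - 1 / (z + w i)) \<le> 2 / q i"
      using norm_triangle_ineq[of "1 / (z - w i)" "1 / (z + w i)"]
        norm_triangle_ineq4[of "1 / (z - w i)" "1 / (z + w i)"]
      by simp_all
    then show "cmod (c1 i) \<le> 1 / q i" "cmod (c2 i) \<le> 1 / q i"
      unfolding c1_def c2_def by (simp_all only: norm_divide norm_minus_cancel) simp_all
  qed
  have c_invol: "c1 (\<sigma> i) = c1 i" "c2 (\<sigma> i) = c2 i" if "i \<in> I" for i
    using w_invol[OF that] by (simp_all add: c1_def c2_def)
  define R where "R \<psi> = (\<lambda>i. c1 i * \<psi> i + c2 i * \<psi> (\<sigma> i))" for \<psi>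
  let ?T = "\<lambda>\<phi> i. wswap \<phi> i - z * \<phi> i"
  have "1 / q i \<le> 1 / \<beta>" for i
    using q(2) \<beta> by (intro divide_left_mono mult_pos_pos q) auto
  then have c_bound: "cmod (c1 i) \<le> 1 / \<beta>" "cmod (c2 i) \<le> 1 / \<beta>" for i
    using c_le by (meson order_trans)+
  have R_ell2: "R \<psi> \<in> ell2 I" if "\<psi> \<in> ell2 I" for \<psi>
    unfolding R_def using that \<beta> c_bound
    by (intro ell2_add ell2_mult(1)[of _ _ "1 / \<beta>"] ell2_invol) auto
  have TR: "?T (R \<psi>) = \<psi>" if \<psi>: "\<psi> \<in> ell2 I" for \<psi>
  proof
    fix i show "?T (R \<psi>) i = \<psi> i"
    proof (cases "i \<in> I")
      case True
      have "?T (R \<psi>) i = (w i * c2 i - z * c1 i) * \<psi> i + (w i * c1 i - z * c2 i) * \<psi> (\<sigma> i)"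
        by (simp add: R_def wswap_def c_invol[OF True] algebra_simps)
      then show ?thesis by (simp only: eq1 eq2) simp
    next
      case False
      then show ?thesis using ell2_zero[OF \<psi>] by (simp add: R_def wswap_def)
    qed
  qed
  have RT: "R (?T \<phi>) = \<phi>" if \<phi>: "\<phi> \<in> wdom" for \<phi>
  proof
    fix i show "R (?T \<phi>) i = \<phi> i"
    proof (cases "i \<in> I")
      case True
      have "R (?T \<phi>) i = (w i * c2 i - z * c1 i) * \<phi> i + (w i * c1 i - z * c2 i) * \<phi> (\<sigma> i)"
        by (simp add: R_def wswap_def w_invol[OF True] algebra_simps)
      then show ?thesis by (simp only: eq1 eq2) simp
    next
      case False
      have "\<phi> \<in> ell2 I" using \<phi> by (simp add: wdom_def)
      with False show ?thesis using ell2_zero[of \<phi> I] by (simp add: R_def wswap_def)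
    qed
  qed
  have R_wdom: "R \<psi> \<in> wdom" if \<psi>: "\<psi> \<in> ell2 I" for \<psi>
  proof -
    \<comment> \<open>The resolvent equation solved for \<open>wswap (R \<psi>)\<close> exhibits it
      as a combination of vectors in \<open>ell2 I\<close>.\<close>
    have "wswap (R \<psi>) = (\<lambda>i. \<psi> i + z * R \<psi> i)"
      using TR[OF \<psi>] by (simp add: fun_eq_iff algebra_simps)
    then show ?thesis
      using R_ell2[OF \<psi>] ell2_add(1)[OF \<psi> ell2_scale[OF R_ell2[OF \<psi>]]] by (simp add: wdom_def)
  qed
  have T_ell2: "?T \<phi> \<in> ell2 I" if "\<phi> \<in> wdom" for \<phi>
    using that by (auto simp: wdom_def intro!: ell2_diff ell2_scale)
  show bij: "bij_betw ?T wdom (ell2 I) \<and> compact_operator I (inv_into wdom ?T)"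
  proof
    show bij: "bij_betw ?T wdom (ell2 I)"
      by (rule bij_betw_byWitness[where f' = R]) (use RT TR R_wdom T_ell2 in auto)
    have inv: "inv_into wdom ?T \<psi> = R \<psi>" if "\<psi> \<in> ell2 I" for \<psi>
      by (rule inv_into_f_eq) (simp_all add: bij_betw_imp_inj_on[OF bij] R_wdom TR that)
    show "compact_operator I (inv_into wdom ?T)"
    proof (rule compact_operatorI[where \<sigma> = \<sigma> and a = "\<lambda>i. 2 / (q i)\<^sup>2"])
      have "(\<lambda>i. 0) \<in> ell2 I" by (simp add: ell2_def)
      then show "lin_operator I (ell2 I) (inv_into wdom ?T)"
        unfolding lin_operator_def using inv R_ell2
        by (auto simp: ell2_add ell2_scale R_def algebra_simps)
      show "(cmod (inv_into wdom ?T \<psi> i))\<^sup>2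
          \<le> 2 / (q i)\<^sup>2 * ((cmod (\<psi> i))\<^sup>2 + (cmod (\<psi> (\<sigma> i)))\<^sup>2)" if \<psi>: "\<psi> \<in> ell2 I" for \<psi> i
      proof -
        have "cmod (R \<psi> i) \<le> cmod (c1 i) * cmod (\<psi> i) + cmod (c2 i) * cmod (\<psi> (\<sigma> i))"
          unfolding R_def by (metis norm_mult norm_triangle_ineq)
        also have "\<dots> \<le> 1 / q i * cmod (\<psi> i) + 1 / q i * cmod (\<psi> (\<sigma> i))"
          by (intro add_mono mult_right_mono c_le) auto
        finally have "(cmod (R \<psi> i))\<^sup>2 \<le> (1 / q i * (cmod (\<psi> i) + cmod (\<psi> (\<sigma> i))))\<^sup>2"
          by (intro power_mono) (auto simp: distrib_left)
        also have "\<dots> = 1 / (q i)\<^sup>2 * (cmod (\<psi> i) + cmod (\<psi> (\<sigma> i)))\<^sup>2"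
          by (simp add: power_mult_distrib power_divide)
        also have "\<dots> \<le> 1 / (q i)\<^sup>2 * (2 * ((cmod (\<psi> i))\<^sup>2 + (cmod (\<psi> (\<sigma> i)))\<^sup>2))"
          using sum_squares_bound[of "cmod (\<psi> i)" "cmod (\<psi> (\<sigma> i))"]
          by (intro mult_left_mono) (auto simp: power2_sum)
        finally show ?thesis by (simp add: inv[OF \<psi>])
      qed
      \<comment> \<open>Since \<open>q i\<close> is at least \<open>w i - cmod z\<close>, a lower
        bound on \<open>2 / (q i)\<^sup>2\<close> is an upper bound on \<open>w i\<close>, and
        properness applies.\<close>
      show "finite {i\<in>I. \<delta> < 2 / (q i)\<^sup>2}" if "0 < \<delta>" for \<delta>
      proof (rule finite_subset[OF _ w_proper])
        show "{i\<in>I. \<delta> < 2 / (q i)\<^sup>2} \<subseteq> {i\<in>I. w i \<le> sqrt (2 / \<delta>) + cmod z}"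
        proof clarify
          fix i assume "\<delta> < 2 / (q i)\<^sup>2"
          then have "(q i)\<^sup>2 < 2 / \<delta>"
            using \<open>0 < \<delta>\<close> q(1)[of i] by (simp add: field_simps)
          then have "q i < sqrt (2 / \<delta>)" by (rule real_less_rsqrt)
          then show "w i \<le> sqrt (2 / \<delta>) + cmod z" by (auto simp: q_def)
        qed
      qed
    qed (use countable_index inj_invol image_invol in auto)
  qed
qed

section \<open>Commutators with multiplication operators\<close>

definition mult_op :: "('i \<Rightarrow> complex) \<Rightarrow> 'i operator" where
  "mult_op m \<phi> = (\<lambda>i. m i * \<phi> i)"

lemma mult_op_wdom:
  assumes "\<And>i. i \<in> I \<Longrightarrow> cmod (m i) \<le> B" "\<phi> \<in> wdom"
  shows "mult_op m \<phi> \<in> wdom"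
proof -
  have B: "\<And>i. i \<in> I \<Longrightarrow> cmod (m i) \<le> max B 0" using assms(1) by (auto simp: le_max_iff_disj)
  have "wswap (mult_op m \<phi>) = (\<lambda>i. m (\<sigma> i) * wswap \<phi> i)"
    by (simp add: wswap_def mult_op_def mult.left_commute)
  then show ?thesis
    using assms(2) B unfolding wdom_def mult_op_def by (auto intro!: ell2_mult(1)[of _ _ "max B 0"])
qed

lemma commutator_mult_op:
  "commutator wswap (mult_op m) \<phi> = (\<lambda>i. complex_of_real (w i) * (m (\<sigma> i) - m i) * \<phi> (\<sigma> i))"
  by (simp add: commutator_def wswap_def mult_op_def algebra_simps)

text \<open>The commutator permutes coordinates by \<open>\<sigma>\<close> and then multiplies by
  \<open>w i * (m (\<sigma> i) - m i)\<close>, so its norm is the supremum of the moduli of these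
  coefficients. The unit vector at \<open>\<sigma> j\<close> detects the coefficient at
  \<open>j\<close>.\<close>

lemma operator_norm_commutator_le_iff:
  assumes "0 \<le> C"
  shows "operator_norm I wdom (commutator wswap (mult_op m)) \<le> ereal C
    \<longleftrightarrow> (\<forall>i\<in>I. w i * cmod (m (\<sigma> i) - m i) \<le> C)"
proof
  assume le: "operator_norm I wdom (commutator wswap (mult_op m)) \<le> ereal C"
  show "\<forall>i\<in>I. w i * cmod (m (\<sigma> i) - m i) \<le> C"
  proof
    fix j assume j: "j \<in> I"
    let ?\<theta> = "commutator wswap (mult_op m) (unit_vec (\<sigma> j))"
    have "\<sigma> j \<in> I" using j by simp
    have eq: "?\<theta> i = (if i = j then w j * (m (\<sigma> j) - m j) else 0)" for i
    proof -
      have "\<sigma> i = \<sigma> j \<longleftrightarrow> i = j" by (metis invol)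
      then show ?thesis by (simp only: commutator_mult_op) (simp add: unit_vec_def)
    qed
    then have "?\<theta> \<in> ell2 I"
      using j by (intro ell2_finite_support[of "{j}"]) auto
    then have "cmod (?\<theta> j) \<le> ell2_norm I ?\<theta>" by (rule ell2_coord_le)
    also have "ereal (ell2_norm I ?\<theta>) \<le> ereal C"
      using le unit_vec_wdom[OF \<open>\<sigma> j \<in> I\<close>] ell2_norm_unit_vec[of I "\<sigma> j"]
      unfolding operator_norm_def SUP_le_iff by blast
    finally show "w j * cmod (m (\<sigma> j) - m j) \<le> C"
      using w_pos[OF j] by (simp add: eq norm_mult)
  qed
next
  assume le: "\<forall>i\<in>I. w i * cmod (m (\<sigma> i) - m i) \<le> C"
  show "operator_norm I wdom (commutator wswap (mult_op m)) \<le> ereal C"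
    unfolding operator_norm_def
  proof (rule SUP_least)
    fix \<phi> assume "\<phi> \<in> {\<phi> \<in> wdom. ell2_norm I \<phi> \<le> 1}"
    then have \<phi>: "\<phi> \<in> ell2 I" "ell2_norm I \<phi> \<le> 1" by (auto simp: wdom_def)
    have "ell2_norm I (commutator wswap (mult_op m) \<phi>) \<le> C * ell2_norm I \<phi>"
    proof (rule ell2_dominated(2)[OF \<phi>(1) inj_invol image_invol assms])
      fix i assume "i \<notin> I"
      then show "commutator wswap (mult_op m) \<phi> i = 0"
        using ell2_zero[OF \<phi>(1), of "\<sigma> i"] by (simp add: commutator_mult_op)
    next
      fix i assume i: "i \<in> I"
      then have "w i * cmod (m (\<sigma> i) - m i) * cmod (\<phi> (\<sigma> i)) \<le> C * cmod (\<phi> (\<sigma> i))"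
        using le by (intro mult_right_mono) auto
      then show "cmod (commutator wswap (mult_op m) \<phi> i) \<le> C * cmod (\<phi> (\<sigma> i))"
        using w_pos[OF i] by (simp add: commutator_mult_op norm_mult)
    qed
    also have "\<dots> \<le> C * 1" using \<phi>(2) assms by (rule mult_left_mono)
    finally show "ereal (ell2_norm I (commutator wswap (mult_op m) \<phi>)) \<le> ereal C" by simp
  qed
qed

lemma operator_norm_commutator_less_infinity_iff:
  "operator_norm I wdom (commutator wswap (mult_op m)) < \<infinity>
    \<longleftrightarrow> (\<exists>C. \<forall>i\<in>I. w i * cmod (m (\<sigma> i) - m i) \<le> C)"
proof
  assume "operator_norm I wdom (commutator wswap (mult_op m)) < \<infinity>"
  then obtain C where "operator_norm I wdom (commutator wswap (mult_op m)) \<le> ereal C"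
    by (cases "operator_norm I wdom (commutator wswap (mult_op m))") auto
  then have "operator_norm I wdom (commutator wswap (mult_op m)) \<le> ereal (max C 0)"
    by (rule order_trans) simp
  then have "\<forall>i\<in>I. w i * cmod (m (\<sigma> i) - m i) \<le> max C 0"
    by (subst (asm) operator_norm_commutator_le_iff) auto
  then show "\<exists>C. \<forall>i\<in>I. w i * cmod (m (\<sigma> i) - m i) \<le> C" by blast
next
  assume "\<exists>C. \<forall>i\<in>I. w i * cmod (m (\<sigma> i) - m i) \<le> C"
  then obtain C where "\<forall>i\<in>I. w i * cmod (m (\<sigma> i) - m i) \<le> max C 0"
    by (auto simp: le_max_iff_disj)
  then have "operator_norm I wdom (commutator wswap (mult_op m)) \<le> ereal (max C 0)"
    by (subst operator_norm_commutator_le_iff) auto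
  then show "operator_norm I wdom (commutator wswap (mult_op m)) < \<infinity>"
    by (rule order.strict_trans1) (simp add: max_def)
qed

end

section \<open>The path space\<close>

lemma topspace_path_space [simp]: "topspace (path_space G) = inf_paths G"
  by (auto simp: path_space_def inf_paths_def)

text \<open>A basic open set of the product restricts finitely many coordinates, and these lie below
  some \<open>N\<close>; hence the cylinders on initial segments form a base.\<close>

lemma openin_product_discrete_iff:
  "openin (product_topology (\<lambda>_::nat. discrete_topology A) UNIV) U \<longleftrightarrow>
     U \<subseteq> UNIV \<rightarrow> A \<and> (\<forall>x\<in>U. \<exists>N. \<forall>y\<in>UNIV \<rightarrow> A. (\<forall>i<N. y i = x i) \<longrightarrow> y \<in> U)"
    (is "?L \<longleftrightarrow> ?R")
proof
  assume L: ?L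
  then have sub: "U \<subseteq> UNIV \<rightarrow> A"
    using openin_subset[OF L] by (auto simp: PiE_def)
  show ?R
  proof (intro conjI sub ballI)
    fix x assume "x \<in> U"
    with L obtain V where fin: "finite {i. V i \<noteq> A}" and x: "x \<in> Pi\<^sub>E UNIV V"
      and V: "Pi\<^sub>E UNIV V \<subseteq> U"
      unfolding openin_product_topology_alt by auto
    from fin obtain N where N: "\<And>i. V i \<noteq> A \<Longrightarrow> i < N"
      unfolding finite_nat_set_iff_bounded by blast
    have "y \<in> U" if "y \<in> UNIV \<rightarrow> A" "\<forall>i<N. y i = x i" for y
    proof (rule subsetD[OF V])
      have "y i \<in> V i" for i
        using that x N[of i] by (cases "i < N") (auto simp: PiE_iff Pi_iff)
      then show "y \<in> Pi\<^sub>E UNIV V" by (simp add: PiE_iff extensional_def)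
    qed
    then show "\<exists>N. \<forall>y\<in>UNIV \<rightarrow> A. (\<forall>i<N. y i = x i) \<longrightarrow> y \<in> U" by blast
  qed
next
  assume R: ?R
  show ?L
    unfolding openin_product_topology_alt
  proof
    fix x assume "x \<in> U"
    from bspec[OF conjunct2[OF R] this]
    obtain N where N: "\<forall>y\<in>UNIV \<rightarrow> A. (\<forall>i<N. y i = x i) \<longrightarrow> y \<in> U" ..
    have xA: "x i \<in> A" for i using R \<open>x \<in> U\<close> by auto
    define V where "V i = (if i < N then {x i} else A)" for i
    have "finite {i. V i \<noteq> A}"
      by (rule finite_subset[of _ "{..<N}"]) (auto simp: V_def)
    moreover have "Pi\<^sub>E UNIV V \<subseteq> U"
    proof
      fix y assume y: "y \<in> Pi\<^sub>E UNIV V"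
      have yV: "y i \<in> V i" for i using y by auto
      have "y i \<in> A \<and> (i < N \<longrightarrow> y i = x i)" for i
        using yV[of i] xA[of i] by (simp add: V_def split: if_splits)
      then have "y \<in> UNIV \<rightarrow> A" "\<forall>i<N. y i = x i" by simp_all
      then show "y \<in> U" using bspec[OF N] by simp
    qed
    ultimately show "\<exists>V. finite {i \<in> UNIV. V i \<noteq> topspace (discrete_topology A)} \<and>
        (\<forall>i\<in>UNIV. openin (discrete_topology A) (V i)) \<and> x \<in> Pi\<^sub>E UNIV V \<and> Pi\<^sub>E UNIV V \<subseteq> U"
      using xA by (intro exI[of _ V]) (auto simp: V_def)
  qed
qed

lemma openin_path_space_iff:
  "openin (path_space G) U \<longleftrightarrow>
     U \<subseteq> inf_paths G \<and> (\<forall>x\<in>U. \<exists>N. \<forall>y\<in>inf_paths G. (\<forall>i<N. y i = x i) \<longrightarrow> y \<in> U)"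
    (is "?L \<longleftrightarrow> ?R")
proof
  assume ?L
  then obtain T where T: "openin (product_topology (\<lambda>_::nat. discrete_topology (arcs G)) UNIV) T"
    and U: "U = T \<inter> inf_paths G"
    unfolding path_space_def openin_subtopology by blast
  show ?R
  proof (intro conjI ballI)
    fix x assume "x \<in> U"
    then have "x \<in> T" using U by simp
    from T[unfolded openin_product_discrete_iff]
    have "\<forall>x\<in>T. \<exists>N. \<forall>y\<in>UNIV \<rightarrow> arcs G. (\<forall>i<N. y i = x i) \<longrightarrow> y \<in> T"
      by (rule conjunct2)
    from bspec[OF this \<open>x \<in> T\<close>]
    obtain N where N: "\<forall>y\<in>UNIV \<rightarrow> arcs G. (\<forall>i<N. y i = x i) \<longrightarrow> y \<in> T" ..
    have "y \<in> U" if "y \<in> inf_paths G" "\<forall>i<N. y i = x i" for y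
    proof -
      have "y \<in> UNIV \<rightarrow> arcs G" using that(1) by (simp add: inf_paths_def)
      then have "y \<in> T" using bspec[OF N] that(2) by blast
      then show ?thesis using that(1) U by simp
    qed
    then have "\<forall>y\<in>inf_paths G. (\<forall>i<N. y i = x i) \<longrightarrow> y \<in> U" by blast
    then show "\<exists>N. \<forall>y\<in>inf_paths G. (\<forall>i<N. y i = x i) \<longrightarrow> y \<in> U" by blast
  qed (use U in auto)
next
  assume R: ?R
  \<comment> \<open>\<open>T\<close> is the union of the cylinders in the full product, composable
    or not, around points of \<open>U\<close> whose traces on the path space lie in
    \<open>U\<close>.\<close>
  define T where "T = {y \<in> UNIV \<rightarrow> arcs G. \<exists>x\<in>U. \<exists>N.
      (\<forall>z\<in>inf_paths G. (\<forall>i<N. z i = x i) \<longrightarrow> z \<in> U) \<and> (\<forall>i<N. y i = x i)}"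
  have "openin (product_topology (\<lambda>_::nat. discrete_topology (arcs G)) UNIV) T"
    unfolding openin_product_discrete_iff
  proof (intro conjI ballI)
    fix y assume "y \<in> T"
    then obtain x N where "x \<in> U" "\<forall>z\<in>inf_paths G. (\<forall>i<N. z i = x i) \<longrightarrow> z \<in> U" "\<forall>i<N. y i = x i"
      by (auto simp: T_def)
    then have "z \<in> T" if "z \<in> UNIV \<rightarrow> arcs G" "\<forall>i<N. z i = y i" for z
      unfolding T_def using that by (intro CollectI conjI bexI[of _ x] exI[of _ N]) simp_all
    then have "\<forall>z\<in>UNIV \<rightarrow> arcs G. (\<forall>i<N. z i = y i) \<longrightarrow> z \<in> T" by simp
    then show "\<exists>N. \<forall>z\<in>UNIV \<rightarrow> arcs G. (\<forall>i<N. z i = y i) \<longrightarrow> z \<in> T" by blast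
  qed (auto simp: T_def)
  moreover have "U = T \<inter> inf_paths G"
  proof
    show "U \<subseteq> T \<inter> inf_paths G"
    proof
      fix x assume x: "x \<in> U"
      then have "x \<in> inf_paths G" using R by blast
      moreover from this have "x \<in> UNIV \<rightarrow> arcs G" by (simp add: inf_paths_def)
      ultimately show "x \<in> T \<inter> inf_paths G" using x R unfolding T_def by blast
    qed
  qed (auto simp: T_def)
  ultimately show ?L unfolding path_space_def openin_subtopology by blast
qed

text \<open>Composability at \<open>i\<close> involves only the letters at \<open>i\<close> and
  \<open>Suc i\<close>, so its failure persists on a cylinder. The paths therefore form a closed
  subset of a compact product of finite sets.\<close>

lemma compact_space_path_space:
  assumes "finite (arcs G)"
  shows "compact_space (path_space G)"
  unfolding path_space_def
proof (rule compact_space_subtopology, rule closedin_compact_space)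
  let ?X = "product_topology (\<lambda>_::nat. discrete_topology (arcs G)) UNIV"
  show "compact_space ?X"
    using assms by (simp add: compact_space_product_topology compact_space_discrete_topology)
  have top: "topspace ?X = UNIV \<rightarrow> arcs G" by (auto simp: PiE_def)
  have "openin ?X (topspace ?X - inf_paths G)"
    unfolding openin_product_discrete_iff top
  proof (intro conjI ballI)
    fix x assume x: "x \<in> (UNIV \<rightarrow> arcs G) - inf_paths G"
    then obtain i where i: "head G (x i) \<noteq> tail G (x (Suc i))" by (auto simp: inf_paths_def)
    have "y \<notin> inf_paths G" if "\<forall>k<Suc (Suc i). y k = x k" for y
    proof
      assume "y \<in> inf_paths G"
      then have "head G (y i) = tail G (y (Suc i))" by (simp add: inf_paths_def)
      then show False using that i by simp
    qed
    then show "\<exists>N. \<forall>y\<in>UNIV \<rightarrow> arcs G. (\<forall>i<N. y i = x i) \<longrightarrow> y \<in> (UNIV \<rightarrow> arcs G) - inf_paths G"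
      by blast
  qed auto
  moreover have "inf_paths G \<subseteq> topspace ?X" unfolding top by (auto simp: inf_paths_def)
  ultimately show "closedin ?X (inf_paths G)" by (simp add: closedin_def)
qed

lemma Hausdorff_space_path_space: "Hausdorff_space (path_space G)"
  unfolding path_space_def
  by (intro Hausdorff_space_subtopology) (simp add: Hausdorff_space_product_topology)

lemma continuous_map_path_space_iff:
  fixes f :: "(nat \<Rightarrow> 'e) \<Rightarrow> complex"
  shows "continuous_map (path_space G) euclidean f \<longleftrightarrow>
    (\<forall>x\<in>inf_paths G. \<forall>\<delta>>0. \<exists>N. \<forall>y\<in>inf_paths G. (\<forall>i<N. y i = x i) \<longrightarrow> cmod (f y - f x) < \<delta>)"
    (is "?L \<longleftrightarrow> ?R")
proof
  assume L: ?L
  show ?R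
  proof (intro ballI allI impI)
    fix x and \<delta> :: real assume x: "x \<in> inf_paths G" and "0 < \<delta>"
    have "openin (path_space G) {y \<in> inf_paths G. f y \<in> ball (f x) \<delta>}"
      using openin_continuous_map_preimage[OF L, of "ball (f x) \<delta>"] by simp
    then obtain N where "\<forall>y\<in>inf_paths G. (\<forall>i<N. y i = x i) \<longrightarrow> f y \<in> ball (f x) \<delta>"
      using x \<open>0 < \<delta>\<close> unfolding openin_path_space_iff by force
    then show "\<exists>N. \<forall>y\<in>inf_paths G. (\<forall>i<N. y i = x i) \<longrightarrow> cmod (f y - f x) < \<delta>"
      by (auto simp: dist_norm norm_minus_commute)
  qed
next
  assume R: ?R
  show ?L
    unfolding continuous_map_def
  proof (intro conjI allI impI)
    fix V :: "complex set" assume "openin euclidean V"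
    then have V: "open V" by simp
    show "openin (path_space G) {x \<in> topspace (path_space G). f x \<in> V}"
      unfolding openin_path_space_iff topspace_path_space
    proof (intro conjI ballI)
      fix x assume "x \<in> {x \<in> inf_paths G. f x \<in> V}"
      then have x: "x \<in> inf_paths G" "f x \<in> V" by auto
      then obtain \<delta> where \<delta>: "0 < \<delta>" "ball (f x) \<delta> \<subseteq> V" using V openE by blast
      then obtain N where N: "\<forall>y\<in>inf_paths G. (\<forall>i<N. y i = x i) \<longrightarrow> cmod (f y - f x) < \<delta>"
        using R x by blast
      have "f y \<in> V" if "y \<in> inf_paths G" "\<forall>i<N. y i = x i" for y
        using N that \<delta>(2) by (auto simp: dist_norm norm_minus_commute subset_iff)
      then show "\<exists>N. \<forall>y\<in>inf_paths G. (\<forall>i<N. y i = x i) \<longrightarrow> y \<in> {x \<in> inf_paths G. f x \<in> V}"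
        by blast
    qed auto
  qed auto
qed

lemma uniform_continuity_path_space:
  fixes f :: "(nat \<Rightarrow> 'e) \<Rightarrow> complex"
  assumes "finite (arcs G)" and f: "continuous_map (path_space G) euclidean f" and "0 < \<delta>"
  obtains N where "\<And>x y. x \<in> inf_paths G \<Longrightarrow> y \<in> inf_paths G \<Longrightarrow> \<forall>i<N. y i = x i
    \<Longrightarrow> cmod (f y - f x) < \<delta>"
proof -
  have "\<forall>x\<in>inf_paths G. \<exists>N. \<forall>y\<in>inf_paths G. (\<forall>i<N. y i = x i) \<longrightarrow> cmod (f y - f x) < \<delta> / 2"
    using f \<open>0 < \<delta>\<close> unfolding continuous_map_path_space_iff by (metis half_gt_zero)
  then obtain N where N: "\<And>x y. x \<in> inf_paths G \<Longrightarrow> y \<in> inf_paths G \<Longrightarrow> \<forall>i<N x. y i = x i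
      \<Longrightarrow> cmod (f y - f x) < \<delta> / 2"
    by metis
  define C where "C x = {y \<in> inf_paths G. \<forall>i<N x. y i = x i}" for x
  have C: "openin (path_space G) (C x)" for x
    unfolding openin_path_space_iff
  proof (intro conjI ballI)
    fix y assume "y \<in> C x"
    then show "\<exists>M. \<forall>z\<in>inf_paths G. (\<forall>i<M. z i = y i) \<longrightarrow> z \<in> C x"
      by (intro exI[of _ "N x"]) (auto simp: C_def)
  qed (auto simp: C_def)
  have "inf_paths G \<subseteq> \<Union> (C ` inf_paths G)" by (auto simp: C_def)
  then obtain F where F: "finite F" "F \<subseteq> C ` inf_paths G" "inf_paths G \<subseteq> \<Union> F"
    using compact_space_path_space[OF assms(1)] C unfolding compact_space_alt topspace_path_space
    by (metis (no_types, lifting) imageE)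
  from finite_subset_image[OF F(1,2)] obtain S where S: "S \<subseteq> inf_paths G" "finite S" "F = C ` S"
    by blast
  \<comment> \<open>The cylinders of the finite subcover have lengths at most \<open>M\<close>, so
    paths agreeing below \<open>M\<close> lie in the same one and are both within
    \<open>\<delta> / 2\<close> of its centre value.\<close>
  define M where "M = Max (insert 0 (N ` S))"
  have M: "N x \<le> M" if "x \<in> S" for x
    unfolding M_def using S(2) that by simp
  show ?thesis
  proof (rule that)
    fix x y assume xy: "x \<in> inf_paths G" "y \<in> inf_paths G" "\<forall>i<M. y i = x i"
    then obtain s where s: "s \<in> S" "x \<in> C s" using F(3) S(3) by blast
    then have "\<forall>i<N s. y i = s i" using xy(3) M[OF s(1)] by (auto simp: C_def)
    then have "cmod (f y - f s) < \<delta> / 2" "cmod (f x - f s) < \<delta> / 2"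
      using N s S(1) xy by (auto simp: C_def)
    then show "cmod (f y - f x) < \<delta>"
      using norm_triangle_ineq4[of "f y - f s" "f x - f s"] by simp
  qed
qed

lemma bounded_path_space:
  fixes f :: "(nat \<Rightarrow> 'e) \<Rightarrow> complex"
  assumes "finite (arcs G)" and f: "continuous_map (path_space G) euclidean f"
  obtains B where "\<And>x. x \<in> inf_paths G \<Longrightarrow> cmod (f x) \<le> B"
proof -
  have "compactin euclidean (f ` inf_paths G)"
    using compact_space_path_space[OF assms(1)] f
    by (metis compact_space_def image_compactin topspace_path_space)
  then have "bounded (f ` inf_paths G)" by (simp add: compact_imp_bounded)
  then show ?thesis using that unfolding bounded_iff by blast
qed

lemma cont_alg_add: "f \<in> cont_alg X \<Longrightarrow> g \<in> cont_alg X \<Longrightarrow> (\<lambda>x. f x + g x) \<in> cont_alg X"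
  by (simp add: cont_alg_def continuous_map_add)

lemma cont_alg_mult: "f \<in> cont_alg X \<Longrightarrow> g \<in> cont_alg X \<Longrightarrow> (\<lambda>x. f x * g x) \<in> cont_alg X"
  by (simp add: cont_alg_def continuous_map_atin tendsto_mult)

lemma cont_alg_scale: "f \<in> cont_alg X \<Longrightarrow> (\<lambda>x. c * f x) \<in> cont_alg X"
  by (simp add: cont_alg_def continuous_map_atin tendsto_mult_left)

section \<open>Horizontal edges\<close>

text \<open>The counterpart of \<open>extend_path\<close> for a prefix taken from a function on all
  indices: paths with equal prefixes give equal grafts, and no lists have to be compared.\<close>

definition graft :: "('e \<Rightarrow> 'e) \<Rightarrow> nat \<Rightarrow> (nat \<Rightarrow> 'e) \<Rightarrow> 'e \<Rightarrow> (nat \<Rightarrow> 'e)" where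
  "graft \<tau>h m x a = (\<lambda>i. if i < m then x i else (\<tau>h ^^ (i - m)) a)"

lemma graft_less [simp]: "i < m \<Longrightarrow> graft \<tau>h m x a i = x i"
  by (simp add: graft_def)

lemma graft_eq [simp]: "graft \<tau>h m x a m = a"
  by (simp add: graft_def)

lemma graft_Suc [simp]: "m \<le> i \<Longrightarrow> graft \<tau>h m x a (Suc i) = \<tau>h (graft \<tau>h m x a i)"
  by (simp add: graft_def Suc_diff_le)

lemma graft_cong: "(\<And>i. i < m \<Longrightarrow> x i = y i) \<Longrightarrow> graft \<tau>h m x a = graft \<tau>h m y a"
  by (auto simp: graft_def)

lemma graft_absorb:
  assumes "\<And>i. m \<le> i \<Longrightarrow> x (Suc i) = \<tau>h (x i)"
  shows "graft \<tau>h m x (x m) = x"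
proof
  fix i
  have "x (m + k) = (\<tau>h ^^ k) (x m)" for k
    by (induction k) (simp_all add: assms)
  from this[of "i - m"] show "graft \<tau>h m x (x m) i = x i"
    by (cases "i < m") (simp_all add: graft_def)
qed

text \<open>Connects successive truncations: the extension of the prefix ending in
  \<open>x m\<close> already has \<open>\<tau>h (x m)\<close> as its next letter, so the next
  truncation arises by exchanging that letter for \<open>x (Suc m)\<close> and extending
  again.\<close>

lemma graft_Suc_\<tau>h: "graft \<tau>h (Suc m) x (\<tau>h (x m)) = graft \<tau>h m x (x m)"
proof -
  have "graft \<tau>h (Suc m) x (\<tau>h (x m)) = graft \<tau>h (Suc m) (graft \<tau>h m x (x m)) (\<tau>h (x m))"
    by (rule graft_cong) (auto simp: less_Suc_eq)
  also have "\<dots> = graft \<tau>h m x (x m)"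
    using graft_absorb[of "Suc m" "graft \<tau>h m x (x m)" \<tau>h] by simp
  finally show ?thesis .
qed

lemma extend_path_snoc: "extend_path \<tau>h (\<eta> @ [a]) = graft \<tau>h (length \<eta>) ((!) \<eta>) a"
proof
  fix i show "extend_path \<tau>h (\<eta> @ [a]) i = graft \<tau>h (length \<eta>) ((!) \<eta>) a i"
    by (cases i "length \<eta>" rule: linorder_cases) (simp_all add: extend_path_def graft_def nth_append)
qed

section \<open>Path extensions and the levels of horizontal edges\<close>

context horizontal_data
begin

lemma \<tau>h_arc:
  assumes "\<epsilon> \<in> arcs G"
  shows "\<tau>h \<epsilon> \<in> arcs G" and "tail G (\<tau>h \<epsilon>) = head G \<epsilon>"
  using assms \<tau>h_lstar[of \<epsilon>] \<tau>h_closer[of \<epsilon>] lstar by (cases "head G \<epsilon> = tail G lstar"; simp)+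

lemma inf_paths_arc: "x \<in> inf_paths G \<Longrightarrow> x i \<in> arcs G"
  and inf_paths_head: "x \<in> inf_paths G \<Longrightarrow> head G (x i) = tail G (x (Suc i))"
  by (auto simp: inf_paths_def)

text \<open>Only indices below \<open>m\<close> are constrained, because the prefix may be given by
  \<open>(!) \<eta>\<close>, whose values beyond the list are arbitrary.\<close>

lemma graft_in_inf_paths:
  assumes "\<And>i. i < m \<Longrightarrow> x i \<in> arcs G" "\<And>i. Suc i < m \<Longrightarrow> head G (x i) = tail G (x (Suc i))"
    and a: "a \<in> arcs G" and "0 < m \<Longrightarrow> head G (x (m - 1)) = tail G a"
  shows "graft \<tau>h m x a \<in> inf_paths G"
proof -
  have ge: "graft \<tau>h m x a (m + k) \<in> arcs G" for k
    by (induction k) (simp_all add: a \<tau>h_arc)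
  have "graft \<tau>h m x a i \<in> arcs G \<and> head G (graft \<tau>h m x a i) = tail G (graft \<tau>h m x a (Suc i))" for i
  proof (cases "Suc i" m rule: linorder_cases)
    case less
    then show ?thesis using assms by simp
  next
    case equal
    then show ?thesis using assms by force
  next
    case greater
    then show ?thesis using ge[of "i - m"] by (simp add: \<tau>h_arc)
  qed
  then show ?thesis by (simp add: inf_paths_def)
qed

lemma graft_path:
  assumes x: "x \<in> inf_paths G" and "a \<in> arcs G" "tail G a = tail G (x m)"
  shows "graft \<tau>h m x a \<in> inf_paths G"
proof (rule graft_in_inf_paths)
  show "head G (x (m - 1)) = tail G a" if "0 < m"
    using inf_paths_head[OF x, of "m - 1"] that assms(3) by simp
qed (use assms inf_paths_arc[OF x] inf_paths_head[OF x] in auto)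

text \<open>The common letter before index \<open>m\<close> has a single head. For
  \<open>m = 0\<close> there is no such letter, and the common start vertex takes its place.\<close>

lemma tail_eq_of_agree:
  assumes "x \<in> inf_paths G" "y \<in> inf_paths G" "tail G (x 0) = tail G (y 0)" "\<And>i. i < m \<Longrightarrow> x i = y i"
  shows "tail G (x m) = tail G (y m)"
proof (cases m)
  case (Suc k)
  then show ?thesis
    using assms(4)[of k] inf_paths_head[OF assms(1), of k] inf_paths_head[OF assms(2), of k] by simp
qed (use assms in simp)

lemma awalk_nthD:
  assumes "awalk u p v"
  shows "\<And>i. i < length p \<Longrightarrow> p ! i \<in> arcs G"
    and "\<And>i. Suc i < length p \<Longrightarrow> head G (p ! i) = tail G (p ! Suc i)"
    and "p \<noteq> [] \<Longrightarrow> head G (p ! (length p - 1)) = v"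
proof -
  \<comment> \<open>The induction also tracks the tail of the first arc, which makes a prepended arc
    composable with the rest.\<close>
  have "(\<forall>i<length p. p ! i \<in> arcs G) \<and> (\<forall>i. Suc i < length p \<longrightarrow> head G (p ! i) = tail G (p ! Suc i))
      \<and> (p \<noteq> [] \<longrightarrow> tail G (p ! 0) = u \<and> head G (p ! (length p - 1)) = v)"
    using assms
  proof (induction p arbitrary: u)
    case (Cons a p)
    then have a: "a \<in> arcs G" "tail G a = u" and p: "awalk (head G a) p v"
      by (auto simp: awalk_Cons_iff)
    have v: "p = [] \<Longrightarrow> head G a = v" using p by (simp add: awalk_Nil_iff)
    show ?case
      using Cons.IH[OF p] a v by (cases p) (auto simp: nth_Cons split: nat.splits)
  qed simp
  then show "\<And>i. i < length p \<Longrightarrow> p ! i \<in> arcs G"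
    and "\<And>i. Suc i < length p \<Longrightarrow> head G (p ! i) = tail G (p ! Suc i)"
    and "p \<noteq> [] \<Longrightarrow> head G (p ! (length p - 1)) = v" by auto
qed

lemma awalk_prefix:
  assumes "x \<in> inf_paths G"
  shows "awalk (tail G (x 0)) (map x [0..<m]) (tail G (x m))"
proof (induction m)
  case 0
  then show ?case using inf_paths_arc[OF assms, of 0] by (simp add: awalk_Nil_iff)
next
  case (Suc m)
  have "awalk (tail G (x m)) [x m] (tail G (x (Suc m)))"
    using arc_implies_awalk[OF inf_paths_arc[OF assms, of m]] inf_paths_head[OF assms, of m] by simp
  from awalk_appendI[OF Suc this] show ?case by simp
qed

text \<open>A level counts letters from \<open>1\<close>, so the two components of an edge of level \<open>Suc m\<close>
  first differ at the index \<open>m\<close>.\<close>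

lemma hor_edges_level_iff:
  assumes "H' \<subseteq> maximal_horizontal G"
  shows "(x, y) \<in> hor_edges_level G \<tau>h H' (Suc m) \<longleftrightarrow>
    x \<in> inf_paths G \<and> y \<in> inf_paths G \<and> (\<forall>i<m. x i = y i) \<and> (x m, y m) \<in> H' \<and>
    (\<forall>i\<ge>m. x (Suc i) = \<tau>h (x i) \<and> y (Suc i) = \<tau>h (y i))" (is "?L \<longleftrightarrow> ?R")
proof
  assume ?L
  then obtain \<eta> \<epsilon> \<epsilon>' u where eq: "x = graft \<tau>h m ((!) \<eta>) \<epsilon>" "y = graft \<tau>h m ((!) \<eta>) \<epsilon>'"
    and len: "length \<eta> = m" and \<epsilon>: "(\<epsilon>, \<epsilon>') \<in> H'" and walk: "awalk u \<eta> (tail G \<epsilon>)"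
    by (auto simp: hor_edges_level_def extend_path_snoc)
  have arcs: "\<epsilon> \<in> arcs G" "\<epsilon>' \<in> arcs G" "tail G \<epsilon> = tail G \<epsilon>'"
    using \<epsilon> assms by (auto simp: maximal_horizontal_def)
  have "x \<in> inf_paths G" "y \<in> inf_paths G"
    unfolding eq using awalk_nthD[OF walk] len arcs by (auto intro!: graft_in_inf_paths)
  then show ?R using \<epsilon> by (simp add: eq)
next
  assume R: ?R
  then have x: "x \<in> inf_paths G" and \<epsilon>: "(x m, y m) \<in> H'" by auto
  let ?\<eta> = "map x [0..<m]"
  have "x = graft \<tau>h m x (x m)" "y = graft \<tau>h m y (y m)"
    using R graft_absorb[of m x \<tau>h] graft_absorb[of m y \<tau>h] by auto
  moreover have "graft \<tau>h m x (x m) = graft \<tau>h m ((!) ?\<eta>) (x m)"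
    "graft \<tau>h m y (y m) = graft \<tau>h m ((!) ?\<eta>) (y m)"
    using R by (auto intro: graft_cong)
  ultimately have "x = extend_path \<tau>h (?\<eta> @ [x m])" "y = extend_path \<tau>h (?\<eta> @ [y m])"
    by (simp_all add: extend_path_snoc)
  then show ?L
    unfolding hor_edges_level_def mem_Collect_eq
    using awalk_prefix[OF x, of m] \<epsilon>
    by (intro exI[of _ ?\<eta>] exI[of _ "x m"] exI[of _ "y m"] conjI exI[of _ "tail G (x 0)"]) simp_all
qed

lemma hor_edges_iff: "e \<in> hor_edges G \<tau>h H' \<longleftrightarrow> (\<exists>m. e \<in> hor_edges_level G \<tau>h H' (Suc m))"
  unfolding hor_edges_def by (auto simp: Suc_le_eq gr0_conv_Suc)

text \<open>The level is fixed by the first index where the components differ, since pairs in the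
  maximal relation are never diagonal. Two relations are allowed in order to compare edges over
  \<open>H\<close> with edges over \<open>Hp\<close>.\<close>

lemma hor_edges_level_unique:
  assumes sub: "H1 \<subseteq> maximal_horizontal G" "H2 \<subseteq> maximal_horizontal G"
    and "(x, y) \<in> hor_edges_level G \<tau>h H1 (Suc m)" "(x, y) \<in> hor_edges_level G \<tau>h H2 (Suc k)"
  shows "m = k"
proof -
  have "x m \<noteq> y m" "x k \<noteq> y k" "\<forall>i<m. x i = y i" "\<forall>i<k. x i = y i"
    using assms unfolding hor_edges_level_iff[OF sub(1)] hor_edges_level_iff[OF sub(2)]
    by (auto simp: maximal_horizontal_def)
  then show ?thesis by (metis linorder_neqE_nat)
qed

lemma level_eq:
  assumes "e \<in> hor_edges_level G \<tau>h H (Suc m)"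
  shows "level G \<tau>h H e = Suc m"
  unfolding level_def
proof (rule the_equality)
  fix n assume n: "1 \<le> n \<and> e \<in> hor_edges_level G \<tau>h H n"
  then obtain k where k: "n = Suc k" by (auto simp: Suc_le_eq gr0_conv_Suc)
  show "n = Suc m"
    using hor_edges_level_unique[OF H_subset H_subset, of "fst e" "snd e" m k] assms n
    unfolding k by simp
qed (use assms in simp)

lemma hor_edges_level_swap:
  assumes "H' \<subseteq> maximal_horizontal G" and e: "e \<in> hor_edges_level G \<tau>h H' (Suc m)"
  shows "prod.swap e \<in> hor_edges_level G \<tau>h (H'\<inverse>) (Suc m)"
proof -
  obtain x y where xy: "e = (x, y)" by (cases e)
  have "H'\<inverse> \<subseteq> maximal_horizontal G"
    using assms(1) by (auto simp: maximal_horizontal_def)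
  then show ?thesis
    using e unfolding xy by (auto simp: hor_edges_level_iff assms(1))
qed

lemma H_converse: "H\<inverse> = H"
  using H_sym by (simp add: sym_conv_converse_eq)

lemma finite_hor_edges_level: "finite (hor_edges_level G \<tau>h H (Suc m))"
proof -
  let ?P = "{p. set p \<subseteq> arcs G \<and> length p = Suc m}"
  have "hor_edges_level G \<tau>h H (Suc m) \<subseteq> (\<lambda>(p, q). (extend_path \<tau>h p, extend_path \<tau>h q)) ` (?P \<times> ?P)"
  proof
    fix e assume "e \<in> hor_edges_level G \<tau>h H (Suc m)"
    then obtain \<eta> \<epsilon> \<epsilon>' u where e: "e = (extend_path \<tau>h (\<eta> @ [\<epsilon>]), extend_path \<tau>h (\<eta> @ [\<epsilon>']))"
      and len: "length \<eta> = m" and \<epsilon>: "(\<epsilon>, \<epsilon>') \<in> H" and walk: "awalk u \<eta> (tail G \<epsilon>)"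
      by (auto simp: hor_edges_level_def)
    have "set \<eta> \<subseteq> arcs G" using walk by (auto simp: awalk_def)
    moreover have "\<epsilon> \<in> arcs G" "\<epsilon>' \<in> arcs G"
      using \<epsilon> H_subset by (auto simp: maximal_horizontal_def)
    ultimately have "(\<eta> @ [\<epsilon>], \<eta> @ [\<epsilon>']) \<in> ?P \<times> ?P" using len by simp
    then show "e \<in> (\<lambda>(p, q). (extend_path \<tau>h p, extend_path \<tau>h q)) ` (?P \<times> ?P)"
      unfolding e by (rule rev_image_eqI) simp
  qed
  moreover have "finite ?P" by (rule finite_lists_length_eq) simp
  ultimately show ?thesis by (meson finite_SigmaI finite_imageI finite_subset)
qed

abbreviation (input) edges :: "((nat \<Rightarrow> 'e) \<times> (nat \<Rightarrow> 'e)) set" where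
  "edges \<equiv> hor_edges G \<tau>h H"

lemma hor_edges_in_paths:
  assumes "e \<in> edges"
  shows "fst e \<in> inf_paths G" and "snd e \<in> inf_paths G"
proof -
  from assms obtain m where "(fst e, snd e) \<in> hor_edges_level G \<tau>h H (Suc m)"
    by (auto simp: hor_edges_iff)
  then show "fst e \<in> inf_paths G" "snd e \<in> inf_paths G"
    unfolding hor_edges_level_iff[OF H_subset] by auto
qed

lemma level_weight: "\<rho> powi (- int n) * t \<le> C \<longleftrightarrow> t \<le> C * \<rho> ^ n"
  using \<rho> by (simp add: power_int_minus field_simps)

text \<open>Symmetry of \<open>H\<close> makes reversal an involution on the edges of each level.
  Properness holds because each level is finite and the weights grow geometrically.\<close>

sublocale D: weighted_involution edges prod.swap "\<lambda>e. \<rho> powi (- int (level G \<tau>h H e))"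
proof
  show "prod.swap (prod.swap e) = e" for e :: "(nat \<Rightarrow> 'e) \<times> (nat \<Rightarrow> 'e)" by simp
  show "0 < \<rho> powi (- int (level G \<tau>h H e))" for e using \<rho> by simp
next
  fix e assume "e \<in> edges"
  then obtain m where m: "e \<in> hor_edges_level G \<tau>h H (Suc m)" by (auto simp: hor_edges_iff)
  then have "prod.swap e \<in> hor_edges_level G \<tau>h H (Suc m)"
    using hor_edges_level_swap[OF H_subset] H_converse by metis
  then show "prod.swap e \<in> edges"
    and "\<rho> powi (- int (level G \<tau>h H (prod.swap e))) = \<rho> powi (- int (level G \<tau>h H e))"
    using level_eq[OF m] level_eq[of "prod.swap e" m] by (auto simp: hor_edges_iff)
next
  fix c :: real
  \<comment> \<open>As \<open>1 / \<rho>\<close> exceeds 1, the weight is larger than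
    \<open>c\<close> from level \<open>N\<close> on.\<close>
  obtain N where N: "c < (1 / \<rho>) ^ N"
    using real_arch_pow[of "1 / \<rho>" c] \<rho> by auto
  have "{e \<in> edges. \<rho> powi (- int (level G \<tau>h H e)) \<le> c} \<subseteq> (\<Union>m<N. hor_edges_level G \<tau>h H (Suc m))"
  proof clarify
    fix x y assume e: "(x, y) \<in> edges" and le: "\<rho> powi (- int (level G \<tau>h H (x, y))) \<le> c"
    obtain m where m: "(x, y) \<in> hor_edges_level G \<tau>h H (Suc m)" using e by (auto simp: hor_edges_iff)
    have "(1 / \<rho>) ^ Suc m = \<rho> powi (- int (level G \<tau>h H (x, y)))"
      unfolding level_eq[OF m] using \<rho> by (simp only: power_int_minus power_int_of_nat) (simp add: field_simps)
    then have "(1 / \<rho>) ^ Suc m < (1 / \<rho>) ^ N" using le N by linarith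
    then have "Suc m < N"
      using \<rho> by (subst (asm) power_strict_increasing_iff) auto
    then show "(x, y) \<in> (\<Union>m<N. hor_edges_level G \<tau>h H (Suc m))" using m by auto
  qed
  then show "finite {e \<in> edges. \<rho> powi (- int (level G \<tau>h H e)) \<le> c}"
    by (rule finite_subset) (simp add: finite_hor_edges_level)
qed

lemma wswap_eq_dirac: "D.wswap = dirac G \<tau>h H \<rho>"
  by (simp add: fun_eq_iff D.wswap_def dirac_def)

lemma wdom_eq_dirac_dom: "D.wdom = dirac_dom G \<tau>h H \<rho>"
  by (simp add: D.wdom_def dirac_dom_def wswap_eq_dirac)

lemma path_rep_eq_mult_op: "path_rep f = D.mult_op (\<lambda>e. f (fst e))"
  by (simp add: fun_eq_iff D.mult_op_def path_rep_def)

end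

section \<open>The spectral triple\<close>

context horizontal_data
begin

lemma cont_alg_bounded:
  assumes "f \<in> cont_alg (path_space G)"
  obtains B where "\<And>x. x \<in> inf_paths G \<Longrightarrow> cmod (f x) \<le> B"
  using assms bounded_path_space[of G f] by (auto simp: cont_alg_def)

lemma star_representation_path_rep: "star_representation (path_space G) edges path_rep"
  unfolding star_representation_def
proof (intro conjI ballI allI)
  fix f assume "f \<in> cont_alg (path_space G)"
  then obtain B where "\<And>x. x \<in> inf_paths G \<Longrightarrow> cmod (f x) \<le> B" by (rule cont_alg_bounded) blast
  then have "\<And>e. e \<in> edges \<Longrightarrow> cmod (f (fst e)) \<le> B" using hor_edges_in_paths by blast
  then have "bounded_operator edges (\<lambda>\<phi> e. f (fst e) * \<phi> e)" by (rule bounded_operator_multiplier)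
  moreover have "path_rep f = (\<lambda>\<phi> e. f (fst e) * \<phi> e)" by (simp add: fun_eq_iff path_rep_def)
  ultimately show "bounded_operator edges (path_rep f)" by simp
next
  fix \<phi> assume \<phi>: "\<phi> \<in> ell2 edges"
  show "path_rep (\<lambda>x. if x \<in> topspace (path_space G) then 1 else 0) \<phi> = \<phi>"
  proof
    fix e show "path_rep (\<lambda>x. if x \<in> topspace (path_space G) then 1 else 0) \<phi> e = \<phi> e"
      using hor_edges_in_paths(1)[of e] ell2_zero[OF \<phi>, of e] by (auto simp: path_rep_def)
  qed
qed (simp_all add: path_rep_def ell2_inner_def algebra_simps)

text \<open>A nonzero sum has a nonzero summand; it supplies the first arc, and the induction
  hypothesis the rest of the walk. This turns primitivity into the existence of walks between any
  two vertices.\<close>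

lemma walk_of_graph_matrix_pow:
  "v \<in> verts G \<Longrightarrow> 0 < graph_matrix_pow G k v w \<Longrightarrow> \<exists>p. awalk v p w"
proof (induction k arbitrary: v)
  case 0
  then have "awalk v [] w" by (auto simp: awalk_Nil_iff split: if_splits)
  then show ?case ..
next
  case (Suc k)
  have "(\<Sum>u\<in>verts G. graph_matrix G v u * graph_matrix_pow G k u w) \<noteq> 0"
    using Suc.prems(2) unfolding graph_matrix_pow.simps by (rule gr_implies_not0)
  then have "\<exists>u\<in>verts G. graph_matrix G v u * graph_matrix_pow G k u w \<noteq> 0"
    by (meson sum.neutral)
  then obtain u where u: "u \<in> verts G" "0 < graph_matrix G v u * graph_matrix_pow G k u w"
    by auto
  then obtain p where p: "awalk u p w" using Suc.IH by auto
  from u have "{\<epsilon> \<in> arcs G. tail G \<epsilon> = v \<and> head G \<epsilon> = u} \<noteq> {}"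
    by (auto simp: graph_matrix_def card_gt_0_iff)
  then obtain \<epsilon> where "\<epsilon> \<in> arcs G" "tail G \<epsilon> = v" "head G \<epsilon> = u" by blast
  then have "awalk v (\<epsilon> # p) w" using p by (auto simp: awalk_Cons_iff)
  then show ?case ..
qed

lemma walk_between: "v \<in> verts G \<Longrightarrow> w \<in> verts G \<Longrightarrow> \<exists>p. awalk v p w"
  using primitive walk_of_graph_matrix_pow unfolding primitive_graph_def by blast

text \<open>Primitivity lets every finite path be continued to the source of a given pair in \<open>H\<close>.\<close>

lemma edge_sources_dense:
  assumes "H \<noteq> {}" and x: "x \<in> inf_paths G"
  shows "\<exists>e\<in>edges. \<forall>i<N. fst e i = x i"
proof -
  from assms obtain \<epsilon> \<epsilon>' where \<epsilon>: "(\<epsilon>, \<epsilon>') \<in> H" by auto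
  then have "\<epsilon> \<in> arcs G" using H_subset by (auto simp: maximal_horizontal_def)
  then obtain p where "awalk (tail G (x N)) p (tail G \<epsilon>)"
    using walk_between[of "tail G (x N)" "tail G \<epsilon>"] inf_paths_arc[OF x, of N] by auto
  from awalk_appendI[OF awalk_prefix[OF x] this]
  have walk: "awalk (tail G (x 0)) (map x [0..<N] @ p) (tail G \<epsilon>)" .
  let ?\<eta> = "map x [0..<N] @ p"
  let ?e = "(extend_path \<tau>h (?\<eta> @ [\<epsilon>]), extend_path \<tau>h (?\<eta> @ [\<epsilon>']))"
  have "?e \<in> hor_edges_level G \<tau>h H (Suc (length ?\<eta>))"
    unfolding hor_edges_level_def mem_Collect_eq using walk \<epsilon>
    by (intro exI[of _ ?\<eta>] exI[of _ \<epsilon>] exI[of _ \<epsilon>'] conjI exI[of _ "tail G (x 0)"]) simp_all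
  then have "?e \<in> edges" unfolding hor_edges_iff by blast
  moreover have "\<forall>i<N. fst ?e i = x i"
    by (simp add: extend_path_def nth_append)
  ultimately show ?thesis by blast
qed

text \<open>Unit vectors show that functions with equal operators agree at all sources of edges. For
  nonempty \<open>H\<close> the sources meet every cylinder, so continuity extends the equality to
  all paths.\<close>

lemma faithful_representation_path_rep:
  assumes "H \<noteq> {}"
  shows "faithful_representation (path_space G) edges path_rep"
  unfolding faithful_representation_def
proof (intro conjI star_representation_path_rep ballI impI)
  fix f g assume f: "f \<in> cont_alg (path_space G)" and g: "g \<in> cont_alg (path_space G)"
    and eq: "\<forall>\<phi>\<in>ell2 edges. path_rep f \<phi> = path_rep g \<phi>"
  have src: "f (fst e) = g (fst e)" if e: "e \<in> edges" for e
  proof -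
    have "path_rep f (unit_vec e) e = path_rep g (unit_vec e) e"
      using eq unit_vec_ell2[OF e] by simp
    then show ?thesis by (simp add: path_rep_def unit_vec_def)
  qed
  show "f = g"
  proof
    fix x show "f x = g x"
    proof (cases "x \<in> inf_paths G")
      case True
      show ?thesis
      proof (rule ccontr)
        assume "f x \<noteq> g x"
        \<comment> \<open>Half the gap: at a source close to \<open>x\<close> for both functions
          \<open>f\<close> and \<open>g\<close> are equal, which contradicts the gap.\<close>
        define \<delta> where "\<delta> = cmod (f x - g x) / 2"
        have "0 < \<delta>" using \<open>f x \<noteq> g x\<close> by (simp add: \<delta>_def)
        obtain N where N: "\<And>y. y \<in> inf_paths G \<Longrightarrow> \<forall>i<N. y i = x i \<Longrightarrow> cmod (f y - f x) < \<delta>"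
          using f True \<open>0 < \<delta>\<close> unfolding cont_alg_def continuous_map_path_space_iff by blast
        obtain M where M: "\<And>y. y \<in> inf_paths G \<Longrightarrow> \<forall>i<M. y i = x i \<Longrightarrow> cmod (g y - g x) < \<delta>"
          using g True \<open>0 < \<delta>\<close> unfolding cont_alg_def continuous_map_path_space_iff by blast
        obtain e where e: "e \<in> edges" "\<forall>i<max M N. fst e i = x i"
          using edge_sources_dense[OF assms True] by blast
        have "cmod (f (fst e) - f x) < \<delta>" "cmod (g (fst e) - g x) < \<delta>"
          using e by (auto intro!: N M hor_edges_in_paths)
        moreover have "cmod (f x - g x) \<le> cmod (g (fst e) - g x) + cmod (f (fst e) - f x)"
          using norm_triangle_ineq4[of "g (fst e) - g x" "f (fst e) - f x"] src[OF e(1)] by simp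
        ultimately show False by (simp add: \<delta>_def)
      qed
    qed (use f g in \<open>simp add: cont_alg_def\<close>)
  qed
qed

section \<open>Functions with bounded commutator\<close>

lemma path_rep_dirac_dom:
  assumes "f \<in> cont_alg (path_space G)"
  shows "path_rep f ` dirac_dom G \<tau>h H \<rho> \<subseteq> dirac_dom G \<tau>h H \<rho>"
proof -
  obtain B where "\<And>x. x \<in> inf_paths G \<Longrightarrow> cmod (f x) \<le> B" using assms by (rule cont_alg_bounded) blast
  then have "\<And>e. e \<in> edges \<Longrightarrow> cmod (f (fst e)) \<le> B" using hor_edges_in_paths by blast
  from D.mult_op_wdom[of "\<lambda>e. f (fst e)", OF this] show ?thesis
    unfolding path_rep_eq_mult_op wdom_eq_dirac_dom by blast
qed

lemma commutator_norm_le_1_iff: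
  "operator_norm edges (dirac_dom G \<tau>h H \<rho>) (commutator (dirac G \<tau>h H \<rho>) (path_rep f)) \<le> 1
    \<longleftrightarrow> (\<forall>e\<in>edges. cmod (f (snd e) - f (fst e)) \<le> \<rho> ^ level G \<tau>h H e)"
  using D.operator_norm_commutator_le_iff[of 1 "\<lambda>e. f (fst e)"]
  by (simp add: level_weight one_ereal_def flip: path_rep_eq_mult_op wdom_eq_dirac_dom wswap_eq_dirac)

lemma bounded_commutator_alg_iff:
  "f \<in> bounded_commutator_alg (path_space G) edges path_rep (dirac_dom G \<tau>h H \<rho>) (dirac G \<tau>h H \<rho>)
    \<longleftrightarrow> f \<in> cont_alg (path_space G) \<and>
      (\<exists>C. \<forall>e\<in>edges. cmod (f (snd e) - f (fst e)) \<le> C * \<rho> ^ level G \<tau>h H e)"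
  using D.operator_norm_commutator_less_infinity_iff[of "\<lambda>e. f (fst e)"] path_rep_dirac_dom[of f]
  by (auto simp: bounded_commutator_alg_def level_weight
      simp flip: path_rep_eq_mult_op wdom_eq_dirac_dom wswap_eq_dirac)

text \<open>Edges of level above \<open>N\<close> join paths with the same first \<open>N\<close>
  letters, so \<open>f\<close> does not vary along them. On the remaining levels \<rho> to the level
  is at least \<open>\<rho> ^ N\<close>, whence the constant
  \<open>2 * \<bar>B\<bar> / \<rho> ^ N\<close> for a bound \<open>B\<close> of
  \<open>f\<close>.\<close>

lemma locally_constant_bounded_commutator:
  assumes f: "f \<in> cont_alg (path_space G)"
    and const: "\<And>x y. x \<in> inf_paths G \<Longrightarrow> y \<in> inf_paths G \<Longrightarrow> \<forall>i<N. x i = y i \<Longrightarrow> f x = f y"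
  shows "\<exists>C. \<forall>e\<in>edges. cmod (f (snd e) - f (fst e)) \<le> C * \<rho> ^ level G \<tau>h H e"
proof -
  obtain B where B: "\<And>x. x \<in> inf_paths G \<Longrightarrow> cmod (f x) \<le> B" using f by (rule cont_alg_bounded) blast
  have "cmod (f (snd e) - f (fst e)) \<le> 2 * \<bar>B\<bar> / \<rho> ^ N * \<rho> ^ level G \<tau>h H e" if e: "e \<in> edges" for e
  proof -
    from e obtain m where m: "(fst e, snd e) \<in> hor_edges_level G \<tau>h H (Suc m)" by (auto simp: hor_edges_iff)
    have agree: "\<forall>i<m. fst e i = snd e i"
      using m unfolding hor_edges_level_iff[OF H_subset] by blast
    have lev: "level G \<tau>h H e = Suc m" using m by (simp add: level_eq)
    show ?thesis
    proof (cases "N \<le> m")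
      case True
      then have "f (fst e) = f (snd e)"
        using agree by (intro const hor_edges_in_paths e) auto
      then show ?thesis using \<rho> by simp
    next
      case False
      have "cmod (f (snd e) - f (fst e)) \<le> cmod (f (snd e)) + cmod (f (fst e))"
        by (rule norm_triangle_ineq4)
      also have "\<dots> \<le> 2 * \<bar>B\<bar>"
        using B[OF hor_edges_in_paths(1)[OF e]] B[OF hor_edges_in_paths(2)[OF e]] by linarith
      also have "\<dots> \<le> 2 * \<bar>B\<bar> * (\<rho> ^ Suc m / \<rho> ^ N)"
      proof -
        have "\<rho> ^ N \<le> \<rho> ^ Suc m" using \<rho> False by (intro power_decreasing) auto
        then have "1 \<le> \<rho> ^ Suc m / \<rho> ^ N" using \<rho> by (simp add: le_divide_eq)
        then show ?thesis using mult_left_mono[of 1 "\<rho> ^ Suc m / \<rho> ^ N" "2 * \<bar>B\<bar>"] by simp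
      qed
      finally show ?thesis by (simp add: lev)
    qed
  qed
  then show ?thesis by blast
qed

lemma continuous_of_locally_constant:
  fixes f :: "(nat \<Rightarrow> 'e) \<Rightarrow> complex"
  assumes "\<And>x y. x \<in> inf_paths G \<Longrightarrow> y \<in> inf_paths G \<Longrightarrow> \<forall>i<N. x i = y i \<Longrightarrow> f x = f y"
  shows "continuous_map (path_space G) euclidean f"
  unfolding continuous_map_path_space_iff
proof (intro ballI allI impI exI[of _ N])
  fix x y and \<delta> :: real assume "x \<in> inf_paths G" "y \<in> inf_paths G" "\<forall>i<N. y i = x i" "0 < \<delta>"
  then have "f y = f x" by (intro assms)
  then show "cmod (f y - f x) < \<delta>" using \<open>0 < \<delta>\<close> by simp
qed

lemma bounded_commutator_alg_dense:
  assumes f: "f \<in> cont_alg (path_space G)" and "0 < \<delta>"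
  shows "\<exists>g\<in>bounded_commutator_alg (path_space G) edges path_rep (dirac_dom G \<tau>h H \<rho>) (dirac G \<tau>h H \<rho>).
    \<forall>x\<in>topspace (path_space G). cmod (f x - g x) < \<delta>"
proof -
  obtain N where N: "\<And>x y. x \<in> inf_paths G \<Longrightarrow> y \<in> inf_paths G \<Longrightarrow> \<forall>i<N. y i = x i
      \<Longrightarrow> cmod (f y - f x) < \<delta>"
    using uniform_continuity_path_space[of G f \<delta>] f \<open>0 < \<delta>\<close> by (auto simp: cont_alg_def)
  \<comment> \<open>Sampling \<open>f\<close> at the extension of the first \<open>Suc N\<close>
    letters makes \<open>g\<close> locally constant, and the sampling point stays in the cylinder of
    length \<open>N\<close> around \<open>x\<close>.\<close>
  define g where "g x = (if x \<in> inf_paths G then f (graft \<tau>h N x (x N)) else 0)" for x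
  have const: "g x = g y" if "x \<in> inf_paths G" "y \<in> inf_paths G" "\<forall>i<Suc N. x i = y i" for x y
  proof -
    have "graft \<tau>h N x (x N) = graft \<tau>h N y (y N)"
      using that(3) by (auto intro: graft_cong simp: less_Suc_eq)
    then show ?thesis using that by (simp add: g_def)
  qed
  have "continuous_map (path_space G) euclidean g"
    using const by (rule continuous_of_locally_constant)
  then have "g \<in> cont_alg (path_space G)" by (simp add: cont_alg_def) (simp add: g_def)
  moreover have "\<exists>C. \<forall>e\<in>edges. cmod (g (snd e) - g (fst e)) \<le> C * \<rho> ^ level G \<tau>h H e"
    using calculation const by (rule locally_constant_bounded_commutator)
  ultimately have "g \<in> bounded_commutator_alg (path_space G) edges path_rep (dirac_dom G \<tau>h H \<rho>) (dirac G \<tau>h H \<rho>)"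
    by (simp add: bounded_commutator_alg_iff)
  moreover have "cmod (f x - g x) < \<delta>" if x: "x \<in> inf_paths G" for x
  proof -
    have "graft \<tau>h N x (x N) \<in> inf_paths G" using x by (intro graft_path) (simp_all add: inf_paths_arc)
    then show ?thesis using x by (simp add: g_def N)
  qed
  ultimately show ?thesis by auto
qed

lemma dense_subalgebra_bounded_commutator_alg:
  "dense_subalgebra (path_space G)
    (bounded_commutator_alg (path_space G) edges path_rep (dirac_dom G \<tau>h H \<rho>) (dirac G \<tau>h H \<rho>))"
  (is "dense_subalgebra ?X ?A")
  unfolding dense_subalgebra_def
proof (intro conjI ballI allI impI)
  show "?A \<subseteq> cont_alg ?X" by (auto simp: bounded_commutator_alg_def)
  have "(\<lambda>x. 0) \<in> cont_alg ?X" by (simp add: cont_alg_def)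
  then show "(\<lambda>x. 0) \<in> ?A" by (auto simp: bounded_commutator_alg_iff intro: exI[of _ 0])
next
  fix f g assume fg: "f \<in> ?A" "g \<in> ?A"
  let ?\<Delta> = "\<lambda>f e. f (snd e) - f (fst e) :: complex" and ?l = "\<lambda>e. \<rho> ^ level G \<tau>h H e"
  obtain C1 C2 where C1: "\<And>e. e \<in> edges \<Longrightarrow> cmod (?\<Delta> f e) \<le> C1 * ?l e"
    and C2: "\<And>e. e \<in> edges \<Longrightarrow> cmod (?\<Delta> g e) \<le> C2 * ?l e"
    using fg unfolding bounded_commutator_alg_iff by blast
  have cont: "f \<in> cont_alg ?X" "g \<in> cont_alg ?X"
    using fg unfolding bounded_commutator_alg_iff by blast+
  have "cmod (?\<Delta> (\<lambda>x. f x + g x) e) \<le> (C1 + C2) * ?l e" if "e \<in> edges" for e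
    using norm_triangle_ineq[of "?\<Delta> f e" "?\<Delta> g e"] C1[OF that] C2[OF that]
    by (simp add: algebra_simps)
  then show "(\<lambda>x. f x + g x) \<in> ?A"
    using cont_alg_add[OF cont] unfolding bounded_commutator_alg_iff by blast
  obtain B1 where B1: "\<And>x. x \<in> inf_paths G \<Longrightarrow> cmod (f x) \<le> B1" using cont(1) by (rule cont_alg_bounded) blast
  obtain B2 where B2: "\<And>x. x \<in> inf_paths G \<Longrightarrow> cmod (g x) \<le> B2" using cont(2) by (rule cont_alg_bounded) blast
  have "cmod (?\<Delta> (\<lambda>x. f x * g x) e) \<le> (B1 * C2 + B2 * C1) * ?l e" if e: "e \<in> edges" for e
  proof -
    \<comment> \<open>The Leibniz rule along an edge; boundedness of \<open>f\<close> and
      \<open>g\<close> controls the factors that are not differenced.\<close>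
    have "?\<Delta> (\<lambda>x. f x * g x) e = f (snd e) * ?\<Delta> g e + g (fst e) * ?\<Delta> f e"
      by (simp add: algebra_simps)
    then have "cmod (?\<Delta> (\<lambda>x. f x * g x) e)
        \<le> cmod (f (snd e)) * cmod (?\<Delta> g e) + cmod (g (fst e)) * cmod (?\<Delta> f e)"
      by (metis norm_mult norm_triangle_ineq)
    also have "\<dots> \<le> B1 * (C2 * ?l e) + B2 * (C1 * ?l e)"
    proof -
      have "cmod (f (snd e)) \<le> B1" "cmod (g (fst e)) \<le> B2"
        using B1 B2 hor_edges_in_paths[OF e] by auto
      moreover from this have "0 \<le> B1" "0 \<le> B2" using norm_ge_zero order_trans by blast+
      ultimately show ?thesis
        using C1[OF e] C2[OF e] by (intro add_mono mult_mono) auto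
    qed
    finally show ?thesis by (simp add: algebra_simps)
  qed
  then show "(\<lambda>x. f x * g x) \<in> ?A"
    using cont_alg_mult[OF cont] unfolding bounded_commutator_alg_iff by blast
next
  fix c f assume "f \<in> ?A"
  then obtain C where f: "f \<in> cont_alg ?X"
    and C: "\<And>e. e \<in> edges \<Longrightarrow> cmod (f (snd e) - f (fst e)) \<le> C * \<rho> ^ level G \<tau>h H e"
    unfolding bounded_commutator_alg_iff by blast
  have "cmod (c * f (snd e) - c * f (fst e)) \<le> (cmod c * C) * \<rho> ^ level G \<tau>h H e" if "e \<in> edges" for e
    using mult_left_mono[OF C[OF that], of "cmod c"] by (simp add: mult.assoc flip: norm_mult right_diff_distrib)
  then show "(\<lambda>x. c * f x) \<in> ?A"
    using cont_alg_scale[OF f] unfolding bounded_commutator_alg_iff by blast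
next
  fix f and \<delta> :: real assume "f \<in> cont_alg ?X" "0 < \<delta>"
  then show "\<exists>g\<in>?A. \<forall>x\<in>topspace ?X. cmod (f x - g x) < \<delta>" by (rule bounded_commutator_alg_dense)
qed

lemma spectral_triple_path_space:
  assumes "H \<noteq> {}"
  shows "spectral_triple (path_space G) edges path_rep (dirac_dom G \<tau>h H \<rho>) (dirac G \<tau>h H \<rho>)"
  unfolding spectral_triple_def
  using compact_space_path_space[of G] Hausdorff_space_path_space[of G]
    faithful_representation_path_rep[OF assms] dense_subalgebra_bounded_commutator_alg
    D.self_adjoint_wswap D.compact_resolvent_wswap
  by (simp add: wswap_eq_dirac wdom_eq_dirac_dom)

section \<open>Orientation and grading\<close>

lemma Hp_subset: "Hp \<subseteq> maximal_horizontal G"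
  using H_subset orientation(1) by blast

text \<open>By uniqueness of the level, the sign of an edge is decided at the first index where its
  components differ.\<close>

lemma hor_edges_positive_iff:
  assumes "(x, y) \<in> hor_edges_level G \<tau>h H (Suc m)"
  shows "(x, y) \<in> hor_edges G \<tau>h Hp \<longleftrightarrow> (x m, y m) \<in> Hp"
proof
  assume "(x, y) \<in> hor_edges G \<tau>h Hp"
  then obtain k where k: "(x, y) \<in> hor_edges_level G \<tau>h Hp (Suc k)" by (auto simp: hor_edges_iff)
  then have "m = k" using hor_edges_level_unique[OF H_subset Hp_subset assms] by blast
  then show "(x m, y m) \<in> Hp" using k unfolding hor_edges_level_iff[OF Hp_subset] by blast
next
  assume "(x m, y m) \<in> Hp"
  then have "(x, y) \<in> hor_edges_level G \<tau>h Hp (Suc m)"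
    using assms unfolding hor_edges_level_iff[OF Hp_subset] hor_edges_level_iff[OF H_subset] by blast
  then show "(x, y) \<in> hor_edges G \<tau>h Hp" unfolding hor_edges_iff by blast
qed

lemma hor_edges_positive_swap:
  assumes "e \<in> edges"
  shows "prod.swap e \<in> hor_edges G \<tau>h Hp \<longleftrightarrow> e \<notin> hor_edges G \<tau>h Hp"
proof -
  obtain x y where e: "e = (x, y)" by (cases e)
  obtain m where m: "(x, y) \<in> hor_edges_level G \<tau>h H (Suc m)"
    using assms by (auto simp: e hor_edges_iff)
  have "(y, x) \<in> hor_edges_level G \<tau>h H (Suc m)"
    using hor_edges_level_swap[OF H_subset m] H_converse by simp
  moreover have "(x m, y m) \<in> H" using m unfolding hor_edges_level_iff[OF H_subset] by blast
  ultimately show ?thesis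
    using m orientation by (auto simp: e hor_edges_positive_iff)
qed

lemma even_spectral_triple_path_space:
  assumes "H \<noteq> {}"
  shows "even_spectral_triple (path_space G) edges path_rep
    (dirac_dom G \<tau>h H \<rho>) (dirac G \<tau>h H \<rho>) (grading G \<tau>h Hp)"
proof -
  \<comment> \<open>The grading is multiplication by a sign that reversal of an edge flips. The flip
    gives anticommutation with \<open>D\<close>, while multiplication operators commute with
    \<open>path_rep f\<close>.\<close>
  define s where "s e = (if e \<in> hor_edges G \<tau>h Hp then 1 else -1 :: complex)" for e
  have grading: "grading G \<tau>h Hp = D.mult_op s"
    by (simp add: fun_eq_iff grading_def D.mult_op_def s_def)
  have s: "s e * s e = 1" "cnj (s e) = s e" "cmod (s e) \<le> 1" for e
    by (simp_all add: s_def)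
  have s_swap: "s (prod.swap e) = - s e" if "e \<in> edges" for e
    using hor_edges_positive_swap[OF that] by (simp add: s_def)
  show ?thesis
    unfolding even_spectral_triple_def grading
  proof (intro conjI ballI spectral_triple_path_space assms)
    have "bounded_operator edges (\<lambda>\<phi> e. s e * \<phi> e)"
      by (rule bounded_operator_multiplier[OF s(3)])
    moreover have "D.mult_op s = (\<lambda>\<phi> e. s e * \<phi> e)" by (simp add: fun_eq_iff D.mult_op_def)
    ultimately show "bounded_operator edges (D.mult_op s)" by simp
  next
    fix \<phi> :: "(nat \<Rightarrow> 'e) \<times> (nat \<Rightarrow> 'e) \<Rightarrow> complex"
    show "D.mult_op s (D.mult_op s \<phi>) = \<phi>"
      by (simp add: D.mult_op_def s(1) flip: mult.assoc)
  next
    fix \<phi> \<psi> :: "(nat \<Rightarrow> 'e) \<times> (nat \<Rightarrow> 'e) \<Rightarrow> complex"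
    show "ell2_inner edges (D.mult_op s \<phi>) \<psi> = ell2_inner edges \<phi> (D.mult_op s \<psi>)"
      by (simp add: ell2_inner_def D.mult_op_def s(2) mult.assoc mult.left_commute)
  next
    fix f \<phi> show "D.mult_op s (path_rep f \<phi>) = path_rep f (D.mult_op s \<phi>)"
      by (simp add: D.mult_op_def path_rep_def mult.left_commute)
  next
    fix \<phi> assume \<phi>: "\<phi> \<in> dirac_dom G \<tau>h H \<rho>"
    then show "D.mult_op s \<phi> \<in> dirac_dom G \<tau>h H \<rho>"
      using D.mult_op_wdom[of s 1] s(3) by (simp add: wdom_eq_dirac_dom)
    have \<phi>': "\<phi> \<in> ell2 edges" using \<phi> by (simp add: dirac_dom_def)
    show "dirac G \<tau>h H \<rho> (D.mult_op s \<phi>) = (\<lambda>e. - D.mult_op s (dirac G \<tau>h H \<rho> \<phi>) e)"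
    proof
      fix e
      show "dirac G \<tau>h H \<rho> (D.mult_op s \<phi>) e = - D.mult_op s (dirac G \<tau>h H \<rho> \<phi>) e"
      proof (cases "e \<in> edges")
        case True
        then show ?thesis by (simp add: dirac_def D.mult_op_def s_swap)
      next
        \<comment> \<open>Off the edges both sides vanish, because \<open>\<phi>\<close> does and
          the complement of the edges is closed under reversal.\<close>
        case False
        then have "\<phi> (prod.swap e) = 0" using ell2_zero[OF \<phi>', of "prod.swap e"] by simp
        then show ?thesis by (simp add: dirac_def D.mult_op_def)
      qed
    qed
  qed
qed

end

section \<open>The distance formula\<close>

lemma horizontal_graph_simps [simp]:
  "verts (horizontal_graph G H) = arcs G" "arcs (horizontal_graph G H) = H"
  "tail (horizontal_graph G H) = fst" "head (horizontal_graph G H) = snd"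
  by (simp_all add: horizontal_graph_def)

context horizontal_data
begin

section \<open>The horizontal graph and its distance\<close>

lemma wf_horizontal_graph: "wf_digraph (horizontal_graph G H)"
  using H_subset by (auto simp: maximal_horizontal_def intro!: wf_digraph.intro)

sublocale hg: wf_digraph "horizontal_graph G H"
  by (rule wf_horizontal_graph)

lemma horizontal_awalk_relpow: "hg.awalk a p b \<Longrightarrow> (a, b) \<in> H ^^ length p"
proof (induction p arbitrary: a)
  case (Cons e p)
  then have "(a, snd e) \<in> H" "hg.awalk (snd e) p b"
    by (auto simp: hg.awalk_Cons_iff)
  with Cons.IH show ?case unfolding length_Cons by (blast intro: relpow_Suc_I2)
qed (simp add: hg.awalk_Nil_iff)

lemma relpow_horizontal_awalk:
  "a \<in> arcs G \<Longrightarrow> (a, b) \<in> H ^^ k \<Longrightarrow> \<exists>p. hg.awalk a p b \<and> length p = k"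
proof (induction k arbitrary: a)
  case 0
  then show ?case by (auto simp: hg.awalk_Nil_iff)
next
  case (Suc k)
  then obtain c where c: "(a, c) \<in> H" "(c, b) \<in> H ^^ k" by (meson relpow_Suc_E2)
  then have "c \<in> arcs G" using H_subset by (auto simp: maximal_horizontal_def)
  then obtain p where "hg.awalk c p b" "length p = k" using Suc.IH c(2) by blast
  then have "hg.awalk a ((a, c) # p) b \<and> length ((a, c) # p) = Suc k"
    using c(1) by (simp add: hg.awalk_Cons_iff)
  then show ?case by blast
qed

text \<open>Natural-number form of \<open>horizontal_dist\<close>, meaningful for pairs in
  \<open>H\<^sup>*\<close>. Relational powers replace walks, so that symmetry and the triangle
  inequality become facts about relations.\<close>

definition hdist :: "'e \<Rightarrow> 'e \<Rightarrow> nat" where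
  "hdist a b = (LEAST k. (a, b) \<in> H ^^ k)"

lemma hdist_le: "(a, b) \<in> H ^^ k \<Longrightarrow> hdist a b \<le> k"
  unfolding hdist_def by (rule Least_le)

lemma relpow_hdist: "(a, b) \<in> H\<^sup>* \<Longrightarrow> (a, b) \<in> H ^^ hdist a b"
  unfolding hdist_def by (rule LeastI_ex) (rule rtrancl_imp_relpow)

lemma horizontal_dist_eq:
  assumes "a \<in> arcs G" "(a, b) \<in> H\<^sup>*"
  shows "horizontal_dist G H a b = ereal (real (hdist a b))"
proof -
  have cost: "hg.awalk_cost (\<lambda>_. 1) p = real (length p)" for p :: "('e \<times> 'e) list"
    by (induction p) simp_all
  show ?thesis
    unfolding horizontal_dist_def hg.\<mu>_def cost
  proof (rule antisym)
    obtain p where "hg.awalk a p b" "length p = hdist a b"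
      using relpow_horizontal_awalk[OF assms(1) relpow_hdist[OF assms(2)]] by blast
    then show "(INF p\<in>{p. hg.awalk a p b}. ereal (real (length p))) \<le> ereal (real (hdist a b))"
      by (intro INF_lower2[of p]) auto
    show "ereal (real (hdist a b)) \<le> (INF p\<in>{p. hg.awalk a p b}. ereal (real (length p)))"
      by (rule INF_greatest) (auto intro: hdist_le horizontal_awalk_relpow)
  qed
qed

lemma horizontal_dist_infinity:
  assumes "(a, b) \<notin> H\<^sup>*"
  shows "horizontal_dist G H a b = \<infinity>"
proof -
  have "{p. hg.awalk a p b} = {}"
    using assms horizontal_awalk_relpow relpow_imp_rtrancl by blast
  then show ?thesis unfolding horizontal_dist_def hg.\<mu>_def by (simp add: top_ereal_def)
qed

text \<open>Pairs in \<open>H\<close> have a common tail, so a chain in \<open>H\<close> stays among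
  the arcs leaving one vertex; this is the source of the infinite distances.\<close>

lemma rtrancl_H_tail: "(a, b) \<in> H\<^sup>* \<Longrightarrow> tail G a = tail G b"
  by (induction rule: rtrancl_induct) (use H_subset in \<open>auto simp: maximal_horizontal_def\<close>)

lemma hdist_self [simp]: "hdist a a = 0"
  using hdist_le[of a a 0] by simp

lemma hdist_pos:
  assumes "(a, b) \<in> H\<^sup>*" "a \<noteq> b"
  shows "1 \<le> hdist a b"
  using relpow_hdist[OF assms(1)] assms(2) by (cases "hdist a b") auto

lemma hdist_H:
  assumes "(a, b) \<in> H"
  shows "hdist a b = 1"
proof (rule antisym)
  show "hdist a b \<le> 1" using hdist_le[of a b 1] assms by simp
  show "1 \<le> hdist a b"
    using assms H_subset by (intro hdist_pos) (auto simp: maximal_horizontal_def)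
qed

lemma sym_relpow_H: "(a, b) \<in> H ^^ k \<Longrightarrow> (b, a) \<in> H ^^ k"
proof (induction k arbitrary: b)
  case (Suc k)
  then obtain c where "(a, c) \<in> H ^^ k" "(c, b) \<in> H" by (meson relpow_Suc_E)
  then show ?case using Suc.IH symD[OF H_sym] by (meson relpow_Suc_I2)
qed simp

lemma hdist_sym: "hdist a b = hdist b a"
  unfolding hdist_def by (metis sym_relpow_H)

lemma hdist_triangle:
  assumes "(a, b) \<in> H\<^sup>*" "(b, c) \<in> H\<^sup>*"
  shows "hdist a c \<le> hdist a b + hdist b c"
  by (rule hdist_le) (use assms in \<open>auto simp: relpow_add intro: relpow_hdist\<close>)

lemma rtrancl_of_sufficiently_large:
  assumes "sufficiently_large G H" "a \<in> arcs G" "b \<in> arcs G" "tail G a = tail G b"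
  shows "(a, b) \<in> H\<^sup>*"
proof -
  have "a \<rightarrow>\<^sup>*\<^bsub>horizontal_graph G H\<^esub> b"
    using assms by (simp add: sufficiently_large_def)
  then obtain p where "hg.awalk a p b" by (auto simp: hg.reachable_awalk)
  then show ?thesis using horizontal_awalk_relpow relpow_imp_rtrancl by blast
qed

text \<open>Letters are counted from 1, so a first difference at index \<open>m\<close> concerns the
  letter \<open>Suc m\<close>.\<close>

lemma split_index_eq:
  assumes "\<forall>i<m. x i = y i" "x m \<noteq> y m"
  shows "split_index x y = Suc m"
  unfolding split_index_def letter_def
proof (rule Greatest_equality)
  show "\<forall>i. 1 \<le> i \<and> i < Suc m \<longrightarrow> x (i - 1) = y (i - 1)" using assms(1) by auto
  fix n assume n: "\<forall>i. 1 \<le> i \<and> i < n \<longrightarrow> x (i - 1) = y (i - 1)"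
  show "n \<le> Suc m" using n[rule_format, of "Suc m"] assms(2) by force
qed

lemma first_difference:
  assumes "x \<noteq> (y :: nat \<Rightarrow> 'e)"
  obtains m where "\<forall>i<m. x i = y i" "x m \<noteq> y m"
  using exists_least_iff[of "\<lambda>m. x m \<noteq> y m"] assms by (auto simp: fun_eq_iff)

text \<open>The first differing letters leave the same vertex, so maximality makes them adjacent in
  \<open>H\<close>. With different start vertices the first letters are not joined by any chain, and
  the coefficient would be \<open>\<infinity>\<close>.\<close>

lemma split_coeff_maximal:
  assumes "H = maximal_horizontal G" "x \<in> inf_paths G" "y \<in> inf_paths G" "x \<noteq> y"
    and "tail G (x 0) = tail G (y 0)"
  shows "split_coeff G H x y = 1"
proof -
  obtain m where m: "\<forall>i<m. x i = y i" "x m \<noteq> y m" using assms(4) by (rule first_difference)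
  have "tail G (x m) = tail G (y m)" by (rule tail_eq_of_agree[OF assms(2,3,5)]) (use m(1) in blast)
  then have "(x m, y m) \<in> H"
    using m(2) assms inf_paths_arc by (simp add: maximal_horizontal_def)
  then have "horizontal_dist G H (x m) (y m) = 1"
    using horizontal_dist_eq[OF inf_paths_arc[OF assms(2)] r_into_rtrancl]
    by (simp add: hdist_H one_ereal_def)
  then show ?thesis using split_index_eq[OF m] by (simp add: split_coeff_def letter_def)
qed

lemma branch_coeff_maximal:
  assumes "H = maximal_horizontal G" "z \<in> inf_paths G" "2 \<le> n"
  shows "branch_coeff G \<tau>h H z n = (if \<tau>h (letter z (n - 1)) \<noteq> letter z n then 1 else 0)"
proof -
  let ?a = "letter z (n - 1)" and ?b = "letter z n"
  have arcs: "\<tau>h ?a \<in> arcs G" "?b \<in> arcs G" using assms(2) by (auto simp: letter_def inf_paths_arc \<tau>h_arc)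
  \<comment> \<open>The letters \<open>n - 1\<close> and \<open>n\<close> are the entries at
    \<open>k\<close> and \<open>Suc k\<close>, so \<open>\<tau>h\<close> of the former leaves the
    same vertex as the latter.\<close>
  obtain k where "n = Suc (Suc k)" using assms(3) by (metis add_2_eq_Suc le_Suc_ex)
  then have "tail G (\<tau>h ?a) = tail G ?b"
    using inf_paths_head[OF assms(2), of k] by (simp add: letter_def inf_paths_arc assms(2) \<tau>h_arc)
  then have H: "\<tau>h ?a \<noteq> ?b \<Longrightarrow> (\<tau>h ?a, ?b) \<in> H"
    using arcs assms(1) by (simp add: maximal_horizontal_def)
  show ?thesis
  proof (cases "\<tau>h ?a = ?b")
    case True
    then show ?thesis
      unfolding branch_coeff_def using horizontal_dist_eq[of ?b ?b] arcs
      by (simp add: zero_ereal_def)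
  next
    case False
    then show ?thesis
      unfolding branch_coeff_def using horizontal_dist_eq[OF arcs(1) r_into_rtrancl[OF H[OF False]]]
      by (simp only: hdist_H[OF H[OF False]]) (simp add: one_ereal_def)
  qed
qed

end

locale connected_horizontal_data = horizontal_data G lstar \<tau>h H Hp Hm \<rho>
  for G :: "('v, 'e) pre_digraph" and lstar \<tau>h H Hp Hm \<rho> +
  assumes large: "sufficiently_large G H"
begin

section \<open>The series metric on paths\<close>

lemma connected:
  "a \<in> arcs G \<Longrightarrow> b \<in> arcs G \<Longrightarrow> tail G a = tail G b \<Longrightarrow> (a, b) \<in> H\<^sup>*"
  by (rule rtrancl_of_sufficiently_large[OF large])

text \<open>Real-valued form of \<open>branch_coeff\<close> at \<open>Suc (Suc i)\<close>: the cost
  of replacing the letter that \<open>\<tau>h\<close> predicts at index \<open>Suc i\<close> by the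
  actual one, to be weighted by \<open>\<rho> ^ Suc (Suc i)\<close>.\<close>

definition jump :: "(nat \<Rightarrow> 'e) \<Rightarrow> nat \<Rightarrow> real" where
  "jump x i = real (hdist (\<tau>h (x i)) (x (Suc i)))"

text \<open>The coefficient of \<open>\<rho> ^ Suc i\<close> in the distance. Between equal prefixes it is the
  distance in \<open>H\<close>, otherwise the way leads through the extensions of the two prefixes;
  in this form the triangle inequality holds term by term.\<close>

definition dcoeff :: "(nat \<Rightarrow> 'e) \<Rightarrow> (nat \<Rightarrow> 'e) \<Rightarrow> nat \<Rightarrow> real" where
  "dcoeff x y i = (if \<forall>k<i. x k = y k then real (hdist (x i) (y i))
     else jump x (i - 1) + jump y (i - 1))"

definition pdist :: "(nat \<Rightarrow> 'e) \<Rightarrow> (nat \<Rightarrow> 'e) \<Rightarrow> real" where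
  "pdist x y = (\<Sum>i. dcoeff x y i * \<rho> ^ Suc i)"

text \<open>A crude uniform bound for convergence and for the diameter of cylinders. Pairs with
  different tails are included, which is harmless since the maximum is over a finite set.\<close>

definition hdiam :: real where
  "hdiam = real (Max ((\<lambda>(a, b). hdist a b) ` (arcs G \<times> arcs G)))"

lemma hdist_le_hdiam: "a \<in> arcs G \<Longrightarrow> b \<in> arcs G \<Longrightarrow> real (hdist a b) \<le> hdiam"
  unfolding hdiam_def of_nat_le_iff by (rule Max_ge) auto

lemma hdiam_nonneg: "0 \<le> hdiam"
  by (simp add: hdiam_def)

lemma jump_le: "x \<in> inf_paths G \<Longrightarrow> jump x i \<le> hdiam"
  unfolding jump_def by (intro hdist_le_hdiam \<tau>h_arc inf_paths_arc)

lemma jump_nonneg: "0 \<le> jump x i"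
  by (simp add: jump_def)

lemma dcoeff_joint: "\<forall>k<i. x k = y k \<Longrightarrow> dcoeff x y i = real (hdist (x i) (y i))"
  unfolding dcoeff_def by (rule if_P)

lemma dcoeff_separate: "\<not> (\<forall>k<i. x k = y k) \<Longrightarrow> dcoeff x y i = jump x (i - 1) + jump y (i - 1)"
  unfolding dcoeff_def by (rule if_not_P)

lemma dcoeff_nonneg: "0 \<le> dcoeff x y i"
  by (simp add: dcoeff_def jump_def)

lemma dcoeff_sym: "dcoeff x y i = dcoeff y x i"
  by (auto simp: dcoeff_def hdist_sym[of "x i"])

lemma dcoeff_agree: "\<forall>k\<le>i. x k = y k \<Longrightarrow> dcoeff x y i = 0"
  by (simp add: dcoeff_def)

lemma dcoeff_le:
  assumes "x \<in> inf_paths G" "y \<in> inf_paths G"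
  shows "dcoeff x y i \<le> 2 * hdiam"
proof -
  have "real (hdist (x i) (y i)) \<le> hdiam"
    using assms by (intro hdist_le_hdiam inf_paths_arc)
  then show ?thesis
    using jump_le[OF assms(1), of "i - 1"] jump_le[OF assms(2), of "i - 1"] hdiam_nonneg
    unfolding dcoeff_def by auto
qed

lemma summable_dcoeff:
  assumes "x \<in> inf_paths G" "y \<in> inf_paths G"
  shows "summable (\<lambda>i. dcoeff x y i * \<rho> ^ Suc i)"
proof (rule summable_comparison_test')
  show "summable (\<lambda>i. 2 * hdiam * \<rho> * \<rho> ^ i)"
    using \<rho> by (intro summable_mult summable_geometric) simp
  fix i show "norm (dcoeff x y i * \<rho> ^ Suc i) \<le> 2 * hdiam * \<rho> * \<rho> ^ i"
    using mult_right_mono[OF dcoeff_le[OF assms, of i], of "\<rho> ^ Suc i"] \<rho> dcoeff_nonneg[of x y i]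
    by (simp add: abs_mult mult.assoc)
qed

lemma \<tau>h_tail_path:
  assumes "x \<in> inf_paths G" "0 < i"
  shows "tail G (\<tau>h (x (i - 1))) = tail G (x i)"
  using assms inf_paths_head[OF assms(1), of "i - 1"] by (simp add: \<tau>h_arc inf_paths_arc)

text \<open>Each coefficient is either a distance in \<open>H\<close> or a sum of two distances from
  the predicted letters. Paths agreeing below \<open>i > 0\<close> have the same predicted letter at
  \<open>i\<close>, so every case reduces to the triangle inequality of \<open>hdist\<close> through
  that letter.\<close>

lemma dcoeff_triangle:
  assumes x: "x \<in> inf_paths G" and y: "y \<in> inf_paths G" and z: "z \<in> inf_paths G"
    and t: "tail G (x 0) = tail G (y 0)" "tail G (y 0) = tail G (z 0)"
  shows "dcoeff x z i \<le> dcoeff x y i + dcoeff y z i"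
proof -
  let ?A = "\<lambda>x y. \<forall>k<i. x k = y k"
  have conn: "(u i, v i) \<in> H\<^sup>*" if "?A u v" "u \<in> {x, y, z}" "v \<in> {x, y, z}" for u v
  proof (rule connected)
    have u: "u \<in> inf_paths G" and v: "v \<in> inf_paths G" using that(2,3) x y z by blast+
    then show "u i \<in> arcs G" "v i \<in> arcs G" by (simp_all add: inf_paths_arc)
    have "tail G (u 0) = tail G (v 0)" using that(2,3) t by force
    then show "tail G (u i) = tail G (v i)"
      by (rule tail_eq_of_agree[OF u v]) (use that(1) in blast)
  qed
  \<comment> \<open>Both \<open>u i\<close> and \<open>v i\<close> are compared with the common
    letter \<open>\<tau>h (u (i - 1))\<close>.\<close>
  have via: "real (hdist (u i) (v i)) \<le> jump u (i - 1) + jump v (i - 1)"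
    if A: "?A u v" "0 < i" and uv: "u \<in> {x, y, z}" "v \<in> {x, y, z}" for u v
  proof -
    have eq: "u (i - 1) = v (i - 1)" using A by simp
    have u: "u \<in> inf_paths G" and v: "v \<in> inf_paths G" using uv x y z by blast+
    have "(\<tau>h (u (i - 1)), u i) \<in> H\<^sup>*" "(\<tau>h (v (i - 1)), v i) \<in> H\<^sup>*"
      by (intro connected \<tau>h_arc inf_paths_arc \<tau>h_tail_path u v A(2))+
    moreover from this have "(u i, \<tau>h (u (i - 1))) \<in> H\<^sup>*"
      using H_sym by (meson sym_rtrancl symD)
    ultimately have "hdist (u i) (v i) \<le> hdist (u i) (\<tau>h (u (i - 1))) + hdist (\<tau>h (u (i - 1))) (v i)"
      unfolding eq by (intro hdist_triangle)
    then show ?thesis using A(2) unfolding jump_def eq by (simp add: hdist_sym[of "u i"])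
  qed
  \<comment> \<open>With the base point in common, exchanging the actual letter changes the distance
    to it by at most the distance between the letters.\<close>
  have step: "jump u (i - 1) \<le> jump v (i - 1) + real (hdist (v i) (u i))"
    if A: "?A u v" "0 < i" and uv: "u \<in> {x, y, z}" "v \<in> {x, y, z}" for u v
  proof -
    have eq: "u (i - 1) = v (i - 1)" using A by simp
    have v: "v \<in> inf_paths G" using uv x y z by blast
    have "(\<tau>h (v (i - 1)), v i) \<in> H\<^sup>*"
      by (intro connected \<tau>h_arc inf_paths_arc \<tau>h_tail_path v A(2))
    moreover have "(v i, u i) \<in> H\<^sup>*" using A(1) by (intro conn uv) simp
    ultimately have "hdist (\<tau>h (v (i - 1))) (u i) \<le> hdist (\<tau>h (v (i - 1))) (v i) + hdist (v i) (u i)"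
      by (rule hdist_triangle)
    then show ?thesis using A(2) unfolding jump_def eq by simp
  qed
  \<comment> \<open>Agreement below \<open>i\<close> is an equivalence relation: all three agree, or
    \<open>y\<close> agrees with exactly one of the others, or \<open>y\<close> is separated from
    both.\<close>
  consider "?A x y" "?A y z" "?A x z" | "?A x y" "\<not> ?A y z" "\<not> ?A x z"
    | "\<not> ?A x y" "?A y z" "\<not> ?A x z" | "\<not> ?A x y" "\<not> ?A y z"
    by force
  then show ?thesis
  proof cases
    case 1
    have "hdist (x i) (z i) \<le> hdist (x i) (y i) + hdist (y i) (z i)"
      using 1 by (intro hdist_triangle conn) simp_all
    then show ?thesis
      unfolding dcoeff_joint[OF 1(1)] dcoeff_joint[OF 1(2)] dcoeff_joint[OF 1(3)] by linarith
  next
    case 2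
    then have "0 < i" by (auto intro: gr0I)
    then show ?thesis
      using step[of x y] 2(1) unfolding dcoeff_joint[OF 2(1)] dcoeff_separate[OF 2(2)] dcoeff_separate[OF 2(3)]
      by (simp add: hdist_sym[of "y i"])
  next
    case 3
    then have "0 < i" by (auto intro: gr0I)
    then show ?thesis
      using step[of z y] 3(2) unfolding dcoeff_joint[OF 3(2)] dcoeff_separate[OF 3(1)] dcoeff_separate[OF 3(3)]
      by simp
  next
    case 4
    then have "0 < i" by (auto intro: gr0I)
    \<comment> \<open>Here \<open>x\<close> and \<open>z\<close> may still agree with each other;
      then \<open>via\<close> applies. The right-hand side has two jumps of \<open>y\<close> to
      spare.\<close>
    have "dcoeff x z i \<le> jump x (i - 1) + jump z (i - 1)"
    proof (cases "?A x z")
      case True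
      then show ?thesis unfolding dcoeff_joint[OF True] using \<open>0 < i\<close> by (intro via) simp_all
    next
      case False
      then show ?thesis by (simp only: dcoeff_separate[OF False] order.refl)
    qed
    then show ?thesis
      unfolding dcoeff_separate[OF 4(1)] dcoeff_separate[OF 4(2)]
      using jump_nonneg[of y "i - 1"] by linarith
  qed
qed

lemma pdist_nonneg: "x \<in> inf_paths G \<Longrightarrow> y \<in> inf_paths G \<Longrightarrow> 0 \<le> pdist x y"
  unfolding pdist_def using \<rho> by (intro suminf_nonneg summable_dcoeff) (simp_all add: dcoeff_nonneg)

lemma pdist_sym: "pdist x y = pdist y x"
  unfolding pdist_def by (simp add: dcoeff_sym[of x])

lemma pdist_self [simp]: "pdist x x = 0"
  unfolding pdist_def by (simp add: dcoeff_agree)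

lemma pdist_triangle:
  assumes "x \<in> inf_paths G" "y \<in> inf_paths G" "z \<in> inf_paths G"
    and "tail G (x 0) = tail G (y 0)" "tail G (y 0) = tail G (z 0)"
  shows "pdist x z \<le> pdist x y + pdist y z"
proof -
  have "pdist x z \<le> (\<Sum>i. dcoeff x y i * \<rho> ^ Suc i + dcoeff y z i * \<rho> ^ Suc i)"
    unfolding pdist_def
  proof (rule suminf_le)
    fix i show "dcoeff x z i * \<rho> ^ Suc i \<le> dcoeff x y i * \<rho> ^ Suc i + dcoeff y z i * \<rho> ^ Suc i"
      using mult_right_mono[OF dcoeff_triangle[OF assms, of i], of "\<rho> ^ Suc i"] \<rho>
      by (simp add: distrib_right)
  qed (intro summable_dcoeff summable_add assms)+
  also have "\<dots> = pdist x y + pdist y z"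
    unfolding pdist_def by (intro suminf_add[symmetric] summable_dcoeff assms)
  finally show ?thesis .
qed

text \<open>The first difference is at some \<open>m \<le> n\<close> and its coefficient is a
  positive integer, so this single term suffices. It separates points and puts small balls inside
  cylinders.\<close>

lemma pdist_ge:
  assumes "x \<in> inf_paths G" "y \<in> inf_paths G" "tail G (x 0) = tail G (y 0)" "x n \<noteq> y n"
  shows "\<rho> ^ Suc n \<le> pdist x y"
proof -
  from assms(4) have "x \<noteq> y" by auto
  then obtain m where m: "\<forall>i<m. x i = y i" "x m \<noteq> y m" by (rule first_difference)
  then have "m \<le> n" using assms(4) by (meson not_le)
  have "tail G (x m) = tail G (y m)"
    by (rule tail_eq_of_agree[OF assms(1,2,3)]) (use m(1) in blast)
  then have "(x m, y m) \<in> H\<^sup>*"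
    by (intro connected inf_paths_arc assms)
  then have "1 \<le> dcoeff x y m" using m hdist_pos by (simp add: dcoeff_def)
  have "\<rho> ^ Suc n \<le> \<rho> ^ Suc m"
    using \<open>m \<le> n\<close> \<rho> by (intro power_decreasing) auto
  also have "\<dots> \<le> dcoeff x y m * \<rho> ^ Suc m"
    using mult_right_mono[OF \<open>1 \<le> dcoeff x y m\<close>, of "\<rho> ^ Suc m"] \<rho> by simp
  also have "\<dots> \<le> pdist x y"
    unfolding pdist_def
    using sum_le_suminf[OF summable_dcoeff[OF assms(1,2)], of "{m}"] \<rho> by (simp add: dcoeff_nonneg)
  finally show ?thesis .
qed

text \<open>The first \<open>N\<close> coefficients vanish and the others are at most
  \<open>2 * hdiam\<close>, which leaves a geometric tail. It puts cylinders inside balls.\<close>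

lemma pdist_le_agree:
  assumes "x \<in> inf_paths G" "y \<in> inf_paths G" "\<forall>i<N. x i = y i"
  shows "pdist x y \<le> 2 * hdiam / (1 - \<rho>) * \<rho> ^ N"
proof -
  let ?f = "\<lambda>i. dcoeff x y i * \<rho> ^ Suc i"
  have sum: "summable ?f" using assms by (intro summable_dcoeff)
  have "(\<Sum>i<N. ?f i) = 0"
    by (rule sum.neutral) (use assms(3) in \<open>auto intro!: dcoeff_agree\<close>)
  then have "pdist x y = (\<Sum>i. ?f (i + N))"
    unfolding pdist_def using suminf_split_initial_segment[OF sum, of N] by simp
  also have "\<dots> \<le> (\<Sum>i. 2 * hdiam * \<rho> ^ N * \<rho> ^ i)"
  proof (rule suminf_le)
    fix i
    \<comment> \<open>One factor \<open>\<rho>\<close> is dropped here, which simplifies the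
      constant.\<close>
    have "?f (i + N) \<le> 2 * hdiam * \<rho> ^ (i + N)"
      using dcoeff_le[OF assms(1,2), of "i + N"] \<rho> hdiam_nonneg
      by (intro mult_mono power_decreasing) auto
    then show "?f (i + N) \<le> 2 * hdiam * \<rho> ^ N * \<rho> ^ i" by (simp add: power_add mult_ac)
  next
    show "summable (\<lambda>i. ?f (i + N))" using sum by (rule summable_ignore_initial_segment)
    show "summable (\<lambda>i. 2 * hdiam * \<rho> ^ N * \<rho> ^ i)"
      using \<rho> by (intro summable_mult summable_geometric) simp
  qed
  also have "\<dots> = 2 * hdiam * \<rho> ^ N * (1 / (1 - \<rho>))"
    using \<rho> by (subst suminf_mult) (simp_all add: summable_geometric suminf_geometric)
  finally show ?thesis by (simp add: mult_ac)
qed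

text \<open>Past index \<open>m\<close> both components follow \<open>\<tau>h\<close>, so every jump
  vanishes and only the term at \<open>m\<close>, with coefficient 1, remains. This makes distance
  functions of \<open>pdist\<close> admissible for the spectral distance.\<close>

lemma pdist_edge:
  assumes "(x, y) \<in> hor_edges_level G \<tau>h H (Suc m)"
  shows "pdist x y = \<rho> ^ Suc m"
proof -
  have H: "\<forall>i<m. x i = y i" "(x m, y m) \<in> H"
    and ext: "\<And>i. m \<le> i \<Longrightarrow> x (Suc i) = \<tau>h (x i)" "\<And>i. m \<le> i \<Longrightarrow> y (Suc i) = \<tau>h (y i)"
    using assms unfolding hor_edges_level_iff[OF H_subset] by auto
  have "x m \<noteq> y m" using H(2) H_subset by (auto simp: maximal_horizontal_def)
  have "dcoeff x y i = (if i = m then 1 else 0)" for i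
  proof (cases i m rule: linorder_cases)
    case less
    then show ?thesis using H(1) by (simp add: dcoeff_agree)
  next
    case equal
    then show ?thesis using H by (simp add: dcoeff_def hdist_H)
  next
    case greater
    then have "\<not> (\<forall>k<i. x k = y k)" using \<open>x m \<noteq> y m\<close> by blast
    then have "dcoeff x y i = jump x (i - 1) + jump y (i - 1)"
      by (rule dcoeff_separate)
    also have "\<dots> = 0"
      using ext[of "i - 1"] greater by (simp add: jump_def)
    finally show ?thesis using greater by simp
  qed
  then have "pdist x y = (\<Sum>i. if i = m then \<rho> ^ Suc i else 0)"
    unfolding pdist_def by (intro suminf_cong) simp
  also have "\<dots> = \<rho> ^ Suc m"
    using sums_single[of m "\<lambda>i. \<rho> ^ Suc i"] by (simp add: sums_iff)
  finally show ?thesis .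
qed

end

section \<open>The spectral distance\<close>

context horizontal_data
begin

section \<open>Admissible functions and infinite distances\<close>

lemma spectral_ball_iff:
  "f \<in> bounded_commutator_alg (path_space G) edges path_rep (dirac_dom G \<tau>h H \<rho>) (dirac G \<tau>h H \<rho>) \<and>
     operator_norm edges (dirac_dom G \<tau>h H \<rho>) (commutator (dirac G \<tau>h H \<rho>) (path_rep f)) \<le> 1
   \<longleftrightarrow> f \<in> cont_alg (path_space G) \<and>
     (\<forall>e\<in>edges. cmod (f (snd e) - f (fst e)) \<le> \<rho> ^ level G \<tau>h H e)"
proof -
  have "\<exists>C. \<forall>e\<in>edges. cmod (f (snd e) - f (fst e)) \<le> C * \<rho> ^ level G \<tau>h H e"
    if "\<forall>e\<in>edges. cmod (f (snd e) - f (fst e)) \<le> \<rho> ^ level G \<tau>h H e"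
    using that by (intro exI[of _ 1]) simp
  then show ?thesis
    unfolding bounded_commutator_alg_iff commutator_norm_le_1_iff by blast
qed

lemma path_dist_eq_SUP:
  "path_dist G \<tau>h H \<rho> x y = (SUP f\<in>{f \<in> cont_alg (path_space G).
     \<forall>e\<in>edges. cmod (f (snd e) - f (fst e)) \<le> \<rho> ^ level G \<tau>h H e}. ereal (cmod (f x - f y)))"
  unfolding path_dist_def spectral_distance_def spectral_ball_iff ..

lemma edge_tail:
  assumes "e \<in> edges"
  shows "tail G (fst e 0) = tail G (snd e 0)"
proof -
  obtain m where "(fst e, snd e) \<in> hor_edges_level G \<tau>h H (Suc m)"
    using assms by (auto simp: hor_edges_iff)
  then have "\<forall>i<m. fst e i = snd e i" "(fst e m, snd e m) \<in> H"
    unfolding hor_edges_level_iff[OF H_subset] by auto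
  then show ?thesis using H_subset by (cases m) (auto simp: maximal_horizontal_def)
qed

text \<open>A function of the start vertex alone is constant along every edge, so its commutator
  vanishes and it may be scaled without bound.\<close>

lemma path_dist_infinity:
  assumes "x \<in> inf_paths G" "y \<in> inf_paths G" "tail G (x 0) \<noteq> tail G (y 0)"
  shows "path_dist G \<tau>h H \<rho> x y = \<infinity>"
proof (rule ereal_top)
  fix B :: real
  define f where "f z = (if z \<in> inf_paths G \<and> tail G (z 0) = tail G (x 0)
      then complex_of_real \<bar>B\<bar> else 0)" for z
  have "continuous_map (path_space G) euclidean f"
    by (rule continuous_of_locally_constant[of "Suc 0"]) (auto simp: f_def)
  then have "f \<in> cont_alg (path_space G)" by (simp add: cont_alg_def) (simp add: f_def)
  moreover have "cmod (f (snd e) - f (fst e)) \<le> \<rho> ^ level G \<tau>h H e" if "e \<in> edges" for e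
    using hor_edges_in_paths[OF that] edge_tail[OF that] \<rho> by (simp add: f_def)
  moreover have "ereal B \<le> ereal (cmod (f x - f y))"
    using assms by (simp add: f_def)
  ultimately show "ereal B \<le> path_dist G \<tau>h H \<rho> x y"
    unfolding path_dist_eq_SUP by (intro SUP_upper2[of f]) auto
qed

lemma hor_edge_graft:
  assumes "x \<in> inf_paths G" "(a, b) \<in> H" "tail G a = tail G (x m)"
  shows "(graft \<tau>h m x a, graft \<tau>h m x b) \<in> hor_edges_level G \<tau>h H (Suc m)"
proof -
  have "a \<in> arcs G" "b \<in> arcs G" "tail G b = tail G (x m)"
    using assms(2,3) H_subset by (auto simp: maximal_horizontal_def)
  then show ?thesis
    unfolding hor_edges_level_iff[OF H_subset] using assms by (simp add: graft_path)
qed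

text \<open>Each step of a chain in \<open>H\<close> is an edge of level \<open>Suc m\<close>
  between grafts with the same prefix and costs one weight.\<close>

lemma lipschitz_graft_relpow:
  fixes f :: "(nat \<Rightarrow> 'e) \<Rightarrow> complex"
  assumes lip: "\<And>e. e \<in> edges \<Longrightarrow> cmod (f (snd e) - f (fst e)) \<le> \<rho> ^ level G \<tau>h H e"
    and x: "x \<in> inf_paths G" and a: "tail G a = tail G (x m)"
  shows "(a, b) \<in> H ^^ k \<Longrightarrow> cmod (f (graft \<tau>h m x b) - f (graft \<tau>h m x a)) \<le> real k * \<rho> ^ Suc m"
proof (induction k arbitrary: b)
  case (Suc k)
  then obtain c where c: "(a, c) \<in> H ^^ k" "(c, b) \<in> H" by (meson relpow_Suc_E)
  let ?g = "\<lambda>a. graft \<tau>h m x a"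
  have "tail G c = tail G (x m)"
    using a rtrancl_H_tail[OF relpow_imp_rtrancl[OF c(1)]] by simp
  then have e: "(?g c, ?g b) \<in> hor_edges_level G \<tau>h H (Suc m)"
    by (rule hor_edge_graft[OF x c(2)])
  then have "(?g c, ?g b) \<in> edges" unfolding hor_edges_iff by blast
  from lip[OF this] have "cmod (f (?g b) - f (?g c)) \<le> \<rho> ^ Suc m"
    unfolding level_eq[OF e] by simp
  moreover have "cmod (f (?g c) - f (?g a)) \<le> real k * \<rho> ^ Suc m"
    by (rule Suc.IH[OF c(1)])
  moreover have "cmod (f (?g b) - f (?g a)) \<le> cmod (f (?g b) - f (?g c)) + cmod (f (?g c) - f (?g a))"
    using norm_triangle_ineq[of "f (?g b) - f (?g c)" "f (?g c) - f (?g a)"] by simp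
  ultimately show ?case by (simp add: distrib_right)
qed simp

end

context connected_horizontal_data
begin

section \<open>Upper bound along truncations and attainment\<close>

lemma lipschitz_graft:
  fixes f :: "(nat \<Rightarrow> 'e) \<Rightarrow> complex"
  assumes lip: "\<And>e. e \<in> edges \<Longrightarrow> cmod (f (snd e) - f (fst e)) \<le> \<rho> ^ level G \<tau>h H e"
    and x: "x \<in> inf_paths G" and "a \<in> arcs G" "b \<in> arcs G"
    and "tail G a = tail G (x m)" "tail G b = tail G (x m)"
  shows "cmod (f (graft \<tau>h m x b) - f (graft \<tau>h m x a)) \<le> real (hdist a b) * \<rho> ^ Suc m"
proof (rule lipschitz_graft_relpow[OF lip x assms(5)])
  show "(a, b) \<in> H ^^ hdist a b"
    using assms by (intro relpow_hdist connected) simp_all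
qed

text \<open>While the prefixes agree, the truncations are joined by one chain of level
  \<open>Suc n\<close>. After the split, lengthening both truncations by a letter costs one jump on
  each side, which is the coefficient of the new level.\<close>

lemma lipschitz_truncated:
  fixes f :: "(nat \<Rightarrow> 'e) \<Rightarrow> complex"
  assumes lip: "\<And>e. e \<in> edges \<Longrightarrow> cmod (f (snd e) - f (fst e)) \<le> \<rho> ^ level G \<tau>h H e"
    and x: "x \<in> inf_paths G" and y: "y \<in> inf_paths G" and t: "tail G (x 0) = tail G (y 0)"
  shows "cmod (f (graft \<tau>h n x (x n)) - f (graft \<tau>h n y (y n))) \<le> (\<Sum>i\<le>n. dcoeff x y i * \<rho> ^ Suc i)"
proof -
  have same: "cmod (f (graft \<tau>h n x (x n)) - f (graft \<tau>h n y (y n))) \<le> dcoeff x y n * \<rho> ^ Suc n"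
    if agree: "\<forall>k<n. x k = y k" for n
  proof -
    have eq: "graft \<tau>h n y (y n) = graft \<tau>h n x (y n)" using agree by (intro graft_cong) simp
    have "tail G (x n) = tail G (y n)" by (rule tail_eq_of_agree[OF x y t]) (use agree in blast)
    then show ?thesis
      using lipschitz_graft[OF lip x, of "y n" "x n" n] agree
      by (simp add: eq dcoeff_def hdist_sym[of "x n"] inf_paths_arc x y)
  qed
  have jump: "cmod (f (graft \<tau>h (Suc n) z (z (Suc n))) - f (graft \<tau>h n z (z n))) \<le> jump z n * \<rho> ^ Suc (Suc n)"
    if z: "z \<in> inf_paths G" for z n
    using lipschitz_graft[OF lip z, of "\<tau>h (z n)" "z (Suc n)" "Suc n"] \<tau>h_tail_path[OF z, of "Suc n"]
    by (simp add: graft_Suc_\<tau>h jump_def inf_paths_arc \<tau>h_arc z)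
  show ?thesis
  proof (induction n)
    case 0
    show ?case using same[of 0] by simp
  next
    case (Suc n)
    let ?P = "\<lambda>n z. f (graft \<tau>h n z (z n))"
    show ?case
    proof (cases "\<forall>k<Suc n. x k = y k")
      case True
      \<comment> \<open>The new level alone bounds the difference here; of the earlier terms only
        the sign matters.\<close>
      have "0 \<le> (\<Sum>i\<le>n. dcoeff x y i * \<rho> ^ Suc i)"
        using \<rho> by (intro sum_nonneg) (simp add: dcoeff_nonneg)
      then show ?thesis using same[OF True] by simp
    next
      case False
      have d: "dcoeff x y (Suc n) = jump x n + jump y n"
        using dcoeff_separate[OF False] by simp
      \<comment> \<open>Back to the shorter truncation of \<open>x\<close>, across to that of
        \<open>y\<close>, and forward again.\<close>
      have "?P (Suc n) x - ?P (Suc n) y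
          = (?P (Suc n) x - ?P n x) + (?P n x - ?P n y) - (?P (Suc n) y - ?P n y)" by simp
      then have "cmod (?P (Suc n) x - ?P (Suc n) y)
          \<le> cmod (?P (Suc n) x - ?P n x) + cmod (?P n x - ?P n y) + cmod (?P (Suc n) y - ?P n y)"
        by (smt (verit) norm_triangle_ineq norm_triangle_ineq4)
      then show ?thesis
        using Suc.IH jump[OF x, of n] jump[OF y, of n] by (simp add: d distrib_right)
    qed
  qed
qed

lemma truncated_tendsto:
  fixes f :: "(nat \<Rightarrow> 'e) \<Rightarrow> complex"
  assumes f: "f \<in> cont_alg (path_space G)" and x: "x \<in> inf_paths G"
  shows "(\<lambda>n. f (graft \<tau>h n x (x n))) \<longlonglongrightarrow> f x"
proof (rule LIMSEQ_I)
  fix \<delta> :: real assume "0 < \<delta>"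
  then obtain N where N: "\<And>y. y \<in> inf_paths G \<Longrightarrow> \<forall>i<N. y i = x i \<Longrightarrow> cmod (f y - f x) < \<delta>"
    using f x unfolding cont_alg_def continuous_map_path_space_iff by blast
  have "norm (f (graft \<tau>h n x (x n)) - f x) < \<delta>" if "N \<le> n" for n
    using that by (intro N graft_path x inf_paths_arc) auto
  then show "\<exists>N. \<forall>n\<ge>N. norm (f (graft \<tau>h n x (x n)) - f x) < \<delta>" by blast
qed

lemma lipschitz_le_pdist:
  assumes f: "f \<in> cont_alg (path_space G)"
    and lip: "\<And>e. e \<in> edges \<Longrightarrow> cmod (f (snd e) - f (fst e)) \<le> \<rho> ^ level G \<tau>h H e"
    and x: "x \<in> inf_paths G" and y: "y \<in> inf_paths G" and t: "tail G (x 0) = tail G (y 0)"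
  shows "cmod (f x - f y) \<le> pdist x y"
proof (rule LIMSEQ_le_const2)
  show "(\<lambda>n. cmod (f (graft \<tau>h n x (x n)) - f (graft \<tau>h n y (y n)))) \<longlonglongrightarrow> cmod (f x - f y)"
    by (intro tendsto_norm tendsto_diff truncated_tendsto f x y)
  have "(\<Sum>i\<le>n. dcoeff x y i * \<rho> ^ Suc i) \<le> pdist x y" for n
    unfolding pdist_def using \<rho>
    by (intro sum_le_suminf summable_dcoeff x y) (auto simp: dcoeff_nonneg)
  then show "\<exists>N. \<forall>n\<ge>N. cmod (f (graft \<tau>h n x (x n)) - f (graft \<tau>h n y (y n))) \<le> pdist x y"
    using lipschitz_truncated[OF lip x y t] by (meson order_trans)
qed

lemma pdist_diff_le:
  assumes "x \<in> inf_paths G" "y \<in> inf_paths G" "z \<in> inf_paths G"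
    and "tail G (x 0) = tail G (y 0)" "tail G (x 0) = tail G (z 0)"
  shows "\<bar>pdist x y - pdist x z\<bar> \<le> pdist y z"
  using pdist_triangle[of x y z] pdist_triangle[of x z y] assms by (simp add: pdist_sym[of z y])

text \<open>\<open>0 < N\<close> is recorded so that paths agreeing below \<open>N\<close> share
  their first letter and hence their start vertex.\<close>

lemma ex_pdist_small:
  assumes "0 < \<delta>"
  obtains N where "\<And>x y. x \<in> inf_paths G \<Longrightarrow> y \<in> inf_paths G \<Longrightarrow> \<forall>i<N. x i = y i \<Longrightarrow> pdist x y < \<delta>"
    and "0 < N"
proof -
  have "(\<lambda>N. 2 * hdiam / (1 - \<rho>) * \<rho> ^ N) \<longlonglongrightarrow> 2 * hdiam / (1 - \<rho>) * 0"
    using \<rho> by (intro tendsto_mult tendsto_const LIMSEQ_power_zero) simp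
  then have "eventually (\<lambda>N. 2 * hdiam / (1 - \<rho>) * \<rho> ^ N < \<delta>) sequentially"
    using assms by (intro order_tendstoD(2)) auto
  then have "eventually (\<lambda>N. 2 * hdiam / (1 - \<rho>) * \<rho> ^ N < \<delta> \<and> 0 < N) sequentially"
    using eventually_gt_at_top[of 0] by eventually_elim blast
  then obtain N where "2 * hdiam / (1 - \<rho>) * \<rho> ^ N < \<delta>" "0 < N"
    by (auto simp: eventually_sequentially)
  then show ?thesis
    using that[of N] order.strict_trans1[OF pdist_le_agree] by simp
qed

text \<open>The supremum is attained at the function \<open>pdist x\<close>.\<close>

lemma path_dist_eq_pdist:
  assumes x: "x \<in> inf_paths G" and y: "y \<in> inf_paths G" and t: "tail G (x 0) = tail G (y 0)"
  shows "path_dist G \<tau>h H \<rho> x y = ereal (pdist x y)"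
  unfolding path_dist_eq_SUP
proof (rule antisym)
  show "(SUP f\<in>{f \<in> cont_alg (path_space G).
      \<forall>e\<in>edges. cmod (f (snd e) - f (fst e)) \<le> \<rho> ^ level G \<tau>h H e}. ereal (cmod (f x - f y))) \<le> ereal (pdist x y)"
    using lipschitz_le_pdist x y t by (intro SUP_least) auto
  \<comment> \<open>Setting \<open>f\<close> to 0 for other start vertices is compatible with
    continuity, since the first letter determines the start vertex, and with the bound along edges,
    since an edge joins paths with the same start vertex.\<close>
  define f where "f z = (if z \<in> inf_paths G \<and> tail G (x 0) = tail G (z 0)
      then complex_of_real (pdist x z) else 0)" for z
  have "continuous_map (path_space G) euclidean f"
    unfolding continuous_map_path_space_iff
  proof (intro ballI allI impI)
    fix u and \<delta> :: real assume u: "u \<in> inf_paths G" and "0 < \<delta>"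
    obtain N where N: "\<And>x y. x \<in> inf_paths G \<Longrightarrow> y \<in> inf_paths G \<Longrightarrow> \<forall>i<N. x i = y i \<Longrightarrow> pdist x y < \<delta>"
      and "0 < N" using ex_pdist_small[OF \<open>0 < \<delta>\<close>] by blast
    have "cmod (f v - f u) < \<delta>" if v: "v \<in> inf_paths G" and agree: "\<forall>i<N. v i = u i" for v
    proof (cases "tail G (x 0) = tail G (u 0)")
      case True
      moreover have "v 0 = u 0" using agree \<open>0 < N\<close> by blast
      ultimately have "\<bar>pdist x v - pdist x u\<bar> \<le> pdist v u" "f v - f u = complex_of_real (pdist x v - pdist x u)"
        using pdist_diff_le[OF x v u] u v by (simp_all add: f_def)
      then show ?thesis using N[OF v u agree] by (simp only: norm_of_real)
    next
      case False
      moreover have "v 0 = u 0" using agree \<open>0 < N\<close> by blast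
      ultimately show ?thesis using \<open>0 < \<delta>\<close> by (simp add: f_def)
    qed
    then show "\<exists>N. \<forall>v\<in>inf_paths G. (\<forall>i<N. v i = u i) \<longrightarrow> cmod (f v - f u) < \<delta>" by blast
  qed
  then have "f \<in> cont_alg (path_space G)" by (simp add: cont_alg_def) (simp add: f_def)
  moreover have "cmod (f (snd e) - f (fst e)) \<le> \<rho> ^ level G \<tau>h H e" if e: "e \<in> edges" for e
  proof -
    from e obtain m where m: "e \<in> hor_edges_level G \<tau>h H (Suc m)" by (auto simp: hor_edges_iff)
    then have dist: "pdist (snd e) (fst e) = \<rho> ^ level G \<tau>h H e"
      using pdist_edge[of "fst e" "snd e" m] level_eq[OF m] by (simp add: pdist_sym[of "snd e"])
    note paths = hor_edges_in_paths[OF e]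
    show ?thesis
    proof (cases "tail G (x 0) = tail G (fst e 0)")
      case True
      then have "f (snd e) - f (fst e) = complex_of_real (pdist x (snd e) - pdist x (fst e))"
        using paths edge_tail[OF e] by (simp add: f_def)
      moreover have "\<bar>pdist x (snd e) - pdist x (fst e)\<bar> \<le> pdist (snd e) (fst e)"
        using True edge_tail[OF e] by (intro pdist_diff_le x paths) simp_all
      ultimately show ?thesis by (simp only: norm_of_real dist)
    next
      case False
      then show ?thesis using edge_tail[OF e] \<rho> by (simp add: f_def)
    qed
  qed
  moreover have "ereal (pdist x y) \<le> ereal (cmod (f x - f y))"
    using x y t pdist_nonneg[OF x y] by (simp add: f_def)
  ultimately show "ereal (pdist x y) \<le> (SUP f\<in>{f \<in> cont_alg (path_space G).
      \<forall>e\<in>edges. cmod (f (snd e) - f (fst e)) \<le> \<rho> ^ level G \<tau>h H e}. ereal (cmod (f x - f y)))"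
    by (intro SUP_upper2[of f]) auto
qed

section \<open>Topology and explicit formula\<close>

lemma path_dist_cases:
  assumes "x \<in> inf_paths G" "y \<in> inf_paths G"
  shows "path_dist G \<tau>h H \<rho> x y = (if tail G (x 0) = tail G (y 0) then ereal (pdist x y) else \<infinity>)"
  using assms by (simp add: path_dist_eq_pdist path_dist_infinity)

lemma path_dist_ge:
  assumes "x \<in> inf_paths G" "y \<in> inf_paths G" "x n \<noteq> y n"
  shows "ereal (\<rho> ^ Suc n) \<le> path_dist G \<tau>h H \<rho> x y"
  using assms pdist_ge[OF assms(1,2) _ assms(3)] by (simp add: path_dist_cases)

text \<open>Balls and cylinders are nested both ways: a difference at index \<open>i\<close> forces
  distance at least \<open>\<rho> ^ Suc i\<close>, and a long common prefix forces small distance.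
  Paths from another vertex lie outside every ball of finite radius.\<close>

lemma compatible_path_dist:
  "compatible_extended_metric (path_space G) (path_dist G \<tau>h H \<rho>)"
  unfolding compatible_extended_metric_def topspace_path_space
proof (intro conjI ballI allI)
  fix x y assume x: "x \<in> inf_paths G" and y: "y \<in> inf_paths G"
  show "0 \<le> path_dist G \<tau>h H \<rho> x y"
    using pdist_nonneg[OF x y] by (simp add: path_dist_cases x y)
  show "path_dist G \<tau>h H \<rho> x y = path_dist G \<tau>h H \<rho> y x"
    by (simp add: path_dist_cases x y pdist_sym[of x] eq_commute[of "tail G (x 0)"])
  show "path_dist G \<tau>h H \<rho> x y = 0 \<longleftrightarrow> x = y"
  proof
    assume zero: "path_dist G \<tau>h H \<rho> x y = 0"
    show "x = y"
    proof
      fix n show "x n = y n"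
      proof (rule ccontr)
        assume "x n \<noteq> y n"
        from path_dist_ge[OF x y this] have "\<rho> ^ Suc n \<le> 0" unfolding zero by simp
        then show False using \<rho> zero_less_power[of \<rho> "Suc n"] by linarith
      qed
    qed
  next
    assume "x = y"
    then show "path_dist G \<tau>h H \<rho> x y = 0" using x by (simp add: path_dist_cases zero_ereal_def)
  qed
next
  fix x y z assume "x \<in> inf_paths G" "y \<in> inf_paths G" "z \<in> inf_paths G"
  then show "path_dist G \<tau>h H \<rho> x z \<le> path_dist G \<tau>h H \<rho> x y + path_dist G \<tau>h H \<rho> y z"
    using pdist_triangle[of x y z] by (auto simp: path_dist_cases)
next
  fix U :: "(nat \<Rightarrow> 'e) set"
  show "openin (path_space G) U \<longleftrightarrow> U \<subseteq> inf_paths G \<and>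
      (\<forall>x\<in>U. \<exists>\<delta>>0. \<forall>y\<in>inf_paths G. path_dist G \<tau>h H \<rho> x y < ereal \<delta> \<longrightarrow> y \<in> U)"
    unfolding openin_path_space_iff
  proof (intro conj_cong refl ball_cong)
    fix x assume U: "U \<subseteq> inf_paths G" and "x \<in> U"
    then have x: "x \<in> inf_paths G" by blast
    show "(\<exists>N. \<forall>y\<in>inf_paths G. (\<forall>i<N. y i = x i) \<longrightarrow> y \<in> U) \<longleftrightarrow>
        (\<exists>\<delta>>0. \<forall>y\<in>inf_paths G. path_dist G \<tau>h H \<rho> x y < ereal \<delta> \<longrightarrow> y \<in> U)"
    proof
      assume "\<exists>N. \<forall>y\<in>inf_paths G. (\<forall>i<N. y i = x i) \<longrightarrow> y \<in> U"
      then obtain N where N: "\<And>y. y \<in> inf_paths G \<Longrightarrow> \<forall>i<N. y i = x i \<Longrightarrow> y \<in> U" by blast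
      \<comment> \<open>The radius \<open>\<rho> ^ N\<close> works because a difference at
        \<open>i < N\<close> would already cost
        \<open>\<rho> ^ Suc i \<ge> \<rho> ^ N\<close>.\<close>
      have "y \<in> U" if y: "y \<in> inf_paths G" and less: "path_dist G \<tau>h H \<rho> x y < ereal (\<rho> ^ N)" for y
      proof (rule N[OF y], intro allI impI)
        fix i assume "i < N"
        show "y i = x i"
        proof (rule ccontr)
          assume "y i \<noteq> x i"
          then have "ereal (\<rho> ^ Suc i) \<le> path_dist G \<tau>h H \<rho> x y"
            by (intro path_dist_ge x y) simp
          also note less
          finally have "\<rho> ^ Suc i < \<rho> ^ N" by simp
          moreover have "\<rho> ^ N \<le> \<rho> ^ Suc i"
            using \<rho> \<open>i < N\<close> by (intro power_decreasing) auto
          ultimately show False by linarith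
        qed
      qed
      moreover have "0 < \<rho> ^ N" using \<rho> by simp
      ultimately show "\<exists>\<delta>>0. \<forall>y\<in>inf_paths G. path_dist G \<tau>h H \<rho> x y < ereal \<delta> \<longrightarrow> y \<in> U" by blast
    next
      assume "\<exists>\<delta>>0. \<forall>y\<in>inf_paths G. path_dist G \<tau>h H \<rho> x y < ereal \<delta> \<longrightarrow> y \<in> U"
      then obtain \<delta> where "0 < \<delta>"
        and \<delta>: "\<And>y. y \<in> inf_paths G \<Longrightarrow> path_dist G \<tau>h H \<rho> x y < ereal \<delta> \<Longrightarrow> y \<in> U" by blast
      obtain N where N: "\<And>x y. x \<in> inf_paths G \<Longrightarrow> y \<in> inf_paths G \<Longrightarrow> \<forall>i<N. x i = y i \<Longrightarrow> pdist x y < \<delta>"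
        and "0 < N" using ex_pdist_small[OF \<open>0 < \<delta>\<close>] by blast
      have "y \<in> U" if y: "y \<in> inf_paths G" and agree: "\<forall>i<N. y i = x i" for y
      proof (rule \<delta>[OF y])
        have "y 0 = x 0" using agree \<open>0 < N\<close> by blast
        moreover have "pdist x y < \<delta>" using agree by (intro N x y) simp
        ultimately show "path_dist G \<tau>h H \<rho> x y < ereal \<delta>" by (simp add: path_dist_cases x y)
      qed
      then show "\<exists>N. \<forall>y\<in>inf_paths G. (\<forall>i<N. y i = x i) \<longrightarrow> y \<in> U" by blast
    qed
  qed
qed

lemma branch_coeff_eq:
  assumes "x \<in> inf_paths G"
  shows "branch_coeff G \<tau>h H x (Suc (Suc k)) = ereal (jump x k)"
proof -
  have "(\<tau>h (x k), x (Suc k)) \<in> H\<^sup>*"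
    using \<tau>h_tail_path[OF assms, of "Suc k"] by (intro connected \<tau>h_arc inf_paths_arc assms) simp
  then show ?thesis
    unfolding branch_coeff_def letter_def
    by (simp add: horizontal_dist_eq \<tau>h_arc inf_paths_arc assms jump_def)
qed

text \<open>For a common start vertex this is the series of \<open>pdist\<close> indexed by
  exponents: terms before the split vanish, the split term stands alone, and the later ones are
  pairs of jumps. For different start vertices both sides are \<open>\<infinity>\<close>.\<close>

lemma path_dist_formula:
  assumes x: "x \<in> inf_paths G" and y: "y \<in> inf_paths G" and "x \<noteq> y"
  shows "path_dist G \<tau>h H \<rho> x y =
    split_coeff G H x y * ereal (\<rho> ^ split_index x y)
    + (\<Sum>n. if n > split_index x y
             then (branch_coeff G \<tau>h H x n + branch_coeff G \<tau>h H y n) * ereal (\<rho> ^ n)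
             else 0)"
proof -
  obtain m where m: "\<forall>i<m. x i = y i" "x m \<noteq> y m" using \<open>x \<noteq> y\<close> by (rule first_difference)
  note split = split_index_eq[OF m]
  show ?thesis
  proof (cases "tail G (x 0) = tail G (y 0)")
    case True
    have "tail G (x m) = tail G (y m)"
      by (rule tail_eq_of_agree[OF x y True]) (use m(1) in blast)
    then have "split_coeff G H x y = ereal (real (hdist (x m) (y m)))"
      unfolding split_coeff_def split letter_def
      by (simp add: horizontal_dist_eq connected inf_paths_arc x y)
    then have coeff: "split_coeff G H x y = ereal (dcoeff x y m)" using m(1) by (simp add: dcoeff_def)
    \<comment> \<open>The part beyond the split; the exponent \<open>n\<close> belongs to the
      coefficient at index \<open>n - 1\<close>.\<close>
    define s where "s n = (if Suc m < n then dcoeff x y (n - 1) * \<rho> ^ n else 0)" for n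
    have summand: "(if n > split_index x y
        then (branch_coeff G \<tau>h H x n + branch_coeff G \<tau>h H y n) * ereal (\<rho> ^ n) else 0) = ereal (s n)" for n
    proof (cases "Suc m < n")
      case True
      \<comment> \<open>Beyond the split \<open>n\<close> is at least 2, so both branch coefficients
        are jumps at \<open>k\<close>.\<close>
      then obtain k where k: "n = Suc (Suc k)" by (metis less_imp_Suc_add add_Suc)
      then have "\<not> (\<forall>i<Suc k. x i = y i)" using m(2) True by auto
      from dcoeff_separate[OF this] have "dcoeff x y (Suc k) = jump x k + jump y k" by simp
      then show ?thesis using True by (simp add: split s_def k branch_coeff_eq x y)
    qed (simp add: split s_def zero_ereal_def)
    \<comment> \<open>\<open>F\<close> lists the terms of \<open>pdist\<close> by exponent, with the
      filler 0 at exponent 0. Removing the split term from it leaves \<open>s\<close>.\<close>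
    define F where "F n = (if n = 0 then 0 else dcoeff x y (n - 1) * \<rho> ^ n)" for n
    have "(\<lambda>i. F (Suc i)) sums pdist x y"
      unfolding F_def pdist_def using summable_sums[OF summable_dcoeff[OF x y]] by simp
    then have "F sums pdist x y" using sums_Suc[of F "pdist x y"] by (simp add: F_def)
    moreover have "(\<lambda>n. if n = Suc m then dcoeff x y m * \<rho> ^ n else 0) sums (dcoeff x y m * \<rho> ^ Suc m)"
      by (rule sums_single)
    ultimately have "(\<lambda>n. F n - (if n = Suc m then dcoeff x y m * \<rho> ^ n else 0))
        sums (pdist x y - dcoeff x y m * \<rho> ^ Suc m)"
      by (rule sums_diff)
    moreover have "F n - (if n = Suc m then dcoeff x y m * \<rho> ^ n else 0) = s n" for n
    proof (cases n "Suc m" rule: linorder_cases)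
      case less
      then have "n = 0 \<or> dcoeff x y (n - 1) = 0" using m(1) by (auto intro!: dcoeff_agree)
      then show ?thesis using less by (auto simp: F_def s_def)
    qed (simp_all add: F_def s_def)
    ultimately have "s sums (pdist x y - dcoeff x y m * \<rho> ^ Suc m)" by simp
    then have "(\<lambda>n. ereal (s n)) sums ereal (pdist x y - dcoeff x y m * \<rho> ^ Suc m)"
      by (simp only: sums_ereal)
    then have "(\<Sum>n. ereal (s n)) = ereal (pdist x y - dcoeff x y m * \<rho> ^ Suc m)"
      by (rule sums_unique[symmetric])
    then show ?thesis
      unfolding summand by (simp add: coeff split path_dist_eq_pdist[OF x y True])
  next
    case False
    \<comment> \<open>The paths split at the first letter. No chain in \<open>H\<close> joins
      letters with different tails, so the split coefficient is \<open>\<infinity>\<close> and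
      absorbs the remaining series.\<close>
    then have "m = 0" using m(1) by (metis gr0I)
    have "(x 0, y 0) \<notin> H\<^sup>*" using False rtrancl_H_tail by blast
    then have "split_coeff G H x y = \<infinity>"
      unfolding split_coeff_def split letter_def \<open>m = 0\<close> by (simp add: horizontal_dist_infinity)
    then show ?thesis
      using \<rho> by (simp add: path_dist_infinity[OF x y False] split)
  qed
qed

end

theorem theorem3p3:
  fixes G :: "('v, 'e) pre_digraph"
    and lstar :: 'e
    and \<tau>h :: "'e \<Rightarrow> 'e"
    and H Hp Hm :: "('e \<times> 'e) set"
    and \<rho> :: real
  assumes "horizontal_data G lstar \<tau>h H Hp Hm \<rho>"
  shows "(H \<noteq> {} \<longrightarrow>
            even_spectral_triple (path_space G) (hor_edges G \<tau>h H) path_rep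
              (dirac_dom G \<tau>h H \<rho>) (dirac G \<tau>h H \<rho>) (grading G \<tau>h Hp) \<and>
            faithful_representation (path_space G) (hor_edges G \<tau>h H) path_rep)
       \<and> (sufficiently_large G H \<longrightarrow>
            compatible_extended_metric (path_space G) (path_dist G \<tau>h H \<rho>) \<and>
            (\<forall>x\<in>inf_paths G. \<forall>y\<in>inf_paths G. x \<noteq> y \<longrightarrow>
               path_dist G \<tau>h H \<rho> x y =
                 split_coeff G H x y * ereal (\<rho> ^ split_index x y)
                 + (\<Sum>n. if n > split_index x y
                          then (branch_coeff G \<tau>h H x n + branch_coeff G \<tau>h H y n) * ereal (\<rho> ^ n)
                          else 0)))
       \<and> (H = maximal_horizontal G \<longrightarrow>
            (\<forall>x\<in>inf_paths G. \<forall>y\<in>inf_paths G.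
               x \<noteq> y \<and> tail G (letter x 1) = tail G (letter y 1) \<longrightarrow> split_coeff G H x y = 1) \<and>
            (\<forall>z\<in>inf_paths G. \<forall>n\<ge>2.
               branch_coeff G \<tau>h H z n = (if \<tau>h (letter z (n - 1)) \<noteq> letter z n then 1 else 0)))"
proof -
  interpret horizontal_data G lstar \<tau>h H Hp Hm \<rho> by fact
  have large: "compatible_extended_metric (path_space G) (path_dist G \<tau>h H \<rho>) \<and>
      (\<forall>x\<in>inf_paths G. \<forall>y\<in>inf_paths G. x \<noteq> y \<longrightarrow>
         path_dist G \<tau>h H \<rho> x y =
           split_coeff G H x y * ereal (\<rho> ^ split_index x y)
           + (\<Sum>n. if n > split_index x y
                    then (branch_coeff G \<tau>h H x n + branch_coeff G \<tau>h H y n) * ereal (\<rho> ^ n)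
                    else 0))" if "sufficiently_large G H"
  proof -
    interpret connected_horizontal_data G lstar \<tau>h H Hp Hm \<rho> by unfold_locales fact
    show ?thesis using compatible_path_dist path_dist_formula by blast
  qed
  have "split_coeff G H x y = 1"
    if "H = maximal_horizontal G" "x \<in> inf_paths G" "y \<in> inf_paths G"
      "x \<noteq> y \<and> tail G (letter x 1) = tail G (letter y 1)" for x y
  proof (rule split_coeff_maximal[OF that(1,2,3)])
    show "x \<noteq> y" "tail G (x 0) = tail G (y 0)" using that(4) by (simp_all add: letter_def)
  qed
  then show ?thesis
    by (intro conjI impI ballI allI even_spectral_triple_path_space faithful_representation_path_rep
        branch_coeff_maximal large[THEN conjunct1] large[THEN conjunct2, THEN bspec, THEN bspec, THEN mp])
qed

end
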